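(* For every integer $\rho\ge2$ and every graph $F$, every hereditary graph class that is $\rho$-controlled and excludes induced $(\le 2\rho+5)$-subdivisions of $F$ (i.e., no graph in the class has an induced subgraph isomorphic to a $(\le 2\rho+5)$-subdivision of $F$) is Burling-controlled.
   Context: Graphs are finite, simple, undirected and have at least one vertex; graph classes are closed under isomorphism; $\mathbb{N}=\{1,2,\ldots\}$. $\chi(G)$ is the chromatic number and $\omega(G)$ the maximum size of a clique of $G$; for $S\subseteq V(G)$, $\chi(S)$ is the chromatic number of $G[S]$; $N_G(v)$ is the set of neighbors of $v$ in $G$; $d_G$ is the shortest-path distance. For disjoint vertex sets $X,Y$, $XY$ denotes the set of edges $\{xy\colon x\in X,\,y\in Y\}$. A graph class is hereditary if it is closed under taking induced subgraphs. A $(\le r)$-subdivision of $F$ is a subdivision of $F$ in which every edge of $F$ has been subdivided by at most $r$ vertices (possibly none). For $\rho\ge2$ and $f\colon\mathbb{N}\to\mathbb{N}$, a graph $G$ is $(f,\rho)$-controlled if for every induced subgraph $H$ of $G$ and every $c\in\mathbb{N}$, $\max_{v\in V(H)}\chi(N_H^\rho[v])\le c$ implies $\chi(H)\le f(c)$, where $N_H^\rho[v]=\{x\in V(H)\colon d_H(v,x)\le\rho\}$. A graph class is $\rho$-controlled if there is $f\colon\mathbb{N}\to\mathbb{N}$ such that every graph in the class is $(f,\rho)$-controlled. Burling's sequence. A marked graph is a graph $G$ with a distinguished independent set of vertices $V_A(G)$; let $V_N(G)=V(G)\setminus V_A(G)$ and $E_N(G)=\{uv\in E(G)\colon u,v\in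 V_N(G)\}$. The marked graphs $B_k$ ($k\ge1$) are defined by: $V(B_1)=V_A(B_1)=\{a\}$, $E(B_1)=\emptyset$; $V(B_2)=\{b,a\}$, $V_A(B_2)=\{a\}$, $E(B_2)=\{ba\}$; and for $k\ge2$, with $A=V_A(B_k)$, for each $a\in A$ let $B^a$ be an isomorphic copy of $B_k$ on a new vertex set (all these vertex sets and $V(B_k)$ pairwise disjoint), let $A^a=V_A(B^a)$, and for each $a\in A$, $v\in A^a$ let $b^a_v,c^a_v$ be two new vertices; then $V(B_{k+1})=V_N(B_k)\cup\bigcup_{a\in A}\bigl(V(B^a)\cup\{b^a_v,c^a_v\colon v\in A^a\}\bigr)$, $V_A(B_{k+1})=\bigcup_{a\in A}\bigl(A^a\cup\{c^a_v\colon v\in A^a\}\bigr)$, $E(B_{k+1})=E_N(B_k)\cup\bigcup_{a\in A}\Bigl(E(B^a)\cup\bigcup_{v\in A^a}\bigl(N_{B^a}(v)\{b^a_v\}\cup\{b^a_vc^a_v\}\cup N_{B_k}(a)\{v,c^a_v\}\bigr)\Bigr)$. $\beta(G)$ is the maximum $k$ such that $B_k$ (as an ordinary graph) is isomorphic to an induced subgraph of $G$. A graph class $\mathcal{G}$ is Burling-controlled if there is $f\colon\mathbb{N}\times\mathbb{N}\to\mathbb{N}$ such that for every $G\in\mathcal{G}$, every induced subgraph $H$ of $G$ satisfies $\chi(H)\le f(\omega(H),\beta(H))$. *)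

theory Defs
  imports "HOL-Library.Extended_Nat" "HOL-Library.FuncSet"
begin

text \<open>Graphs: finite, simple, undirected, with at least one vertex. An edge is a two-element set.\<close>

record 'a ugraph =
  verts :: "'a set"
  edges :: "'a set set"

definition simple_graph :: "'a ugraph \<Rightarrow> bool" where
  "simple_graph G \<longleftrightarrow> finite (verts G) \<and> verts G \<noteq> {} \<and>
     (\<forall>e\<in>edges G. e \<subseteq> verts G \<and> card e = 2)"

definition nbrs :: "'a ugraph \<Rightarrow> 'a \<Rightarrow> 'a set" where
  "nbrs G v = {u. {u, v} \<in> edges G}"

definition graph_iso :: "'a ugraph \<Rightarrow> 'b ugraph \<Rightarrow> bool" where
  "graph_iso G H \<longleftrightarrow> (\<exists>\<phi>. bij_betw \<phi> (verts G) (verts H) \<and>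
     (\<forall>u\<in>verts G. \<forall>v\<in>verts G. {u, v} \<in> edges G \<longleftrightarrow> {\<phi> u, \<phi> v} \<in> edges H))"

definition induced :: "'a ugraph \<Rightarrow> 'a set \<Rightarrow> 'a ugraph" where
  "induced G S = \<lparr>verts = S, edges = {e \<in> edges G. e \<subseteq> S}\<rparr>"

definition induced_subgraph :: "'a ugraph \<Rightarrow> 'a ugraph \<Rightarrow> bool" where
  "induced_subgraph H G \<longleftrightarrow> (\<exists>S. S \<subseteq> verts G \<and> S \<noteq> {} \<and> H = induced G S)"

definition contains_induced :: "'b ugraph \<Rightarrow> 'a ugraph \<Rightarrow> bool" where
  "contains_induced K G \<longleftrightarrow> (\<exists>H. induced_subgraph H G \<and> graph_iso K H)"

definition chromatic_number :: "'a ugraph \<Rightarrow> nat" where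
  "chromatic_number G = (LEAST k. \<exists>c :: 'a \<Rightarrow> nat. (\<forall>v\<in>verts G. c v < k) \<and>
     (\<forall>u\<in>verts G. \<forall>v\<in>verts G. {u, v} \<in> edges G \<longrightarrow> c u \<noteq> c v))"

definition clique :: "'a ugraph \<Rightarrow> 'a set \<Rightarrow> bool" where
  "clique G K \<longleftrightarrow> K \<subseteq> verts G \<and> (\<forall>u\<in>K. \<forall>v\<in>K. u \<noteq> v \<longrightarrow> {u, v} \<in> edges G)"

definition clique_number :: "'a ugraph \<Rightarrow> nat" where
  "clique_number G = Max {card K | K. clique G K}"

definition is_path :: "'a ugraph \<Rightarrow> 'a list \<Rightarrow> bool" where
  "is_path G p \<longleftrightarrow> p \<noteq> [] \<and> distinct p \<and> set p \<subseteq> verts G \<and>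
     (\<forall>i. Suc i < length p \<longrightarrow> {p ! i, p ! Suc i} \<in> edges G)"

definition path_edges :: "'a list \<Rightarrow> 'a set set" where
  "path_edges p = {{p ! i, p ! Suc i} | i. Suc i < length p}"

definition inner_verts :: "'a list \<Rightarrow> 'a set" where
  "inner_verts p = set p - {hd p, last p}"

text \<open>The distance is \<open>\<infinity>\<close> between vertices of different components (infimum of the empty set).\<close>

definition gdist :: "'a ugraph \<Rightarrow> 'a \<Rightarrow> 'a \<Rightarrow> enat" where
  "gdist G u v =
     (INF p \<in> {p. is_path G p \<and> hd p = u \<and> last p = v}. enat (length p - 1))"

definition closed_ball :: "'a ugraph \<Rightarrow> nat \<Rightarrow> 'a \<Rightarrow> 'a set" where
  "closed_ball G \<rho> v = {x \<in> verts G. gdist G v x \<le> enat \<rho>}"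

text \<open>\<open>H\<close> is a subdivision of \<open>F\<close> in which every edge is subdivided at most \<open>r\<close> times:
  \<open>\<phi>\<close> gives the branch vertices, and \<open>P e\<close> is the path replacing the edge \<open>e\<close>, in either
  of its two directions.\<close>

definition le_subdivision :: "nat \<Rightarrow> 'f ugraph \<Rightarrow> 'a ugraph \<Rightarrow> bool" where
  "le_subdivision r F H \<longleftrightarrow> simple_graph H \<and>
     (\<exists>(\<phi> :: 'f \<Rightarrow> 'a) (P :: 'f set \<Rightarrow> 'a list).
        inj_on \<phi> (verts F) \<and>
        (\<forall>e\<in>edges F. is_path H (P e) \<and> {hd (P e), last (P e)} = \<phi> ` e \<and>
           card (inner_verts (P e)) \<le> r \<and> inner_verts (P e) \<inter> \<phi> ` verts F = {}) \<and>
        (\<forall>e\<in>edges F. \<forall>e'\<in>edges F. e \<noteq> e' \<longrightarrow> inner_verts (P e) \<inter> inner_verts (P e') = {}) \<and>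
        verts H = \<phi> ` verts F \<union> (\<Union>e\<in>edges F. inner_verts (P e)) \<and>
        edges H = (\<Union>e\<in>edges F. path_edges (P e)))"

text \<open>Graph classes. Every finite graph is isomorphic to a graph on natural numbers, so classes of
  graphs closed under isomorphism correspond to isomorphism-closed sets of graphs on \<open>nat\<close>.\<close>

definition graph_class :: "nat ugraph set \<Rightarrow> bool" where
  "graph_class \<G> \<longleftrightarrow> (\<forall>G\<in>\<G>. simple_graph G) \<and>
     (\<forall>G\<in>\<G>. \<forall>H. simple_graph H \<and> graph_iso G H \<longrightarrow> H \<in> \<G>)"

definition hereditary :: "nat ugraph set \<Rightarrow> bool" where
  "hereditary \<G> \<longleftrightarrow> (\<forall>G\<in>\<G>. \<forall>H. induced_subgraph H G \<longrightarrow> H \<in> \<G>)"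

text \<open>The set of natural numbers of the source does not contain \<open>0\<close>, hence the ranges \<open>{1..}\<close> below.\<close>

definition controlled :: "(nat \<Rightarrow> nat) \<Rightarrow> nat \<Rightarrow> 'a ugraph \<Rightarrow> bool" where
  "controlled f \<rho> G \<longleftrightarrow> (\<forall>H. \<forall>c\<ge>1. induced_subgraph H G \<longrightarrow>
     Max ((\<lambda>v. chromatic_number (induced H (closed_ball H \<rho> v))) ` verts H) \<le> c \<longrightarrow>
     chromatic_number H \<le> f c)"

definition controlled_class :: "nat \<Rightarrow> nat ugraph set \<Rightarrow> bool" where
  "controlled_class \<rho> \<G> \<longleftrightarrow> (\<exists>f \<in> {1..} \<rightarrow> {1..}. \<forall>G\<in>\<G>. controlled f \<rho> G)"

text \<open>Burling's sequence. In the step from \<open>B\<^sub>k\<close> to \<open>B\<^sub>k\<^sub>+\<^sub>1\<close>, \<open>Old x\<close> is the vertex \<open>x\<close> of \<open>B\<^sub>k\<close>,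
  \<open>Copy a x\<close> is the vertex of the copy \<open>B\<^sup>a\<close> corresponding to the vertex \<open>x\<close> of \<open>B\<^sub>k\<close>, and
  \<open>NewB a v\<close>, \<open>NewC a v\<close> are the two new vertices belonging to \<open>a\<close> and the marked vertex
  \<open>Copy a v\<close> of \<open>B\<^sup>a\<close>.\<close>

datatype burling_vertex =
    BaseA
  | BaseB
  | Old burling_vertex
  | Copy burling_vertex burling_vertex
  | NewB burling_vertex burling_vertex
  | NewC burling_vertex burling_vertex

record 'a marked_graph =
  graph :: "'a ugraph"
  marked :: "'a set"

definition join_edges :: "'a set \<Rightarrow> 'a set \<Rightarrow> 'a set set" where
  "join_edges X Y = {{x, y} | x y. x \<in> X \<and> y \<in> Y}"

definition burling_step :: "burling_vertex marked_graph \<Rightarrow> burling_vertex marked_graph" where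
  "burling_step M =
     (let B = graph M; A = marked M in
      \<lparr>graph = \<lparr>
         verts = Old ` (verts B - A) \<union>
           (\<Union>a\<in>A. Copy a ` verts B \<union> (\<Union>v\<in>A. {NewB a v, NewC a v})),
         edges = (`) Old ` {e \<in> edges B. e \<subseteq> verts B - A} \<union>
           (\<Union>a\<in>A. (`) (Copy a) ` edges B \<union>
             (\<Union>v\<in>A. join_edges (Copy a ` nbrs B v) {NewB a v} \<union>
                {{NewB a v, NewC a v}} \<union>
                join_edges (Old ` nbrs B a) {Copy a v, NewC a v}))\<rparr>,
       marked = (\<Union>a\<in>A. Copy a ` A \<union> NewC a ` A)\<rparr>)"

text \<open>The sequence starts at index \<open>1\<close>; the value at \<open>0\<close> is a dummy. The step only applies
  from index \<open>2\<close> on: \<open>B\<^sub>2\<close> is not the result of the step on \<open>B\<^sub>1\<close>.\<close>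

fun burling :: "nat \<Rightarrow> burling_vertex marked_graph" where
  "burling 0 = \<lparr>graph = \<lparr>verts = {BaseA}, edges = {}\<rparr>, marked = {BaseA}\<rparr>"
| "burling (Suc 0) = \<lparr>graph = \<lparr>verts = {BaseA}, edges = {}\<rparr>, marked = {BaseA}\<rparr>"
| "burling (Suc (Suc 0)) =
     \<lparr>graph = \<lparr>verts = {BaseB, BaseA}, edges = {{BaseB, BaseA}}\<rparr>, marked = {BaseA}\<rparr>"
| "burling (Suc (Suc (Suc k))) = burling_step (burling (Suc (Suc k)))"

definition burling_number :: "'a ugraph \<Rightarrow> nat" where
  "burling_number G = Max {k. 1 \<le> k \<and> contains_induced (graph (burling k)) G}"

definition burling_controlled :: "nat ugraph set \<Rightarrow> bool" where
  "burling_controlled \<G> \<longleftrightarrow> (\<exists>f \<in> {1..} \<times> {1..} \<rightarrow> {1..}. \<forall>G\<in>\<G>. \<forall>H. induced_subgraph H G \<longrightarrow>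
     chromatic_number H \<le> f (clique_number H, burling_number H))"

end

theory Submission
  imports Defs
begin

text \<open>Suppose the chromatic number is unbounded although the clique number and the Burling number are
  bounded. Passing to subfamilies, take the least radius \<open>s\<close> at which balls control the chromatic
  number; balls of radius \<open>s - 1\<close> then have bounded chromatic number. A long multicover (many
  roots, each with a stable set of neighbours that reaches a common set of large chromatic number)
  contains a short subdivision of \<open>F\<close>, which forces \<open>s = 2\<close>. Next take the largest \<open>h\<close> such that
  every set of large chromatic number contains an \<open>h\<close>-clique \<open>K\<close> whose common neighbours dominate a
  set of large chromatic number. Nesting such cliques and covering by their common neighbours,
  the absence of long multicovers allows one to refocus all earlier covers on the newest clique,
  while the maximality of \<open>h\<close> separates a common neighbour of \<open>K\<close> from the remaining ones. This
  suffices to imitate the recursion of the Burling graphs: \<open>B\<^sub>k\<^sub>+\<^sub>1\<close> arises from \<open>B\<^sub>k\<close> by doubling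
  the marked vertices of a copy of \<open>B\<^sub>k\<close> and grafting such copies at the marked vertices.\<close>

section \<open>Chromatic number and distances of an abstract graph\<close>

text \<open>Neighbourhoods have bounded chromatic number by induction on the clique number, since
  their cliques are smaller. So the least radius is at least 2, balls of radius 1 are bounded as
  well, and deleting a bounded number of vertices with their neighbourhoods costs a bounded amount.
  One obstacle is that all bounds must be uniform over the class. Hence most steps concern a family
  of vertex sets of unbounded chromatic number, closed under subsets; if a uniform bound fails, the
  exceptions form such a family again, and the argument continues there. The other obstacle is that
  marked vertices of Burling graphs are multiplied and acquire neighbours at every later step, so
  they cannot be fixed early. Each is kept as a large set of vertices whose neighbours in the covers
  all have the prescribed adjacencies. Copies are embedded inside that set, and a cover vertex is
  picked when it is needed. A subdivided edge runs through two legs of at most \<open>r + 1\<close>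
  vertices sharing their last one, so it has at most \<open>2 * r + 1\<close> inner vertices with
  \<open>r \<le> \<rho>\<close>.\<close>

locale sgraph =
  fixes adj :: "'v \<Rightarrow> 'v \<Rightarrow> bool"
  assumes adj_sym: "adj x y \<Longrightarrow> adj y x"
    and adj_irr: "\<not> adj x x"
begin

definition proper :: "'v set \<Rightarrow> nat \<Rightarrow> ('v \<Rightarrow> nat) \<Rightarrow> bool" where
  "proper X k c \<longleftrightarrow> (\<forall>v\<in>X. c v < k) \<and> (\<forall>u\<in>X. \<forall>v\<in>X. adj u v \<longrightarrow> c u \<noteq> c v)"

definition chi :: "'v set \<Rightarrow> nat" where
  "chi X = (LEAST k. \<exists>c. proper X k c)"

definition stable :: "'v set \<Rightarrow> bool" where
  "stable S \<longleftrightarrow> (\<forall>x\<in>S. \<forall>y\<in>S. \<not> adj x y)"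

definition clq :: "'v set \<Rightarrow> bool" where
  "clq K \<longleftrightarrow> (\<forall>x\<in>K. \<forall>y\<in>K. x \<noteq> y \<longrightarrow> adj x y)"

definition cn :: "'v set \<Rightarrow> 'v set" where
  "cn K = {t. \<forall>y\<in>K. adj y t}"

definition dominated :: "'v set \<Rightarrow> 'v set \<Rightarrow> 'v set" where
  "dominated X S = {w \<in> X. \<exists>t\<in>X \<inter> S. adj t w}"

section \<open>Elementary bounds on the chromatic number of vertex sets\<close>

lemma chi_le: "proper X k c \<Longrightarrow> chi X \<le> k"
  unfolding chi_def by (rule Least_le) blast

lemma ex_proper:
  assumes "finite X"
  shows "\<exists>c. proper X (chi X) c"
proof -
  obtain f :: "'v \<Rightarrow> nat" where f: "inj_on f X"
    using finite_imp_inj_to_nat_seg[OF assms] by blast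
  have "\<exists>k. \<forall>v\<in>X. f v < k"
    using assms by (metis finite_imageI finite_nat_set_iff_bounded imageI)
  then obtain k where "\<forall>v\<in>X. f v < k" by blast
  then have "proper X k f"
    using f adj_irr by (auto simp: proper_def inj_on_def)
  then have "\<exists>k c. proper X k c" by blast
  then show ?thesis unfolding chi_def by (rule LeastI_ex)
qed

lemma chi_mono:
  assumes "finite Y" "X \<subseteq> Y"
  shows "chi X \<le> chi Y"
proof -
  obtain c where "proper Y (chi Y) c" using ex_proper[OF assms(1)] by blast
  then have "proper X (chi Y) c" using assms(2) unfolding proper_def by blast
  then show ?thesis by (rule chi_le)
qed

lemma chi_empty [simp]: "chi {} = 0"
  using chi_le[of "{}" 0] by (simp add: proper_def)

lemma chi_Un:
  assumes "finite A" "finite B"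
  shows "chi (A \<union> B) \<le> chi A + chi B"
proof -
  obtain c where c: "proper A (chi A) c" using ex_proper[OF assms(1)] by blast
  obtain d where d: "proper B (chi B) d" using ex_proper[OF assms(2)] by blast
  have "proper (A \<union> B) (chi A + chi B) (\<lambda>v. if v \<in> A then c v else chi A + d v)"
    using c d unfolding proper_def by (auto; fastforce)
  then show ?thesis by (rule chi_le)
qed

lemma chi_UN:
  assumes "finite I" "\<And>i. i \<in> I \<Longrightarrow> finite (A i)"
  shows "chi (\<Union>i\<in>I. A i) \<le> (\<Sum>i\<in>I. chi (A i))"
  using assms
proof (induction I rule: finite_induct)
  case (insert i I)
  have "chi (\<Union>j\<in>insert i I. A j) = chi (A i \<union> (\<Union>j\<in>I. A j))" by simp
  also have "\<dots> \<le> chi (A i) + chi (\<Union>j\<in>I. A j)"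
    using insert by (intro chi_Un) auto
  also have "\<dots> \<le> chi (A i) + (\<Sum>j\<in>I. chi (A j))" using insert by auto
  finally show ?case using insert by simp
qed simp

lemma chi_UN_le:
  assumes "finite I" "\<And>i. i \<in> I \<Longrightarrow> finite (A i)" "\<And>i. i \<in> I \<Longrightarrow> chi (A i) \<le> d"
  shows "chi (\<Union>i\<in>I. A i) \<le> card I * d"
proof -
  have "chi (\<Union>i\<in>I. A i) \<le> (\<Sum>i\<in>I. chi (A i))" using assms by (intro chi_UN)
  also have "\<dots> \<le> (\<Sum>i\<in>I. d)" using assms by (intro sum_mono) auto
  finally show ?thesis by simp
qed

lemma chi_diff:
  assumes "finite X" "finite Y"
  shows "chi X \<le> chi (X - Y) + chi Y"
proof -
  have "chi X \<le> chi ((X - Y) \<union> Y)" using assms by (intro chi_mono) auto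
  also have "\<dots> \<le> chi (X - Y) + chi Y" using assms by (intro chi_Un) auto
  finally show ?thesis .
qed

lemma chi_pigeon:
  assumes "finite X" "finite P" "f ` X \<subseteq> P" "card P * d < chi X"
  shows "\<exists>p\<in>P. d < chi {w \<in> X. f w = p}"
proof (rule ccontr)
  assume "\<not> ?thesis"
  then have "chi (\<Union>p\<in>P. {w \<in> X. f w = p}) \<le> card P * d"
    using assms by (intro chi_UN_le) (auto simp: not_less)
  moreover have "X = (\<Union>p\<in>P. {w \<in> X. f w = p})" using assms(3) by auto
  ultimately show False using assms(4) by simp
qed

text \<open>Let every vertex of \<open>C\<close> choose a related element of \<open>N\<close>. An
  optimal colouring of \<open>N\<close> splits \<open>C\<close> by the colour of the choice into at
  most \<open>d\<close> parts, and colour classes are stable: a cover becomes stable at the cost of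
  a factor \<open>d\<close>.\<close>

lemma stable_cover_part:
  assumes "finite C" "finite N" "chi N \<le> d" "\<And>w. w \<in> C \<Longrightarrow> \<exists>t\<in>N. R t w" "d * n < chi C"
  shows "\<exists>T C'. T \<subseteq> N \<and> stable T \<and> C' \<subseteq> C \<and> n < chi C' \<and> (\<forall>w\<in>C'. \<exists>t\<in>T. R t w)"
proof -
  obtain c where c: "proper N (chi N) c" using ex_proper[OF assms(2)] by blast
  obtain g where g: "\<And>w. w \<in> C \<Longrightarrow> g w \<in> N \<and> R (g w) w" using assms(4) by metis
  have im: "(\<lambda>w. c (g w)) ` C \<subseteq> {..<chi N}" using c g unfolding proper_def by auto
  have "chi N * n < chi C" using assms(3,5) by (meson le_less_trans mult_le_mono1)
  then obtain p where p: "n < chi {w \<in> C. c (g w) = p}"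
    using chi_pigeon[OF assms(1) _ im, of n] by auto
  have st: "stable {t \<in> N. c t = p}" using c unfolding proper_def stable_def by (metis (mono_tags) mem_Collect_eq)
  show ?thesis
    by (rule exI[of _ "{t \<in> N. c t = p}"], rule exI[of _ "{w \<in> C. c (g w) = p}"])
      (use p st g in auto)
qed

text \<open>Distance at most \<open>r\<close> in the subgraph induced on \<open>X\<close>, unfolded
  at the first step. The ambient \<open>X\<close> is a parameter because covers keep being measured
  in a fixed \<open>X\<close> while the covered set shrinks.\<close>

fun near :: "'v set \<Rightarrow> nat \<Rightarrow> 'v \<Rightarrow> 'v \<Rightarrow> bool" where
  "near X 0 v u \<longleftrightarrow> v \<in> X \<and> v = u"
| "near X (Suc r) v u \<longleftrightarrow> v \<in> X \<and> (near X r v u \<or> (\<exists>z. adj v z \<and> near X r z u))"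

lemma near_in: "near X r v u \<Longrightarrow> v \<in> X \<and> u \<in> X"
  by (induction r arbitrary: v) auto

lemma near_mono: "r \<le> r' \<Longrightarrow> near X r v u \<Longrightarrow> near X r' v u"
  by (induction r' rule: dec_induct) (auto dest: near_in)

lemma near_subset: "X \<subseteq> Y \<Longrightarrow> near X r v u \<Longrightarrow> near Y r v u"
proof (induction r arbitrary: v)
  case (Suc r)
  then show ?case by (simp, blast)
qed auto

lemma near_step: "v \<in> X \<Longrightarrow> adj v z \<Longrightarrow> near X r z u \<Longrightarrow> near X (Suc r) v u"
  by auto

definition walk :: "'v list \<Rightarrow> bool" where
  "walk p \<longleftrightarrow> p \<noteq> [] \<and> (\<forall>i. Suc i < length p \<longrightarrow> adj (p ! i) (p ! Suc i))"

lemma walk_Cons: "walk p \<Longrightarrow> adj v (hd p) \<Longrightarrow> walk (v # p)"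
  unfolding walk_def by (auto simp: nth_Cons hd_conv_nth split: nat.splits)

text \<open>The last clause is the important one: vertices after the first are within
  \<open>r - 1\<close> of \<open>u\<close>. A neighbour of such a vertex is then still within
  \<open>r\<close> of \<open>u\<close>, which is how contacts between paths are excluded
  later.\<close>

lemma near_walk:
  "near X r v u \<Longrightarrow> \<exists>q. walk q \<and> hd q = v \<and> last q = u \<and> set q \<subseteq> X \<and> length q \<le> Suc r \<and>
     (\<forall>z\<in>set (tl q). near X (r - 1) z u)"
proof (induction r arbitrary: v)
  case 0
  then show ?case by (intro exI[of _ "[v]"]) (auto simp: walk_def)
next
  case (Suc r)
  from Suc.prems consider "near X r v u" | z where "adj v z" "near X r z u" by auto
  then show ?case
  proof cases
    case 1
    from Suc.IH[OF this] obtain q where q: "walk q" "hd q = v" "last q = u" "set q \<subseteq> X"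
      "length q \<le> Suc r" "\<forall>z\<in>set (tl q). near X (r - 1) z u" by blast
    then have "\<forall>z\<in>set (tl q). near X (Suc r - 1) z u"
      using near_mono[of "r - 1" r] by auto
    with q show ?thesis by (intro exI[of _ q]) auto
  next
    case 2
    from Suc.IH[OF 2(2)] obtain q where q: "walk q" "hd q = z" "last q = u" "set q \<subseteq> X"
      "length q \<le> Suc r" "\<forall>z\<in>set (tl q). near X (r - 1) z u" by blast
    have ne: "q \<noteq> []" using q(1) by (simp add: walk_def)
    have "\<forall>y\<in>set q. near X r y u"
    proof
      fix y assume "y \<in> set q"
      then have "y = z \<or> y \<in> set (tl q)" using ne q(2) by (cases q) auto
      then show "near X r y u" using 2(2) q(6) near_mono[of "r - 1" r] by auto
    qed
    moreover have "v \<in> X" using Suc.prems near_in by blast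
    ultimately show ?thesis using q ne walk_Cons[of q v] 2(1)
      by (intro exI[of _ "v # q"]) auto
  qed
qed

definition reach :: "'v set \<Rightarrow> nat \<Rightarrow> 'v set \<Rightarrow> 'v set" where
  "reach X r S = {u \<in> X. \<exists>t\<in>S. near X r t u}"

definition world :: "nat \<Rightarrow> nat \<Rightarrow> 'v set \<Rightarrow> bool" where
  "world r d X \<longleftrightarrow> finite X \<and> (\<forall>v\<in>X. chi {u \<in> X. near X r v u} \<le> d)"

text \<open>A smallest subset \<open>S\<close> of \<open>L\<close> whose reach is large in
  \<open>P\<close> or in \<open>Q\<close> overshoots by at most one ball: without one of its
  elements it reaches less than \<open>E\<close> in both sets, and that element adds at most
  \<open>d\<close>.\<close>

lemma reach_split:
  assumes w: "world r d X" and sub: "P \<subseteq> X" "Q \<subseteq> X" "L \<subseteq> X" and PL: "P \<subseteq> reach X r L"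
    and E: "0 < E" "E \<le> chi P"
  shows "\<exists>S\<subseteq>L. (E \<le> chi (P \<inter> reach X r S) \<or> E \<le> chi (Q \<inter> reach X r S)) \<and>
     chi (P \<inter> reach X r S) < E + d \<and> chi (Q \<inter> reach X r S) < E + d"
proof -
  have fin: "finite X" using w by (simp add: world_def)
  define big where "big S \<longleftrightarrow> E \<le> chi (P \<inter> reach X r S) \<or> E \<le> chi (Q \<inter> reach X r S)" for S
  have "P \<inter> reach X r L = P" using PL by blast
  then have "L \<subseteq> L \<and> big L" using E unfolding big_def by auto
  then obtain S where S: "S \<subseteq> L" "big S" and min: "\<And>S'. S' \<subseteq> L \<and> big S' \<Longrightarrow> card S \<le> card S'"
    using ex_has_least_nat[of "\<lambda>S. S \<subseteq> L \<and> big S" L card] by blast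
  have "S \<noteq> {}" using S(2) E unfolding big_def reach_def by auto
  then obtain t where t: "t \<in> S" by blast
  have finS: "finite S" using S(1) sub(3) fin by (meson finite_subset)
  have "\<not> big (S - {t})"
    using min[of "S - {t}"] S(1) card_Diff1_less[OF finS t] by (auto simp: not_le[symmetric])
  then have small: "chi (P \<inter> reach X r (S - {t})) < E" "chi (Q \<inter> reach X r (S - {t})) < E"
    unfolding big_def by auto
  have step: "chi (Y \<inter> reach X r S) < E + d" if "chi (Y \<inter> reach X r (S - {t})) < E" "Y \<subseteq> X" for Y
  proof -
    have "Y \<inter> reach X r S \<subseteq> (Y \<inter> reach X r (S - {t})) \<union> {u \<in> X. near X r t u}"
      unfolding reach_def by auto
    then have "chi (Y \<inter> reach X r S) \<le> chi ((Y \<inter> reach X r (S - {t})) \<union> {u \<in> X. near X r t u})"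
      using fin that(2) by (intro chi_mono) (auto intro: finite_subset)
    also have "\<dots> \<le> chi (Y \<inter> reach X r (S - {t})) + chi {u \<in> X. near X r t u}"
      using fin that(2) by (intro chi_Un) (auto intro: finite_subset)
    also have "chi {u \<in> X. near X r t u} \<le> d"
      using w t S(1) sub(3) unfolding world_def by blast
    finally show ?thesis using that(1) by linarith
  qed
  show ?thesis using S small step sub unfolding big_def by blast
qed

text \<open>To keep \<open>E'\<close> on both sides after one cover is processed,
  \<open>2 * E' + d\<close> is enough: the side restricted to its unreached part loses less than
  \<open>E' + d\<close>.\<close>

fun split_bound :: "nat \<Rightarrow> nat \<Rightarrow> nat \<Rightarrow> nat" where
  "split_bound d E 0 = E"
| "split_bound d E (Suc n) = 2 * split_bound d E n + d"

lemma split_bound_ge: "E \<le> split_bound d E n"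
  by (induction n) auto

text \<open>The covers are shrunk one at a time by \<open>reach_split\<close>; the side reached
  heavily is cut down to the reached part, the other to the unreached part. In the end each shrunken
  cover reaches all of one side and nothing of the other, even when \<open>P\<close> and
  \<open>Q\<close> start as the same set.\<close>

lemma cover_split:
  assumes w: "world r d X" and E: "0 < E" and "finite I"
  shows "\<lbrakk>P \<subseteq> X; Q \<subseteq> X; \<forall>i\<in>I. L i \<subseteq> X \<and> P \<union> Q \<subseteq> reach X r (L i);
     split_bound d E (card I) \<le> chi P; split_bound d E (card I) \<le> chi Q\<rbrakk> \<Longrightarrow>
   \<exists>P' Q' IP IQ L'. P' \<subseteq> P \<and> Q' \<subseteq> Q \<and> E \<le> chi P' \<and> E \<le> chi Q' \<and> I = IP \<union> IQ \<and>
     (\<forall>i\<in>I. L' i \<subseteq> L i) \<and>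
     (\<forall>i\<in>IP. P' \<subseteq> reach X r (L' i) \<and> Q' \<inter> reach X r (L' i) = {}) \<and>
     (\<forall>i\<in>IQ. Q' \<subseteq> reach X r (L' i) \<and> P' \<inter> reach X r (L' i) = {})"
  using \<open>finite I\<close>
proof (induction I arbitrary: P Q rule: finite_induct)
  case empty
  then show ?case by (intro exI[of _ P] exI[of _ Q] exI[of _ "{}"]) auto
next
  case (insert i I)
  have fin: "finite X" using w by (simp add: world_def)
  define E' where "E' = split_bound d E (card I)"
  have E': "0 < E'" using E split_bound_ge[of E d "card I"] by (simp add: E'_def)
  have big: "2 * E' + d \<le> chi P" "2 * E' + d \<le> chi Q"
    using insert by (auto simp: E'_def)
  obtain S where S: "S \<subseteq> L i" "E' \<le> chi (P \<inter> reach X r S) \<or> E' \<le> chi (Q \<inter> reach X r S)"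
    "chi (P \<inter> reach X r S) < E' + d" "chi (Q \<inter> reach X r S) < E' + d"
    using reach_split[OF w insert.prems(1,2), of "L i" E'] insert.prems(3) E' big by auto
  have finPQ: "finite P" "finite Q" using insert.prems fin by (auto intro: finite_subset)
  have rest: "E' \<le> chi (Y - reach X r S)"
    if "chi (Y \<inter> reach X r S) < E' + d" "2 * E' + d \<le> chi Y" "finite Y" for Y
  proof -
    have "chi Y \<le> chi (Y - Y \<inter> reach X r S) + chi (Y \<inter> reach X r S)"
      using that by (intro chi_diff) auto
    moreover have "Y - Y \<inter> reach X r S = Y - reach X r S" by blast
    ultimately show ?thesis using that by simp
  qed
  from S(2) show ?case
  proof
    assume a: "E' \<le> chi (P \<inter> reach X r S)"
    define P1 Q1 where "P1 = P \<inter> reach X r S" and "Q1 = Q - reach X r S"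
    have e1: "E' \<le> chi P1" "E' \<le> chi Q1" using a rest[OF S(4)] big finPQ by (auto simp: P1_def Q1_def)
    have sub1: "P1 \<subseteq> X" "Q1 \<subseteq> X" using insert.prems(1,2) by (auto simp: P1_def Q1_def)
    have cov1: "\<forall>j\<in>I. L j \<subseteq> X \<and> P1 \<union> Q1 \<subseteq> reach X r (L j)"
      using insert.prems(3) by (auto simp: P1_def Q1_def)
    obtain P' Q' IP IQ L' where *: "P' \<subseteq> P1" "Q' \<subseteq> Q1" "E \<le> chi P'" "E \<le> chi Q'" "I = IP \<union> IQ"
      "\<forall>i\<in>I. L' i \<subseteq> L i"
      "\<forall>i\<in>IP. P' \<subseteq> reach X r (L' i) \<and> Q' \<inter> reach X r (L' i) = {}"
      "\<forall>i\<in>IQ. Q' \<subseteq> reach X r (L' i) \<and> P' \<inter> reach X r (L' i) = {}"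
      using insert.IH[OF sub1 cov1 e1[unfolded E'_def]] by (elim exE conjE) (rule that)
    have ni: "i \<notin> IP" "i \<notin> IQ" using * insert by auto
    show ?thesis
      by (rule exI[of _ P'], rule exI[of _ Q'], rule exI[of _ "insert i IP"], rule exI[of _ IQ],
          rule exI[of _ "L'(i := S)"])
        (use * S(1) ni P1_def Q1_def in auto)
  next
    assume a: "E' \<le> chi (Q \<inter> reach X r S)"
    define P1 Q1 where "P1 = P - reach X r S" and "Q1 = Q \<inter> reach X r S"
    have e1: "E' \<le> chi P1" "E' \<le> chi Q1" using a rest[OF S(3)] big finPQ by (auto simp: P1_def Q1_def)
    have sub1: "P1 \<subseteq> X" "Q1 \<subseteq> X" using insert.prems(1,2) by (auto simp: P1_def Q1_def)
    have cov1: "\<forall>j\<in>I. L j \<subseteq> X \<and> P1 \<union> Q1 \<subseteq> reach X r (L j)"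
      using insert.prems(3) by (auto simp: P1_def Q1_def)
    obtain P' Q' IP IQ L' where *: "P' \<subseteq> P1" "Q' \<subseteq> Q1" "E \<le> chi P'" "E \<le> chi Q'" "I = IP \<union> IQ"
      "\<forall>i\<in>I. L' i \<subseteq> L i"
      "\<forall>i\<in>IP. P' \<subseteq> reach X r (L' i) \<and> Q' \<inter> reach X r (L' i) = {}"
      "\<forall>i\<in>IQ. Q' \<subseteq> reach X r (L' i) \<and> P' \<inter> reach X r (L' i) = {}"
      using insert.IH[OF sub1 cov1 e1[unfolded E'_def]] by (elim exE conjE) (rule that)
    have ni: "i \<notin> IP" "i \<notin> IQ" using * insert by auto
    show ?thesis
      by (rule exI[of _ P'], rule exI[of _ Q'], rule exI[of _ IP], rule exI[of _ "insert i IQ"],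
          rule exI[of _ "L'(i := S)"])
        (use * S(1) ni P1_def Q1_def in auto)
  qed
qed

end

section \<open>Multicovers and spiders\<close>

text \<open>Outdegrees at most \<open>d\<close> force some vertex of indegree at most
  \<open>d\<close>, by counting arcs in two ways. Such a vertex is taken and deleted with its at
  most \<open>2 * d\<close> neighbours, and induction applies to the rest.\<close>

lemma independent_in_sparse_digraph:
  fixes A :: "'i \<Rightarrow> 'i \<Rightarrow> bool"
  assumes "finite I" "\<And>i. i \<in> I \<Longrightarrow> card {j \<in> I. A i j} \<le> d"
  shows "\<exists>J\<subseteq>I. card I \<le> (2 * d + 1) * card J \<and> (\<forall>i\<in>J. \<forall>j\<in>J. i \<noteq> j \<longrightarrow> \<not> A i j)"
  using assms
proof (induction "card I" arbitrary: I rule: less_induct)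
  case less
  show ?case
  proof (cases "I = {}")
    case False
    have "\<exists>i\<in>I. card {j \<in> I. A j i} \<le> d"
    proof (rule ccontr)
      assume "\<not> ?thesis"
      then have "(\<Sum>i\<in>I. d) < (\<Sum>i\<in>I. card {j \<in> I. A j i})"
        using False less.prems(1) by (intro sum_strict_mono) auto
      also have "\<dots> = (\<Sum>i\<in>I. \<Sum>j\<in>I. if A j i then 1 else 0)"
        using less.prems(1) by (simp add: sum.If_cases Int_def)
      also have "\<dots> = (\<Sum>j\<in>I. \<Sum>i\<in>I. if A j i then 1 else 0)" by (rule sum.swap)
      also have "\<dots> = (\<Sum>j\<in>I. card {i \<in> I. A j i})"
        using less.prems(1) by (simp add: sum.If_cases Int_def)
      also have "\<dots> \<le> (\<Sum>j\<in>I. d)" using less.prems(2) by (intro sum_mono) auto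
      finally show False by simp
    qed
    then obtain i where i: "i \<in> I" "card {j \<in> I. A j i} \<le> d" by blast
    define N where "N = insert i ({j \<in> I. A j i} \<union> {j \<in> I. A i j})"
    have "card N \<le> 1 + card ({j \<in> I. A j i} \<union> {j \<in> I. A i j})"
      unfolding N_def using less.prems(1) by (simp add: card_insert_if)
    also have "\<dots> \<le> 1 + (card {j \<in> I. A j i} + card {j \<in> I. A i j})"
      using card_Un_le by (intro add_left_mono)
    also have "\<dots> \<le> 1 + (d + d)" using i less.prems(2)[OF i(1)] by linarith
    finally have cN: "card N \<le> 2 * d + 1" by simp
    have NI: "N \<subseteq> I" "i \<in> N" using i unfolding N_def by auto
    have fin: "finite (I - N)" using less.prems(1) by simp
    have "card (I - N) < card I"
      using NI i less.prems(1) by (intro psubset_card_mono) auto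
    moreover have "card {j \<in> I - N. A k j} \<le> d" if "k \<in> I - N" for k
    proof -
      have "card {j \<in> I - N. A k j} \<le> card {j \<in> I. A k j}"
        using less.prems(1) by (intro card_mono) auto
      then show ?thesis using less.prems(2)[of k] that by auto
    qed
    ultimately obtain J where J: "J \<subseteq> I - N" "card (I - N) \<le> (2 * d + 1) * card J"
      "\<forall>i\<in>J. \<forall>j\<in>J. i \<noteq> j \<longrightarrow> \<not> A i j"
      using less.hyps[of "I - N"] fin by blast
    have "i \<notin> J" using J(1) NI by auto
    moreover have "finite J" using J(1) fin finite_subset by blast
    ultimately have "card (insert i J) = Suc (card J)" by simp
    moreover have "card I = card (I - N) + card N"
      using NI less.prems(1) by (metis card_Diff_subset card_mono finite_subset le_add_diff_inverse2)
    ultimately have "card I \<le> (2 * d + 1) * card (insert i J)" using J(2) cN by simp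
    moreover have "\<forall>a\<in>insert i J. \<forall>b\<in>insert i J. a \<noteq> b \<longrightarrow> \<not> A a b"
      using J unfolding N_def by blast
    ultimately show ?thesis using J(1) i by (intro exI[of _ "insert i J"]) auto
  qed (auto intro: exI[of _ "{}"])
qed

context sgraph
begin

text \<open>Edges between \<open>L i\<close> and \<open>L j\<close> are allowed: only roots are kept
  apart from each other, from foreign covers and from \<open>C\<close>. Controlling the edges
  between covers is the task of the spider construction.\<close>

definition multicover :: "'v set \<Rightarrow> nat \<Rightarrow> nat set \<Rightarrow> (nat \<Rightarrow> 'v) \<Rightarrow> (nat \<Rightarrow> 'v set) \<Rightarrow> 'v set \<Rightarrow> bool" where
  "multicover X r I x L C \<longleftrightarrow> finite I \<and> C \<subseteq> X \<and>
     (\<forall>i\<in>I. x i \<in> X \<and> L i \<subseteq> X \<and> stable (L i) \<and> (\<forall>t\<in>L i. adj (x i) t) \<and>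
        C \<subseteq> reach X r (L i) \<and> (\<forall>u\<in>C. \<not> near X r (x i) u)) \<and>
     (\<forall>i\<in>I. \<forall>j\<in>I. i \<noteq> j \<longrightarrow> x i \<noteq> x j \<and> \<not> adj (x i) (x j) \<and> (\<forall>t\<in>L j. \<not> adj (x i) t))"

lemma multicover_subset:
  assumes "multicover X r I x L C" "J \<subseteq> I" "C' \<subseteq> C"
    and "\<And>i. i \<in> J \<Longrightarrow> L' i \<subseteq> L i" "\<And>i. i \<in> J \<Longrightarrow> C' \<subseteq> reach X r (L' i)"
  shows "multicover X r J x L' C'"
proof -
  have "finite J" using assms(1,2) finite_subset unfolding multicover_def by blast
  moreover have "C' \<subseteq> X" using assms unfolding multicover_def by blast
  moreover have "\<forall>i\<in>J. x i \<in> X \<and> L' i \<subseteq> X \<and> stable (L' i) \<and> (\<forall>t\<in>L' i. adj (x i) t) \<and>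
        C' \<subseteq> reach X r (L' i) \<and> (\<forall>u\<in>C'. \<not> near X r (x i) u)"
  proof
    fix i assume i: "i \<in> J"
    then have "i \<in> I" using assms(2) by blast
    then have a: "x i \<in> X" "L i \<subseteq> X" "stable (L i)" "\<forall>t\<in>L i. adj (x i) t"
      "\<forall>u\<in>C. \<not> near X r (x i) u"
      using assms(1) unfolding multicover_def by blast+
    have s: "stable (L' i)" using a(3) assms(4)[OF i] unfolding stable_def by blast
    show "x i \<in> X \<and> L' i \<subseteq> X \<and> stable (L' i) \<and> (\<forall>t\<in>L' i. adj (x i) t) \<and>
        C' \<subseteq> reach X r (L' i) \<and> (\<forall>u\<in>C'. \<not> near X r (x i) u)"
      using a s assms(3) assms(4)[OF i] assms(5)[OF i] by blast
  qed
  moreover have "\<forall>i\<in>J. \<forall>j\<in>J. i \<noteq> j \<longrightarrow> x i \<noteq> x j \<and> \<not> adj (x i) (x j) \<and> (\<forall>t\<in>L' j. \<not> adj (x i) t)"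
  proof (intro ballI impI)
    fix i j assume ij: "i \<in> J" "j \<in> J" "i \<noteq> j"
    then have "i \<in> I" "j \<in> I" using assms(2) by auto
    then have "x i \<noteq> x j" "\<not> adj (x i) (x j)" "\<forall>t\<in>L j. \<not> adj (x i) t"
      using assms(1) ij(3) unfolding multicover_def by blast+
    then show "x i \<noteq> x j \<and> \<not> adj (x i) (x j) \<and> (\<forall>t\<in>L' j. \<not> adj (x i) t)"
      using assms(4)[OF ij(2)] by blast
  qed
  ultimately show ?thesis unfolding multicover_def by blast
qed

text \<open>A leg is the part of a root-to-point path without the root.\<close>

definition leg :: "'v set \<Rightarrow> nat \<Rightarrow> 'v set \<Rightarrow> 'v \<Rightarrow> 'v list \<Rightarrow> bool" where
  "leg X r T u q \<longleftrightarrow> walk q \<and> hd q \<in> T \<and> last q = u \<and> set q \<subseteq> X \<and> length q \<le> Suc r \<and>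
     (\<forall>z\<in>set q. near X r z u) \<and> (\<forall>z\<in>set (tl q). near X (r - 1) z u)"

text \<open>The roots are to become the vertices of a graph and the points \<open>u k\<close> its
  edges, each point being joined by legs to all roots at once. Legs of one point may meet or touch,
  since only two of them are used for an edge and their union is shortened to an induced
  path.\<close>

definition spider :: "'v set \<Rightarrow> nat \<Rightarrow> nat \<Rightarrow> nat set \<Rightarrow> (nat \<Rightarrow> 'v set) \<Rightarrow> 'v set \<Rightarrow> nat \<Rightarrow> bool" where
  "spider X r n I L C m \<longleftrightarrow> (\<exists>J p u. J \<subseteq> I \<and> card J = n \<and>
     (\<forall>k<m. u k \<in> C \<and> (\<forall>i\<in>J. leg X r (L i) (u k) (p k i))) \<and>
     (\<forall>k<m. \<forall>l<m. k \<noteq> l \<longrightarrow> (\<forall>i\<in>J. \<forall>j\<in>J. \<forall>a\<in>set (p k i). \<forall>b\<in>set (p l j). a \<noteq> b \<and> \<not> adj a b)))"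

lemma leg_mono: "leg X r T u q \<Longrightarrow> T \<subseteq> T' \<Longrightarrow> leg X r T' u q"
  unfolding leg_def by blast

lemma spider_mono:
  assumes "spider X r n J L' C' m" "J \<subseteq> I" "C' \<subseteq> C" "\<And>i. i \<in> J \<Longrightarrow> L' i \<subseteq> L i"
  shows "spider X r n I L C m"
proof -
  obtain J' p u where *: "J' \<subseteq> J" "card J' = n"
     "\<forall>k<m. u k \<in> C' \<and> (\<forall>i\<in>J'. leg X r (L' i) (u k) (p k i))"
     "\<forall>k<m. \<forall>l<m. k \<noteq> l \<longrightarrow> (\<forall>i\<in>J'. \<forall>j\<in>J'. \<forall>a\<in>set (p k i). \<forall>b\<in>set (p l j). a \<noteq> b \<and> \<not> adj a b)"
    using assms(1) unfolding spider_def by (elim exE conjE) (rule that)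
  have "\<forall>k<m. u k \<in> C \<and> (\<forall>i\<in>J'. leg X r (L i) (u k) (p k i))"
  proof (intro allI impI conjI ballI)
    fix k assume k: "k < m"
    show "u k \<in> C" using *(3) k assms(3) by blast
    fix i assume i: "i \<in> J'"
    show "leg X r (L i) (u k) (p k i)"
      by (rule leg_mono[OF _ assms(4)]) (use *(1,3) k i in auto)
  qed
  with * assms(2) show ?thesis unfolding spider_def
    by (intro exI[of _ J'] exI[of _ p] exI[of _ u]) auto
qed

lemma ex_leg:
  assumes "u \<in> reach X r T" "0 < r"
  shows "\<exists>q. leg X r T u q"
proof -
  obtain t where t: "t \<in> T" "near X r t u" using assms unfolding reach_def by blast
  obtain q where q: "walk q" "hd q = t" "last q = u" "set q \<subseteq> X" "length q \<le> Suc r"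
     "\<forall>z\<in>set (tl q). near X (r - 1) z u"
    using near_walk[OF t(2)] by blast
  have "near X r z u" if "z \<in> set q" for z
  proof -
    have "z = t \<or> z \<in> set (tl q)" using that q(1,2) by (cases q) (auto simp: walk_def)
    then show ?thesis using q(6) t(2) near_mono[of "r - 1" r X z u] by auto
  qed
  then show ?thesis using q t unfolding leg_def by blast
qed

text \<open>A vertex of an old leg is within \<open>r\<close> of its point, and within
  \<open>r - 1\<close> unless it is the first. New legs are farther than \<open>r\<close> from all
  old points, so they neither share a vertex with an old leg nor touch it beyond its first vertex;
  contact with first vertices is what \<open>sep\<close> forbids.\<close>

lemma spider_add:
  assumes "spider X r n J L' C' m" "0 < r" "J \<subseteq> I" "C' \<subseteq> C" "\<And>i. i \<in> J \<Longrightarrow> L' i \<subseteq> L i"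
    and u: "u \<in> C" and q: "\<And>i. i \<in> J \<Longrightarrow> leg X r (L i) u (q i)"
    and far: "\<And>i w. i \<in> J \<Longrightarrow> w \<in> C' \<Longrightarrow> \<forall>z\<in>set (q i). \<not> near X r z w"
    and sep: "\<And>i j. i \<in> J \<Longrightarrow> j \<in> J \<Longrightarrow> \<forall>z\<in>set (q i). \<forall>t\<in>L' j. \<not> adj z t"
  shows "spider X r n I L C (Suc m)"
proof -
  obtain J' p us where *: "J' \<subseteq> J" "card J' = n"
     "\<forall>k<m. us k \<in> C' \<and> (\<forall>i\<in>J'. leg X r (L' i) (us k) (p k i))"
     "\<forall>k<m. \<forall>l<m. k \<noteq> l \<longrightarrow> (\<forall>i\<in>J'. \<forall>j\<in>J'. \<forall>a\<in>set (p k i). \<forall>b\<in>set (p l j). a \<noteq> b \<and> \<not> adj a b)"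
    using assms(1) unfolding spider_def by (elim exE conjE) (rule that)
  define p' where "p' k i = (if k = m then q i else p k i)" for k i
  define us' where "us' k = (if k = m then u else us k)" for k
  have legs: "\<forall>k<Suc m. us' k \<in> C \<and> (\<forall>i\<in>J'. leg X r (L i) (us' k) (p' k i))"
  proof (intro allI impI)
    fix k assume "k < Suc m"
    then consider "k = m" | "k < m" by linarith
    then show "us' k \<in> C \<and> (\<forall>i\<in>J'. leg X r (L i) (us' k) (p' k i))"
    proof cases
      case 1
      then show ?thesis using u q *(1) by (auto simp: us'_def p'_def)
    next
      case 2
      then have a: "us k \<in> C'" "\<forall>i\<in>J'. leg X r (L' i) (us k) (p k i)" using *(3) by auto
      have "leg X r (L i) (us k) (p k i)" if "i \<in> J'" for i
        by (rule leg_mono[OF _ assms(5)]) (use a(2) that *(1) in auto)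
      then show ?thesis using 2 assms(4) a(1) by (auto simp: us'_def p'_def)
    qed
  qed
  have new: "a \<noteq> b \<and> \<not> adj a b"
    if "l < m" "i \<in> J'" "j \<in> J'" "a \<in> set (q i)" "b \<in> set (p l j)" for l i j a b
  proof -
    have ij: "i \<in> J" "j \<in> J" using that *(1) by auto
    have lg: "leg X r (L' j) (us l) (p l j)" "us l \<in> C'" using *(3) that by auto
    have nb: "near X r b (us l)" and tl: "b \<in> set (tl (p l j)) \<Longrightarrow> near X (r - 1) b (us l)"
      using lg(1) that(5) unfolding leg_def by blast+
    have na: "\<not> near X r a (us l)" using far[OF ij(1) lg(2)] that(4) by blast
    have aX: "a \<in> X" using q[OF ij(1)] that(4) unfolding leg_def by blast
    have "\<not> adj a b"
    proof
      assume ab: "adj a b"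
      have "b = hd (p l j) \<or> b \<in> set (tl (p l j))"
        using that(5) by (cases "p l j") auto
      then show False
      proof
        assume "b = hd (p l j)"
        then have "b \<in> L' j" using lg(1) unfolding leg_def by blast
        then show False using sep[OF ij] that(4) ab by blast
      next
        assume "b \<in> set (tl (p l j))"
        then have "near X (Suc (r - 1)) a (us l)" using near_step[OF aX ab tl] by blast
        then show False using na \<open>0 < r\<close> by simp
      qed
    qed
    then show ?thesis using na nb by blast
  qed
  have "\<forall>k<Suc m. \<forall>l<Suc m. k \<noteq> l \<longrightarrow>
     (\<forall>i\<in>J'. \<forall>j\<in>J'. \<forall>a\<in>set (p' k i). \<forall>b\<in>set (p' l j). a \<noteq> b \<and> \<not> adj a b)"
  proof (intro allI impI ballI)
    fix k l i j a b
    assume h: "k < Suc m" "l < Suc m" "k \<noteq> l" "i \<in> J'" "j \<in> J'" "a \<in> set (p' k i)" "b \<in> set (p' l j)"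
    then consider "k = m" "l < m" | "l = m" "k < m" | "k < m" "l < m" by linarith
    then show "a \<noteq> b \<and> \<not> adj a b"
    proof cases
      case 1
      then show ?thesis using new[of l i j a b] h by (auto simp: p'_def)
    next
      case 2
      then show ?thesis using new[of k j i b a] h adj_sym by (auto simp: p'_def)
    next
      case 3
      then show ?thesis using *(4) h by (auto simp: p'_def)
    qed
  qed
  with legs * assms(3) show ?thesis unfolding spider_def
    by (intro exI[of _ J'] exI[of _ p'] exI[of _ us']) auto
qed

text \<open>Half of the covers, once shrunk, reach a set \<open>P\<close> and miss a set
  \<open>Q\<close>. A point \<open>u\<close> of \<open>Q\<close> receives legs from the original
  covers, while the shrunken ones serve \<open>P\<close>. A neighbour of the tail of a leg is within
  \<open>r\<close> of \<open>u\<close>, and shrunken covers do not reach \<open>u\<close>; so only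
  first vertices of legs can see them, and a pigeonhole makes this adjacency depend on the indices
  alone.\<close>

lemma multicover_step:
  assumes r: "0 < r" and W: "world r d X" and mc: "multicover X r I x L C" and n: "card I = n" "0 < n"
    and big: "split_bound d (n * Suc r * d + 2 ^ (n * n) * Suc D + 1) n \<le> chi C"
  shows "\<exists>J C' L' u q A. J \<subseteq> I \<and> n \<le> 2 * card J \<and> multicover X r J x L' C' \<and> D < chi C' \<and> C' \<subseteq> C \<and>
    (\<forall>i\<in>J. L' i \<subseteq> L i) \<and> u \<in> C \<and> (\<forall>i\<in>J. leg X r (L i) u (q i)) \<and>
    (\<forall>i\<in>J. \<forall>w\<in>C'. \<forall>z\<in>set (q i). \<not> near X r z w) \<and>
    (\<forall>i\<in>J. \<forall>j\<in>J. \<forall>z\<in>set (tl (q i)). \<forall>t\<in>L' j. \<not> adj z t) \<and>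
    (\<forall>i\<in>J. \<forall>j\<in>J. \<forall>t\<in>L' j. adj (hd (q i)) t \<longleftrightarrow> A i j)"
proof -
  \<comment> \<open>The balls around at most \<open>n * Suc r\<close> leg vertices cost
    \<open>n * Suc r * d\<close>; the factor \<open>2 ^ (n * n)\<close> bounds the number of
    adjacency patterns between legs and covers.\<close>
  define E where "E = n * Suc r * d + 2 ^ (n * n) * Suc D + 1"
  have E: "0 < E" by (simp add: E_def)
  have finX: "finite X" using W by (simp add: world_def)
  have finI: "finite I" and CX: "C \<subseteq> X" using mc by (auto simp: multicover_def)
  have cov: "\<forall>i\<in>I. L i \<subseteq> X \<and> C \<union> C \<subseteq> reach X r (L i)" using mc by (auto simp: multicover_def)
  have big': "split_bound d E (card I) \<le> chi C" using big n unfolding E_def by simp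
  obtain P Q IP IQ L1 where s: "P \<subseteq> C" "Q \<subseteq> C" "E \<le> chi P" "E \<le> chi Q" "I = IP \<union> IQ"
     "\<forall>i\<in>I. L1 i \<subseteq> L i"
     "\<forall>i\<in>IP. P \<subseteq> reach X r (L1 i) \<and> Q \<inter> reach X r (L1 i) = {}"
     "\<forall>i\<in>IQ. Q \<subseteq> reach X r (L1 i) \<and> P \<inter> reach X r (L1 i) = {}"
    using cover_split[OF W E finI CX CX cov big' big'] by (elim exE conjE) (rule that)
  have "n \<le> card IP + card IQ" using s(5) n card_Un_le by metis
  then have "\<exists>J P Q. J \<subseteq> I \<and> n \<le> 2 * card J \<and> P \<subseteq> C \<and> Q \<subseteq> C \<and> E \<le> chi P \<and> E \<le> chi Q \<and>
     (\<forall>i\<in>J. P \<subseteq> reach X r (L1 i) \<and> Q \<inter> reach X r (L1 i) = {})"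
  proof (cases "card IQ \<le> card IP")
    case True
    then have "n \<le> 2 * card IP" using \<open>n \<le> card IP + card IQ\<close> by linarith
    then show ?thesis by (intro exI[of _ IP] exI[of _ P] exI[of _ Q]) (simp add: s)
  next
    case False
    then have "n \<le> 2 * card IQ" using \<open>n \<le> card IP + card IQ\<close> by linarith
    then show ?thesis by (intro exI[of _ IQ] exI[of _ Q] exI[of _ P]) (simp add: s)
  qed
  then obtain J P Q where J: "J \<subseteq> I" "n \<le> 2 * card J" "P \<subseteq> C" "Q \<subseteq> C" "E \<le> chi P" "E \<le> chi Q"
     "\<forall>i\<in>J. P \<subseteq> reach X r (L1 i) \<and> Q \<inter> reach X r (L1 i) = {}"
    by (elim exE conjE) (rule that)
  have finJ: "finite J" using J(1) finI finite_subset by blast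
  have cJ: "card J \<le> n" using J(1) n finI card_mono by blast
  have "Q \<noteq> {}" using J(6) E by auto
  then obtain u where u: "u \<in> Q" by blast
  then have uC: "u \<in> C" using J by blast
  have "\<exists>q. leg X r (L i) u q" if "i \<in> J" for i
    using cov that J(1) uC r by (intro ex_leg) auto
  then obtain q where q: "\<And>i. i \<in> J \<Longrightarrow> leg X r (L i) u (q i)" by metis
  define Z where "Z = (\<Union>i\<in>J. set (q i))"
  have ZX: "Z \<subseteq> X" using q unfolding Z_def leg_def by blast
  have "card Z \<le> (\<Sum>i\<in>J. card (set (q i)))" unfolding Z_def by (rule card_UN_le[OF finJ])
  also have "\<dots> \<le> (\<Sum>i\<in>J. Suc r)"
    using q unfolding leg_def by (intro sum_mono) (meson card_length le_trans)
  also have "\<dots> \<le> n * Suc r" using mult_le_mono1[OF cJ, of "Suc r"] by simp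
  finally have cZ: "card Z \<le> n * Suc r" .
  define N where "N = (\<Union>z\<in>Z. {w \<in> X. near X r z w})"
  have finZ: "finite Z" using ZX finX finite_subset by blast
  have "chi N \<le> card Z * d" unfolding N_def
    using W ZX finX finZ by (intro chi_UN_le) (auto simp: world_def)
  also have "\<dots> \<le> n * Suc r * d" using cZ mult_le_mono1 by blast
  finally have cN: "chi N \<le> n * Suc r * d" .
  define C1 where "C1 = P - N"
  have finP: "finite P" using J(3) CX finX by (meson finite_subset)
  have finN: "finite N" unfolding N_def using finX finZ by auto
  have "chi P \<le> chi C1 + chi N" unfolding C1_def using chi_diff[OF finP finN] .
  then have cC1: "2 ^ (n * n) * Suc D < chi C1" using cN J(5) unfolding E_def by linarith
  have "\<exists>t\<in>L1 j. near X r t w" if "j \<in> J" "w \<in> C1" for j w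
    using that J(7) unfolding C1_def reach_def by blast
  then obtain g where g: "\<And>j w. j \<in> J \<Longrightarrow> w \<in> C1 \<Longrightarrow> g j w \<in> L1 j \<and> near X r (g j w) w" by metis
  \<comment> \<open>The pattern of \<open>w\<close>: which first leg vertices see its chosen cover
    vertices. One pattern is kept, and each cover is cut down to the elements conforming to
    it.\<close>
  define f where "f w = {(i, j). i \<in> J \<and> j \<in> J \<and> adj (hd (q i)) (g j w)}" for w
  have "f ` C1 \<subseteq> Pow (J \<times> J)" unfolding f_def by auto
  moreover have "finite (Pow (J \<times> J))" using finJ by auto
  moreover have "card (Pow (J \<times> J)) * D < chi C1"
  proof -
    have "card J * card J \<le> n * n" using cJ mult_le_mono by blast
    then have "card (Pow (J \<times> J)) \<le> 2 ^ (n * n)"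
      using finJ by (simp add: card_Pow card_cartesian_product)
    then have "card (Pow (J \<times> J)) * D \<le> 2 ^ (n * n) * Suc D" by (intro mult_le_mono) auto
    then show ?thesis using cC1 by linarith
  qed
  moreover have finC1: "finite C1" unfolding C1_def using finP by simp
  ultimately obtain S where S: "D < chi {w \<in> C1. f w = S}"
    using chi_pigeon[of C1 "Pow (J \<times> J)" f D] by blast
  define C' where "C' = {w \<in> C1. f w = S}"
  define L' where "L' j = {t \<in> L1 j. \<forall>i\<in>J. adj (hd (q i)) t \<longleftrightarrow> (i, j) \<in> S}" for j
  have C'C: "C' \<subseteq> C" using J(3) unfolding C'_def C1_def by blast
  have L'L: "L' i \<subseteq> L i" if "i \<in> J" for i using s(6) that J(1) unfolding L'_def by blast
  have mc': "multicover X r J x L' C'"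
  proof (rule multicover_subset[OF mc J(1) C'C L'L])
    fix j assume j: "j \<in> J"
    show "C' \<subseteq> reach X r (L' j)"
    proof
      fix w assume w: "w \<in> C'"
      then have w1: "w \<in> C1" "f w = S" unfolding C'_def by auto
      have "g j w \<in> L' j" using g[OF j w1(1)] w1(2) j unfolding L'_def f_def by auto
      then show "w \<in> reach X r (L' j)"
        using g[OF j w1(1)] near_in unfolding reach_def by blast
    qed
  qed
  have far: "\<not> near X r z w" if "i \<in> J" "w \<in> C'" "z \<in> set (q i)" for i w z
  proof
    assume "near X r z w"
    then have "w \<in> N" using that near_in unfolding N_def Z_def by blast
    then show False using that(2) unfolding C'_def C1_def by blast
  qed
  have sep: "\<not> adj z t" if "i \<in> J" "j \<in> J" "z \<in> set (tl (q i))" "t \<in> L' j" for i j z t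
  proof
    assume a: "adj z t"
    have nz: "near X (r - 1) z u" using q[OF that(1)] that(3) unfolding leg_def by blast
    have t: "t \<in> L1 j" using that(4) unfolding L'_def by blast
    then have tX: "t \<in> X" using s(6) cov that(2) J(1) by blast
    have "near X (Suc (r - 1)) t u" using near_step[OF tX adj_sym[OF a] nz] .
    then have "u \<in> reach X r (L1 j)" using r t near_in unfolding reach_def by auto
    then show False using J(7) that(2) u by blast
  qed
  have A: "\<forall>i\<in>J. \<forall>j\<in>J. \<forall>t\<in>L' j. adj (hd (q i)) t \<longleftrightarrow> (i, j) \<in> S"
    unfolding L'_def by blast
  show ?thesis
    by (rule exI[of _ J], rule exI[of _ C'], rule exI[of _ L'], rule exI[of _ u], rule exI[of _ q],
        rule exI[of _ "\<lambda>i j. (i, j) \<in> S"])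
      (use J(1,2) mc' S C'C L'L uC q far sep A in \<open>auto simp: C'_def\<close>)
qed

text \<open>Outer induction on the size of cliques in the union of the covers, inner induction on
  the number of points. If, after a step, some first leg vertex sees all of many new covers, then
  cliques in these covers are smaller, since that vertex can be added to them, and the outer
  hypothesis gives all points at once. Otherwise the sight relation is sparse, a large independent
  set of indices remains, and the new legs are added to a spider with one point fewer.\<close>

lemma multicover_spider:
  assumes r: "0 < r"
  shows "\<exists>n0 D0. \<forall>X I x L C. world r d X \<longrightarrow> multicover X r I x L C \<longrightarrow> n0 \<le> card I \<longrightarrow> D0 \<le> chi C \<longrightarrow>
     (\<forall>K. clq K \<longrightarrow> K \<subseteq> (\<Union>i\<in>I. L i) \<longrightarrow> card K \<le> w) \<longrightarrow> spider X r n I L C m"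
proof (induction w arbitrary: m)
  case 0
  have "False" if h: "world r d X" "multicover X r I x L C" "1 \<le> card I" "1 \<le> chi C"
    "\<forall>K. clq K \<longrightarrow> K \<subseteq> (\<Union>i\<in>I. L i) \<longrightarrow> card K \<le> 0" for X I x L C
  proof -
    obtain i where i: "i \<in> I" using h(3) by fastforce
    have "C \<noteq> {}" using h(4) by auto
    then obtain t where t: "t \<in> L i" using h(2) i unfolding multicover_def reach_def by blast
    have "clq {t}" by (simp add: clq_def)
    then have "card {t} \<le> 0" using h(5) t i by blast
    then show False by simp
  qed
  then show ?case by (intro exI[of _ 1]) blast
next
  case (Suc w)
  note IHw = Suc.IH
  show ?case
  proof (induction m)
    case 0
    have "spider X r n I L C 0" if h: "multicover X r I x L C" "n \<le> card I" for X I x L C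
    proof -
      obtain J where "J \<subseteq> I" "card J = n" using h(2) obtain_subset_with_card_n by metis
      then show ?thesis unfolding spider_def by auto
    qed
    then show ?case by blast
  next
    case (Suc m)
    obtain n0 D0 where n0: "\<And>X I x L C. world r d X \<Longrightarrow> multicover X r I x L C \<Longrightarrow> n0 \<le> card I \<Longrightarrow>
       D0 \<le> chi C \<Longrightarrow> (\<forall>K. clq K \<longrightarrow> K \<subseteq> (\<Union>i\<in>I. L i) \<longrightarrow> card K \<le> w) \<Longrightarrow> spider X r n I L C (Suc m)"
      using IHw[of "Suc m"] by blast
    obtain n1 D1 where n1: "\<And>X I x L C. world r d X \<Longrightarrow> multicover X r I x L C \<Longrightarrow> n1 \<le> card I \<Longrightarrow>
       D1 \<le> chi C \<Longrightarrow> (\<forall>K. clq K \<longrightarrow> K \<subseteq> (\<Union>i\<in>I. L i) \<longrightarrow> card K \<le> Suc w) \<Longrightarrow> spider X r n I L C m"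
      using Suc.IH by blast
    \<comment> \<open>Half of the indices survive the step and a share of
      \<open>1 / (2 * n0 + 1)\<close> the sparse case, which must leave \<open>n1\<close>; the final
      \<open>1\<close> makes \<open>N\<close> positive.\<close>
    define N where "N = 2 * ((2 * n0 + 1) * n1) + 1"
    define D where "D = D0 + D1"
    define B where "B = split_bound d (N * Suc r * d + 2 ^ (N * N) * Suc D + 1) N"
    have "spider X r n I L C (Suc m)"
      if W: "world r d X" and mc0: "multicover X r I0 x L C" and cI0: "N \<le> card I0" and cC: "B \<le> chi C"
        and om0: "\<forall>K. clq K \<longrightarrow> K \<subseteq> (\<Union>i\<in>I0. L i) \<longrightarrow> card K \<le> Suc w" and I: "I \<subseteq> I0" "card I = N"
      for X I I0 x L C
    proof -
      have mc: "multicover X r I x L C"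
        using multicover_subset[OF mc0 I(1), of C L] mc0 I(1) unfolding multicover_def by blast
      have om: "\<forall>K. clq K \<longrightarrow> K \<subseteq> (\<Union>i\<in>I. L i) \<longrightarrow> card K \<le> Suc w" using om0 I(1) by blast
      have N0: "0 < N" by (simp add: N_def)
      obtain J C' L' u q A where s: "J \<subseteq> I" "N \<le> 2 * card J" "multicover X r J x L' C'" "D < chi C'"
        "C' \<subseteq> C" "\<forall>i\<in>J. L' i \<subseteq> L i" "u \<in> C" "\<forall>i\<in>J. leg X r (L i) u (q i)"
        "\<forall>i\<in>J. \<forall>w\<in>C'. \<forall>z\<in>set (q i). \<not> near X r z w"
        "\<forall>i\<in>J. \<forall>j\<in>J. \<forall>z\<in>set (tl (q i)). \<forall>t\<in>L' j. \<not> adj z t"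
        "\<forall>i\<in>J. \<forall>j\<in>J. \<forall>t\<in>L' j. adj (hd (q i)) t \<longleftrightarrow> A i j"
        using multicover_step[OF r W mc I(2) N0 cC[unfolded B_def]] by (elim exE conjE) (rule that)
      have finJ: "finite J" using s(3) unfolding multicover_def by blast
      have hdL: "hd (q i) \<in> L i" if "i \<in> J" for i using s(8) that unfolding leg_def by blast
      show ?thesis
      proof (cases "\<exists>i\<in>J. n0 \<le> card {j \<in> J. A i j}")
        case True
        then obtain i where i: "i \<in> J" "n0 \<le> card {j \<in> J. A i j}" by blast
        let ?J = "{j \<in> J. A i j}"
        have mcJ: "multicover X r ?J x L' C'"
          using multicover_subset[OF s(3), of ?J C' L'] s(3) unfolding multicover_def by blast
        have "\<forall>K. clq K \<longrightarrow> K \<subseteq> (\<Union>j\<in>?J. L' j) \<longrightarrow> card K \<le> w"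
        proof (intro allI impI)
          fix K assume K: "clq K" "K \<subseteq> (\<Union>j\<in>?J. L' j)"
          have ad: "adj (hd (q i)) t" if "t \<in> K" for t using K(2) that s(11) i(1) by blast
          have "clq (insert (hd (q i)) K)"
            using K(1) ad adj_sym unfolding clq_def by (metis insert_iff)
          moreover have "insert (hd (q i)) K \<subseteq> (\<Union>j\<in>I. L j)"
            using K(2) s(1,6) hdL[OF i(1)] i(1) by blast
          ultimately have "card (insert (hd (q i)) K) \<le> Suc w" using om by blast
          moreover have "hd (q i) \<notin> K" using ad adj_irr by blast
          moreover have "finite K"
          proof -
            have "K \<subseteq> X" using K(2) s(3) unfolding multicover_def by blast
            then show ?thesis using W finite_subset unfolding world_def by blast
          qed
          ultimately show "card K \<le> w" by simp
        qed
        then have sp: "spider X r n ?J L' C' (Suc m)"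
          using n0[OF W mcJ i(2)] s(4) unfolding D_def by simp
        show ?thesis by (rule spider_mono[OF sp]) (use s(1,5,6) in auto)
      next
        case False
        then have "\<And>i. i \<in> J \<Longrightarrow> card {j \<in> J. A i j} \<le> n0" by force
        from independent_in_sparse_digraph[of J A, OF finJ this]
        obtain J1 where J1: "J1 \<subseteq> J" "card J \<le> (2 * n0 + 1) * card J1"
          "\<forall>i\<in>J1. \<forall>j\<in>J1. i \<noteq> j \<longrightarrow> \<not> A i j" by blast
        have "(2 * n0 + 1) * n1 \<le> (2 * n0 + 1) * card J1" using J1(2) s(2) unfolding N_def by linarith
        then have cJ1: "n1 \<le> card J1" by (rule mult_left_le_imp_le) simp
        have mcJ: "multicover X r J1 x L' C'"
          using multicover_subset[OF s(3) J1(1), of C' L'] s(3) J1(1) unfolding multicover_def by blast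
        have "\<forall>K. clq K \<longrightarrow> K \<subseteq> (\<Union>j\<in>J1. L' j) \<longrightarrow> card K \<le> Suc w"
        proof (intro allI impI)
          fix K assume K: "clq K" "K \<subseteq> (\<Union>j\<in>J1. L' j)"
          have "(\<Union>j\<in>J1. L' j) \<subseteq> (\<Union>i\<in>I. L i)"
            using s(1,6) J1(1) by (intro UN_mono) auto
          then show "card K \<le> Suc w" using om K by (meson subset_trans)
        qed
        then have sp: "spider X r n J1 L' C' m" using n1[OF W mcJ cJ1] s(4) unfolding D_def by simp
        have sep: "\<forall>z\<in>set (q i). \<forall>t\<in>L' j. \<not> adj z t" if ij: "i \<in> J1" "j \<in> J1" for i j
        proof (intro ballI)
          fix z t assume z: "z \<in> set (q i)" "t \<in> L' j"
          have ij': "i \<in> J" "j \<in> J" using ij J1(1) by auto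
          have "z = hd (q i) \<or> z \<in> set (tl (q i))" using z(1) by (cases "q i") auto
          then show "\<not> adj z t"
          proof
            assume zh: "z = hd (q i)"
            show ?thesis
            proof (cases "i = j")
              case True
              \<comment> \<open>Independence concerns distinct indices only; on the diagonal the
                stability of \<open>L i\<close> excludes the edge.\<close>
              have "stable (L i)" using mc s(1) ij' unfolding multicover_def by blast
              moreover have "t \<in> L i" using z(2) True s(6) ij' by blast
              ultimately show ?thesis using zh hdL[OF ij'(1)] unfolding stable_def by blast
            next
              case False
              then show ?thesis using s(11) J1(3) ij ij' z(2) zh by blast
            qed
          qed (use s(10) ij' z(2) in blast)
        qed
        show ?thesis
        proof (rule spider_add[OF sp r])
          show "J1 \<subseteq> I" using s(1) J1(1) by blast
          show "C' \<subseteq> C" "u \<in> C" by fact+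
          show "L' i \<subseteq> L i" "leg X r (L i) u (q i)" if "i \<in> J1" for i
            using s(6,8) that J1(1) by auto
          show "\<forall>z\<in>set (q i). \<not> near X r z w" if "i \<in> J1" "w \<in> C'" for i w
            using s(9) that J1(1) by auto
        qed (rule sep)
      qed
    qed
    note main = this
    have "spider X r n I0 L C (Suc m)"
      if h: "world r d X" "multicover X r I0 x L C" "N \<le> card I0" "B \<le> chi C"
        "\<forall>K. clq K \<longrightarrow> K \<subseteq> (\<Union>i\<in>I0. L i) \<longrightarrow> card K \<le> Suc w" for X I0 x L C
    proof -
      obtain I where I: "I \<subseteq> I0" "card I = N" using h(3) obtain_subset_with_card_n by metis
      show ?thesis by (rule spider_mono[OF main[OF h I] I(1)]) auto
    qed
    then show ?case by blast
  qed
qed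

end

section \<open>Subdivisions from spiders\<close>

context sgraph
begin

section \<open>Walks, and shortening them to induced paths\<close>

lemma walk_append:
  assumes "walk p" "walk q" "adj (last p) (hd q)"
  shows "walk (p @ q)"
  unfolding walk_def
proof (intro conjI allI impI)
  show "p @ q \<noteq> []" using assms by (simp add: walk_def)
  fix i assume i: "Suc i < length (p @ q)"
  have ne: "p \<noteq> []" "q \<noteq> []" using assms by (auto simp: walk_def)
  consider "Suc i < length p" | "Suc i = length p" | "length p \<le> i" by linarith
  then show "adj ((p @ q) ! i) ((p @ q) ! Suc i)"
  proof cases
    case 1
    then show ?thesis using assms(1) by (simp add: walk_def nth_append)
  next
    case 2
    then have i2: "i = length p - 1" by simp
    have "(p @ q) ! i = last p" using ne i2 2 by (simp add: nth_append last_conv_nth)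
    moreover have "(p @ q) ! Suc i = hd q" using ne 2 by (simp add: nth_append hd_conv_nth)
    ultimately show ?thesis using assms(3) by simp
  next
    case 3
    then have "Suc (i - length p) < length q" using i by simp
    then have "adj (q ! (i - length p)) (q ! Suc (i - length p))" using assms(2) by (simp add: walk_def)
    then show ?thesis using 3 by (simp add: nth_append Suc_diff_le)
  qed
qed

lemma walk_rev:
  assumes "walk p"
  shows "walk (rev p)"
  unfolding walk_def
proof (intro conjI allI impI)
  show "rev p \<noteq> []" using assms by (simp add: walk_def)
  fix i assume i: "Suc i < length (rev p)"
  define k where "k = length p - Suc (Suc i)"
  have k: "Suc k < length p" "length p - Suc i = Suc k" using i by (auto simp: k_def)
  have "adj (p ! k) (p ! Suc k)" using assms k by (simp add: walk_def)
  then show "adj (rev p ! i) (rev p ! Suc i)"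
    using i k adj_sym by (simp add: rev_nth k_def)
qed

lemma walk_tl: "walk p \<Longrightarrow> tl p \<noteq> [] \<Longrightarrow> walk (tl p)"
  unfolding walk_def by (auto simp: nth_tl)

text \<open>A repeated vertex or a chord allows a detour to be cut out, which shortens the walk; a
  walk with neither is an induced path.\<close>

lemma walk_shortcut:
  assumes "walk p"
  shows "\<exists>q. walk q \<and> hd q = hd p \<and> last q = last p \<and> set q \<subseteq> set p \<and>
     (\<forall>i j. i < j \<longrightarrow> j < length q \<longrightarrow> q ! i \<noteq> q ! j \<and> (adj (q ! i) (q ! j) \<longrightarrow> j = Suc i))"
  using assms
proof (induction "length p" arbitrary: p rule: less_induct)
  case less
  show ?case
  proof (cases "\<forall>i j. i < j \<longrightarrow> j < length p \<longrightarrow> p ! i \<noteq> p ! j \<and> (adj (p ! i) (p ! j) \<longrightarrow> j = Suc i)")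
    case True
    then show ?thesis using less.prems by blast
  next
    case False
    then obtain i j where ij: "i < j" "j < length p" "p ! i = p ! j \<or> adj (p ! i) (p ! j) \<and> j \<noteq> Suc i"
      by blast
    \<comment> \<open>The prefix of length \<open>k\<close> is kept and the walk resumes at
      \<open>j\<close>: a repeated vertex is retained only at \<open>j\<close>, whereas for a chord
      the left end \<open>p ! i\<close> stays.\<close>
    define k where "k = (if p ! i = p ! j then i else Suc i)"
    have k: "k < j" "k = 0 \<Longrightarrow> p ! 0 = p ! j" using ij by (auto simp: k_def split: if_splits)
    have kad: "adj (p ! (k - 1)) (p ! j)" if "k > 0"
    proof (cases "p ! i = p ! j")
      case True
      then have "k = i" by (simp add: k_def)
      then have "adj (p ! (k - 1)) (p ! i)"
        using less.prems that ij unfolding walk_def by (metis Suc_pred' order.strict_trans)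
      then show ?thesis using True by simp
    next
      case False
      then show ?thesis using ij by (simp add: k_def)
    qed
    define q where "q = take k p @ drop j p"
    have len: "length q = k + (length p - j)" using k ij by (simp add: q_def)
    have nth: "q ! a = (if a < k then p ! a else p ! (a - k + j))" if "a < length q" for a
      using that k ij len by (auto simp: q_def nth_append add.commute)
    have "walk q" unfolding walk_def
    proof (intro conjI allI impI)
      show "q \<noteq> []" using len ij by auto
      fix a assume a: "Suc a < length q"
      consider "Suc a < k" | "Suc a = k" | "k \<le> a" by linarith
      then show "adj (q ! a) (q ! Suc a)"
      proof cases
        case 1
        then show ?thesis using nth[of a] nth[of "Suc a"] a less.prems k ij by (simp add: walk_def)
      next
        case 2
        then show ?thesis using nth[of a] nth[of "Suc a"] a kad by auto
      next
        case 3
        have "Suc (a - k + j) < length p" using a len 3 by linarith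
        then have "adj (p ! (a - k + j)) (p ! Suc (a - k + j))" using less.prems by (simp add: walk_def)
        then show ?thesis using nth[of a] nth[of "Suc a"] a 3 by (simp add: Suc_diff_le)
      qed
    qed
    moreover have "length q < length p" using len k ij by simp
    moreover have "hd q = hd p"
    proof -
      have "q ! 0 = p ! 0" using nth[of 0] k ij len by (cases "k = 0") auto
      then show ?thesis using \<open>walk q\<close> less.prems by (simp add: walk_def hd_conv_nth)
    qed
    moreover have "last q = last p" using ij by (simp add: q_def)
    moreover have "set q \<subseteq> set p"
      unfolding q_def using set_take_subset set_drop_subset by fastforce
    ultimately show ?thesis using less.hyps[of q] by (metis subset_trans)
  qed
qed

end

lemma simple_graph_sgraph:
  "simple_graph G \<Longrightarrow> sgraph (\<lambda>a b. {a, b} \<in> edges G)"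
  unfolding simple_graph_def by unfold_locales (auto simp: insert_commute card_insert_if)

lemma induced_self: "simple_graph S \<Longrightarrow> S = induced G V \<Longrightarrow> V \<subseteq> verts G \<Longrightarrow> contains_induced S G"
  unfolding contains_induced_def induced_subgraph_def graph_iso_def
  by (rule exI[of _ S], intro conjI exI[of _ V] exI[of _ id]) (auto simp: induced_def simple_graph_def)

text \<open>Walks whose inner parts are disjoint and anticomplete, and see only their own branch
  vertices, need only be shortened to induced paths. As branch vertices are pairwise nonadjacent,
  each edge on the union of the vertex sets then lies on one of the paths. Of the at most
  \<open>r + 2\<close> vertices of a walk, two are branch vertices.\<close>

lemma subdivision_of_walks:
  fixes F :: "'f ugraph" and G :: "'a ugraph" and \<phi> :: "'f \<Rightarrow> 'a" and W :: "'f set \<Rightarrow> 'a list"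
  assumes F: "simple_graph F" and G: "simple_graph G"
    and \<phi>: "inj_on \<phi> (verts F)" "\<phi> ` verts F \<subseteq> verts G"
      "\<And>v w. v \<in> verts F \<Longrightarrow> w \<in> verts F \<Longrightarrow> {\<phi> v, \<phi> w} \<notin> edges G"
    and W: "\<And>e. e \<in> edges F \<Longrightarrow> sgraph.walk (\<lambda>a b. {a, b} \<in> edges G) (W e)"
      "\<And>e. e \<in> edges F \<Longrightarrow> set (W e) \<subseteq> verts G"
      "\<And>e. e \<in> edges F \<Longrightarrow> {hd (W e), last (W e)} = \<phi> ` e"
      "\<And>e. e \<in> edges F \<Longrightarrow> length (W e) \<le> r + 2"
    and W1: "\<And>e a f. e \<in> edges F \<Longrightarrow> a \<in> set (W e) - \<phi> ` e \<Longrightarrow> f \<in> verts F \<Longrightarrow>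
       a \<noteq> \<phi> f \<and> (f \<notin> e \<longrightarrow> {a, \<phi> f} \<notin> edges G)"
    and W2: "\<And>e e' a b. e \<in> edges F \<Longrightarrow> e' \<in> edges F \<Longrightarrow> e \<noteq> e' \<Longrightarrow> a \<in> set (W e) - \<phi> ` e \<Longrightarrow>
       b \<in> set (W e') - \<phi> ` e' \<Longrightarrow> a \<noteq> b \<and> {a, b} \<notin> edges G"
  shows "\<exists>S :: 'a ugraph. le_subdivision r F S \<and> contains_induced S G"
proof -
  interpret g: sgraph "\<lambda>a b. {a, b} \<in> edges G" using simple_graph_sgraph[OF G] .
  have eF: "e \<subseteq> verts F" "card e = 2" if "e \<in> edges F" for e
    using F that by (auto simp: simple_graph_def)
  have "\<forall>e\<in>edges F. \<exists>q. g.walk q \<and> hd q = hd (W e) \<and> last q = last (W e) \<and> set q \<subseteq> set (W e) \<and>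
     (\<forall>i j. i < j \<longrightarrow> j < length q \<longrightarrow> q ! i \<noteq> q ! j \<and> ({q ! i, q ! j} \<in> edges G \<longrightarrow> j = Suc i))"
  proof
    fix e assume "e \<in> edges F"
    from g.walk_shortcut[OF W(1)[OF this]]
    show "\<exists>q. g.walk q \<and> hd q = hd (W e) \<and> last q = last (W e) \<and> set q \<subseteq> set (W e) \<and>
     (\<forall>i j. i < j \<longrightarrow> j < length q \<longrightarrow> q ! i \<noteq> q ! j \<and> ({q ! i, q ! j} \<in> edges G \<longrightarrow> j = Suc i))" .
  qed
  from bchoice[OF this] obtain P where PP: "\<forall>e\<in>edges F. g.walk (P e) \<and> hd (P e) = hd (W e) \<and>
     last (P e) = last (W e) \<and> set (P e) \<subseteq> set (W e) \<and> (\<forall>i j. i < j \<longrightarrow> j < length (P e) \<longrightarrow>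
       P e ! i \<noteq> P e ! j \<and> ({P e ! i, P e ! j} \<in> edges G \<longrightarrow> j = Suc i))" ..
  have P: "g.walk (P e)" "hd (P e) = hd (W e) \<and> last (P e) = last (W e)" "set (P e) \<subseteq> set (W e)"
      "\<And>i j. i < j \<Longrightarrow> j < length (P e) \<Longrightarrow>
         P e ! i \<noteq> P e ! j \<and> ({P e ! i, P e ! j} \<in> edges G \<longrightarrow> j = Suc i)"
    if "e \<in> edges F" for e
    using bspec[OF PP that] by simp_all
  have ne: "P e \<noteq> []" if "e \<in> edges F" for e using P(1)[OF that] by (simp add: g.walk_def)
  have dist: "distinct (P e)" if "e \<in> edges F" for e
    unfolding distinct_conv_nth using P(4)[OF that] by (metis nat_neq_iff)
  have ends: "{hd (P e), last (P e)} = \<phi> ` e" if "e \<in> edges F" for e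
    using P(2)[OF that] W(3)[OF that] by simp
  have endsP: "\<phi> ` e \<subseteq> set (P e)" if "e \<in> edges F" for e
    unfolding ends[OF that, symmetric] using ne[OF that] by simp
  define inn where "inn e = set (P e) - \<phi> ` e" for e
  have inner: "inner_verts (P e) = inn e" if "e \<in> edges F" for e
    using ends[OF that] by (simp add: inner_verts_def inn_def)
  have innW: "inn e \<subseteq> set (W e) - \<phi> ` e" if "e \<in> edges F" for e
    using P(3)[OF that] by (auto simp: inn_def)
  define V where "V = \<phi> ` verts F \<union> (\<Union>e\<in>edges F. inn e)"
  define S where "S = induced G V"
  have VG: "V \<subseteq> verts G" unfolding V_def using \<phi>(2) innW W(2) by blast
  have PV: "set (P e) \<subseteq> V" if "e \<in> edges F" for e
    using that eF[OF that] unfolding V_def inn_def by blast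
  have simpS: "simple_graph S"
    using G F VG finite_subset unfolding S_def induced_def simple_graph_def V_def by auto
  have vS: "verts S = V" and eS: "edges S = {e \<in> edges G. e \<subseteq> V}" by (auto simp: S_def induced_def)
  have pathS: "is_path S (P e)" if "e \<in> edges F" for e
    unfolding is_path_def
  proof (intro conjI allI impI)
    show "P e \<noteq> []" "distinct (P e)" "set (P e) \<subseteq> verts S" using ne dist PV that vS by auto
    fix i assume i: "Suc i < length (P e)"
    then have "{P e ! i, P e ! Suc i} \<in> edges G" using P(1)[OF that] by (simp add: g.walk_def)
    moreover have "P e ! i \<in> V" "P e ! Suc i \<in> V" using PV[OF that] i by auto
    ultimately show "{P e ! i, P e ! Suc i} \<in> edges S" unfolding eS by simp
  qed
  have cardi: "card (inn e) \<le> r" if "e \<in> edges F" for e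
  proof -
    have "card (\<phi> ` e) = 2" using eF[OF that] \<phi>(1) by (metis card_image inj_on_subset)
    moreover have "card (inn e) = card (set (P e)) - card (\<phi> ` e)"
      unfolding inn_def using endsP[OF that] by (intro card_Diff_subset) (auto intro: finite_subset)
    moreover have "card (set (P e)) \<le> r + 2"
      using card_mono[OF _ P(3)[OF that]] card_length[of "W e"] W(4)[OF that] by (meson List.finite_set le_trans)
    ultimately show ?thesis by simp
  qed
  have disj: "inn e \<inter> \<phi> ` verts F = {}" if "e \<in> edges F" for e
    using W1[OF that] innW[OF that] by blast
  have disj2: "inn e \<inter> inn e' = {}" if "e \<in> edges F" "e' \<in> edges F" "e \<noteq> e'" for e e'
    using W2[OF that] innW[OF that(1)] innW[OF that(2)] by blast
  have onpath: "{a, b} \<in> path_edges (P e)"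
    if e: "e \<in> edges F" and ab: "a \<in> set (P e)" "b \<in> set (P e)" "{a, b} \<in> edges G" for a b e
  proof -
    obtain i j where ij: "i < length (P e)" "a = P e ! i" "j < length (P e)" "b = P e ! j"
      using ab(1,2) by (metis in_set_conv_nth)
    have "a \<noteq> b" using ab(3) g.adj_irr by auto
    then consider "i < j" | "j < i" using ij by (metis nat_neq_iff)
    then show ?thesis
    proof cases
      case 1
      then have "j = Suc i" using P(4)[OF e 1 ij(3)] ab(3) ij by simp
      then show ?thesis unfolding path_edges_def using ij by blast
    next
      case 2
      then have "i = Suc j" using P(4)[OF e 2 ij(1)] ab(3) ij by (simp add: insert_commute)
      then show ?thesis unfolding path_edges_def using ij by (metis (mono_tags, lifting) insert_commute mem_Collect_eq)
    qed
  qed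
  have from_inner: "\<exists>e\<in>edges F. {a, b} \<in> path_edges (P e)"
    if ab: "{a, b} \<in> edges G" "b \<in> V" and e: "e \<in> edges F" "a \<in> inn e" for a b e
  proof -
    have "b \<in> set (P e)"
    proof (rule ccontr)
      assume nb: "b \<notin> set (P e)"
      from ab(2) consider f where "f \<in> verts F" "b = \<phi> f" | e' where "e' \<in> edges F" "b \<in> inn e'"
        unfolding V_def by blast
      then show False
      proof cases
        case 1
        then have "f \<notin> e" using nb endsP[OF e(1)] by blast
        then show False using W1[OF e(1) _ 1(1)] innW[OF e(1)] e(2) ab(1) 1(2) by blast
      next
        case 2
        then have "e \<noteq> e'" using nb by (auto simp: inn_def)
        then show False using W2[OF e(1) 2(1)] innW[OF e(1)] innW[OF 2(1)] e(2) 2(2) ab(1) by blast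
      qed
    qed
    then show ?thesis using onpath[OF e(1) _ _ ab(1)] e by (auto simp: inn_def)
  qed
  have "edges S = (\<Union>e\<in>edges F. path_edges (P e))"
  proof
    show "(\<Union>e\<in>edges F. path_edges (P e)) \<subseteq> edges S"
      using pathS unfolding path_edges_def is_path_def by blast
    show "edges S \<subseteq> (\<Union>e\<in>edges F. path_edges (P e))"
    proof
      fix s assume s: "s \<in> edges S"
      then have "card s = 2" using simpS by (simp add: simple_graph_def)
      then obtain a b where s2: "s = {a, b}" by (meson card_2_iff)
      have ab: "{a, b} \<in> edges G" "a \<in> V" "b \<in> V" using s unfolding eS s2 by auto
      have "\<exists>e\<in>edges F. {a, b} \<in> path_edges (P e)"
      proof (cases "\<exists>e\<in>edges F. a \<in> inn e \<or> b \<in> inn e")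
        case True
        then obtain e where e: "e \<in> edges F" "a \<in> inn e \<or> b \<in> inn e" by blast
        have ba: "{b, a} \<in> edges G" using ab(1) by (simp add: insert_commute)
        from e(2) show ?thesis
        proof
          assume "b \<in> inn e"
          from from_inner[OF ba ab(2) e(1) this] show ?thesis by (simp add: insert_commute)
        qed (rule from_inner[OF ab(1,3) e(1)])
      next
        case False
        then have "a \<in> \<phi> ` verts F" "b \<in> \<phi> ` verts F" using ab unfolding V_def by auto
        then show ?thesis using \<phi>(3) ab(1) by auto
      qed
      then show "s \<in> (\<Union>e\<in>edges F. path_edges (P e))" unfolding s2 by blast
    qed
  qed
  moreover have "verts S = \<phi> ` verts F \<union> (\<Union>e\<in>edges F. inner_verts (P e))"
    unfolding vS V_def using inner by auto
  ultimately have "le_subdivision r F S"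
    unfolding le_subdivision_def using simpS \<phi>(1) pathS ends cardi disj disj2 inner
    by (intro conjI exI[of _ \<phi>] exI[of _ P]) auto
  moreover have "contains_induced S G" using induced_self[OF simpS S_def VG] .
  ultimately show ?thesis by blast
qed

text \<open>All graphs of a class are treated at once, inside the disjoint union of the simple graphs on
  a vertex type.\<close>

definition union_adj :: "'a ugraph \<times> 'a \<Rightarrow> 'a ugraph \<times> 'a \<Rightarrow> bool" where
  "union_adj p q \<longleftrightarrow> fst p = fst q \<and> simple_graph (fst p) \<and> {snd p, snd q} \<in> edges (fst p)"

interpretation u: sgraph union_adj
proof
  show "union_adj x y \<Longrightarrow> union_adj y x" for x y :: "'a ugraph \<times> 'a"
    by (auto simp: union_adj_def insert_commute)
  show "\<not> union_adj x x" for x :: "'a ugraph \<times> 'a"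
    using sgraph.adj_irr[OF simple_graph_sgraph, of "fst x" "snd x"] by (auto simp: union_adj_def)
qed

text \<open>Roots become branch vertices, and each edge gets a point of its own: it is routed from
  one root along a leg to the point and back along another leg to the second root.\<close>

lemma spider_subdivision:
  fixes F :: "'f ugraph" and G :: "'a ugraph"
  assumes F: "simple_graph F" and G: "simple_graph G" and X: "X \<subseteq> {G} \<times> verts G" and r: "0 < r"
    and mc: "u.multicover X r I x L C"
    and sp: "u.spider X r (card (verts F)) I L C (card (edges F))"
    and s: "2 * r + 1 \<le> s"
  shows "\<exists>S :: 'a ugraph. le_subdivision s F S \<and> contains_induced S G"
proof -
  obtain J p us where J: "J \<subseteq> I" "card J = card (verts F)"
     and leg: "\<forall>k<card (edges F). us k \<in> C \<and> (\<forall>i\<in>J. u.leg X r (L i) (us k) (p k i))"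
     and sep: "\<forall>k<card (edges F). \<forall>l<card (edges F). k \<noteq> l \<longrightarrow>
       (\<forall>i\<in>J. \<forall>j\<in>J. \<forall>a\<in>set (p k i). \<forall>b\<in>set (p l j). a \<noteq> b \<and> \<not> union_adj a b)"
    using sp unfolding u.spider_def by (elim exE conjE) (rule that)
  have finF: "finite (verts F)" "finite (edges F)"
  proof -
    show "finite (verts F)" using F by (simp add: simple_graph_def)
    moreover have "edges F \<subseteq> Pow (verts F)" using F by (auto simp: simple_graph_def)
    ultimately show "finite (edges F)" by (meson finite_Pow_iff finite_subset)
  qed
  have "finite I" using mc by (simp add: u.multicover_def)
  then have "finite J" using J(1) finite_subset by blast
  then obtain \<iota> where \<iota>: "bij_betw \<iota> (verts F) J" using finF J(2) finite_same_card_bij by metis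
  obtain \<kappa> where \<kappa>: "bij_betw \<kappa> (edges F) {..<card (edges F)}"
    using ex_bij_betw_finite_nat[OF finF(2)] atLeast0LessThan by metis
  have eF: "e \<subseteq> verts F" "card e = 2" if "e \<in> edges F" for e
    using F that by (auto simp: simple_graph_def)
  have "\<exists>v w. e = {v, w} \<and> v \<noteq> w" if "e \<in> edges F" for e using eF[OF that] by (meson card_2_iff)
  then obtain va wa where vw: "\<And>e. e \<in> edges F \<Longrightarrow> e = {va e, wa e} \<and> va e \<noteq> wa e" by metis
  define y where "y v = x (\<iota> v)" for v
  have \<iota>J: "\<iota> v \<in> J" "\<iota> v \<in> I" if "v \<in> verts F" for v
    using \<iota> that J(1) by (auto simp: bij_betw_def)
  have \<iota>inj: "\<iota> v \<noteq> \<iota> w" if "v \<in> verts F" "w \<in> verts F" "v \<noteq> w" for v w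
    using \<iota> that by (auto simp: bij_betw_def inj_on_def)
  have yX: "y v \<in> X" if "v \<in> verts F" for v
    using mc \<iota>J[OF that] unfolding y_def u.multicover_def by blast
  have yy: "y v \<noteq> y w" "\<not> union_adj (y v) (y w)" "\<forall>t\<in>L (\<iota> w). \<not> union_adj (y v) t"
    if "v \<in> verts F" "w \<in> verts F" "v \<noteq> w" for v w
    using mc \<iota>J[OF that(1)] \<iota>J[OF that(2)] \<iota>inj[OF that] unfolding y_def u.multicover_def by blast+
  have yL: "\<forall>t\<in>L (\<iota> v). union_adj (y v) t" if "v \<in> verts F" for v
    using mc \<iota>J[OF that] unfolding y_def u.multicover_def by blast
  have \<kappa>m: "\<kappa> e < card (edges F)" if "e \<in> edges F" for e using \<kappa> that by (auto simp: bij_betw_def)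
  have lg: "u.leg X r (L (\<iota> v)) (us (\<kappa> e)) (p (\<kappa> e) (\<iota> v))" "us (\<kappa> e) \<in> C"
    if "e \<in> edges F" "v \<in> verts F" for e v using leg \<kappa>m[OF that(1)] \<iota>J[OF that(2)] by auto
  \<comment> \<open>The point is farther than \<open>r\<close> from every root, so no root lies on a
    leg or sees a leg beyond its first vertex; first vertices lie in a cover, which is seen by its
    own root only.\<close>
  have off: "a \<noteq> y f" "f \<noteq> v \<Longrightarrow> \<not> union_adj a (y f)"
    if h: "e \<in> edges F" "v \<in> verts F" "f \<in> verts F" "a \<in> set (p (\<kappa> e) (\<iota> v))" for e v f a
  proof -
    note l = lg[OF h(1,2)]
    have far: "\<not> u.near X r (y f) (us (\<kappa> e))"
      using mc \<iota>J[OF h(3)] l(2) unfolding y_def u.multicover_def by blast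
    have "u.near X r a (us (\<kappa> e))" using l(1) h(4) unfolding u.leg_def by blast
    then show "a \<noteq> y f" using far by blast
    show "\<not> union_adj a (y f)" if "f \<noteq> v"
    proof
      assume ad: "union_adj a (y f)"
      have "a = hd (p (\<kappa> e) (\<iota> v)) \<or> a \<in> set (tl (p (\<kappa> e) (\<iota> v)))"
        using h(4) by (cases "p (\<kappa> e) (\<iota> v)") auto
      then show False
      proof
        assume "a = hd (p (\<kappa> e) (\<iota> v))"
        then have "a \<in> L (\<iota> v)" using l(1) unfolding u.leg_def by blast
        then show False using yy(3)[OF h(3,2) that] ad u.adj_sym by blast
      next
        assume "a \<in> set (tl (p (\<kappa> e) (\<iota> v)))"
        then have "u.near X (r - 1) a (us (\<kappa> e))" using l(1) unfolding u.leg_def by blast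
        from u.near_step[OF yX[OF h(3)] u.adj_sym[OF ad] this] show False using far r by simp
      qed
    qed
  qed
  \<comment> \<open>The two legs share the point, so \<open>butlast\<close> drops its second
    occurrence; this leaves at most \<open>1 + (r + 1) + r + 1\<close> vertices.\<close>
  define W where "W e = y (va e) # p (\<kappa> e) (\<iota> (va e)) @ rev (y (wa e) # butlast (p (\<kappa> e) (\<iota> (wa e))))" for e
  have Wp: "u.walk (W e)" "set (W e) \<subseteq> X" "hd (W e) = y (va e)" "last (W e) = y (wa e)"
    "length (W e) \<le> 2 * r + 3"
    "set (W e) \<subseteq> {y (va e), y (wa e)} \<union> set (p (\<kappa> e) (\<iota> (va e))) \<union> set (p (\<kappa> e) (\<iota> (wa e)))"
    if e: "e \<in> edges F" for e
  proof -
    let ?p = "p (\<kappa> e) (\<iota> (va e))" and ?q = "p (\<kappa> e) (\<iota> (wa e))"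
    have v: "va e \<in> verts F" "wa e \<in> verts F" using vw[OF e] eF[OF e] by auto
    note l1 = lg(1)[OF e v(1)] and l2 = lg(1)[OF e v(2)]
    have wp: "u.walk ?p" "u.walk ?q" "last ?p = us (\<kappa> e)" "last ?q = us (\<kappa> e)" "set ?p \<subseteq> X" "set ?q \<subseteq> X"
      "length ?p \<le> Suc r" "length ?q \<le> Suc r" "hd ?p \<in> L (\<iota> (va e))" "hd ?q \<in> L (\<iota> (wa e))"
      using l1 l2 unfolding u.leg_def by auto
    have ne: "?p \<noteq> []" "?q \<noteq> []" using wp by (auto simp: u.walk_def)
    have a1: "union_adj (y (va e)) (hd ?p)" and a2: "union_adj (y (wa e)) (hd ?q)"
      using yL v wp by auto
    have w1: "u.walk (y (va e) # ?p)" using u.walk_Cons[OF wp(1) a1] .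
    have w2: "u.walk (y (wa e) # ?q)" using u.walk_Cons[OF wp(2) a2] .
    have rv: "u.walk (rev (y (wa e) # ?q))" using u.walk_rev[OF w2] .
    have tle: "rev (y (wa e) # butlast ?q) = tl (rev (y (wa e) # ?q))"
      using ne(2) by (cases ?q rule: rev_cases) auto
    have tlw: "u.walk (rev (y (wa e) # butlast ?q))"
      unfolding tle by (rule u.walk_tl[OF rv]) (simp only: tle[symmetric] rev_is_Nil_conv list.distinct not_False_eq_True)
    have hdrv: "hd (rev (y (wa e) # ?q)) = us (\<kappa> e)" using ne wp(4) by (simp add: hd_rev)
    have "union_adj (last (y (va e) # ?p)) (hd (rev (y (wa e) # butlast ?q)))"
    proof -
      have snd_elem: "l ! Suc 0 = hd (tl l)" if "Suc 0 < length l" for l :: "('a ugraph \<times> 'a) list"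
        using that by (cases l) (auto simp: hd_conv_nth)
      have ln: "Suc 0 < length (rev (y (wa e) # ?q))" using ne by (cases ?q) auto
      then have "union_adj (rev (y (wa e) # ?q) ! 0) (rev (y (wa e) # ?q) ! Suc 0)"
        using rv unfolding u.walk_def by blast
      moreover have "rev (y (wa e) # ?q) ! Suc 0 = hd (tl (rev (y (wa e) # ?q)))"
        using snd_elem[OF ln] .
      moreover have "rev (y (wa e) # ?q) ! 0 = hd (rev (y (wa e) # ?q))"
        by (simp add: hd_conv_nth)
      ultimately show ?thesis using hdrv ne wp(3) tle by simp
    qed
    then show "u.walk (W e)" unfolding W_def using u.walk_append[OF w1 tlw] by simp
    have sq: "set (butlast ?q) \<subseteq> set ?q" by (meson in_set_butlastD subsetI)
    show "set (W e) \<subseteq> X" unfolding W_def using yX v wp(5,6) sq by auto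
    show "hd (W e) = y (va e)" "last (W e) = y (wa e)" unfolding W_def by auto
    show "length (W e) \<le> 2 * r + 3" unfolding W_def using wp(7,8) by simp
    show "set (W e) \<subseteq> {y (va e), y (wa e)} \<union> set ?p \<union> set ?q" unfolding W_def using sq by auto
  qed
  have fstX: "fst a = G" if "a \<in> X" for a using X that by auto
  have adjX: "union_adj a b \<longleftrightarrow> {snd a, snd b} \<in> edges G" if "a \<in> X" "b \<in> X" for a b
    using fstX[OF that(1)] fstX[OF that(2)] G by (simp add: union_adj_def)
  have sndX: "snd a = snd b \<longleftrightarrow> a = b" if "a \<in> X" "b \<in> X" for a b
    using fstX[OF that(1)] fstX[OF that(2)] by (auto simp: prod_eq_iff)
  define \<phi> where "\<phi> v = snd (y v)" for v
  have lift: "\<exists>b v. a = snd b \<and> b \<in> X \<and> b \<in> set (p (\<kappa> e) (\<iota> v)) \<and> v \<in> e"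
    if e: "e \<in> edges F" and a: "a \<in> set (map snd (W e)) - \<phi> ` e" for e a
  proof -
    obtain b where b: "b \<in> set (W e)" "a = snd b" using a by auto
    have "va e \<in> e" "wa e \<in> e" using vw[OF e] by auto
    then have "b \<noteq> y (va e)" "b \<noteq> y (wa e)" using a b unfolding \<phi>_def by auto
    then have "b \<in> set (p (\<kappa> e) (\<iota> (va e))) \<or> b \<in> set (p (\<kappa> e) (\<iota> (wa e)))"
      using Wp(6)[OF e] b(1) by blast
    then show ?thesis using b Wp(2)[OF e] \<open>va e \<in> e\<close> \<open>wa e \<in> e\<close> by blast
  qed
  show ?thesis
  proof (rule subdivision_of_walks[OF F G, of \<phi> "\<lambda>e. map snd (W e)"])
    show "inj_on \<phi> (verts F)"
      unfolding inj_on_def \<phi>_def using sndX yX yy(1) by metis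
    show "\<phi> ` verts F \<subseteq> verts G" unfolding \<phi>_def using yX X by fastforce
    show "{\<phi> v, \<phi> w} \<notin> edges G" if "v \<in> verts F" "w \<in> verts F" for v w
    proof (cases "v = w")
      case True
      then show ?thesis using sgraph.adj_irr[OF simple_graph_sgraph[OF G]] by blast
    next
      case False
      then show ?thesis using yy(2)[OF that] adjX yX that unfolding \<phi>_def by blast
    qed
    show "{hd (map snd (W e)), last (map snd (W e))} = \<phi> ` e" if "e \<in> edges F" for e
    proof -
      have "W e \<noteq> []" using Wp(1)[OF that] by (simp add: u.walk_def)
      then have "{hd (map snd (W e)), last (map snd (W e))} = {\<phi> (va e), \<phi> (wa e)}"
        using Wp(3,4)[OF that] by (simp add: hd_map last_map \<phi>_def)
      also have "\<dots> = \<phi> ` {va e, wa e}" by simp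
      finally show ?thesis using vw[OF that] by simp
    qed
    show "set (map snd (W e)) \<subseteq> verts G" if "e \<in> edges F" for e
      using Wp(2)[OF that] X by fastforce
    show "length (map snd (W e)) \<le> s + 2" if "e \<in> edges F" for e
      using Wp(5)[OF that] s by simp
    show "sgraph.walk (\<lambda>a b. {a, b} \<in> edges G) (map snd (W e))" if "e \<in> edges F" for e
    proof -
      have *: "{snd (W e ! i), snd (W e ! Suc i)} \<in> edges G" if i: "Suc i < length (W e)" for i
      proof -
        have "W e ! i \<in> X" "W e ! Suc i \<in> X" using Wp(2)[OF \<open>e \<in> edges F\<close>] i by auto
        moreover have "union_adj (W e ! i) (W e ! Suc i)"
          using Wp(1)[OF \<open>e \<in> edges F\<close>] i unfolding u.walk_def by blast
        ultimately show ?thesis using adjX by blast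
      qed
      have "W e \<noteq> []" using Wp(1)[OF that] by (simp add: u.walk_def)
      then show ?thesis unfolding sgraph.walk_def[OF simple_graph_sgraph[OF G]] using * by simp
    qed
    fix e a f assume h: "e \<in> edges F" "a \<in> set (map snd (W e)) - \<phi> ` e" "f \<in> verts F"
    obtain b v where b: "a = snd b" "b \<in> X" "b \<in> set (p (\<kappa> e) (\<iota> v))" "v \<in> e"
      using lift[OF h(1,2)] by blast
    have v: "v \<in> verts F" using b(4) eF[OF h(1)] by blast
    show "a \<noteq> \<phi> f \<and> (f \<notin> e \<longrightarrow> {a, \<phi> f} \<notin> edges G)"
      using off[OF h(1) v h(3) b(3)] b sndX[OF b(2) yX[OF h(3)]] adjX[OF b(2) yX[OF h(3)]]
      unfolding \<phi>_def by auto
  next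
    fix e e' a b
    assume h: "e \<in> edges F" "e' \<in> edges F" "e \<noteq> e'" "a \<in> set (map snd (W e)) - \<phi> ` e"
      "b \<in> set (map snd (W e')) - \<phi> ` e'"
    obtain a' v where a: "a = snd a'" "a' \<in> X" "a' \<in> set (p (\<kappa> e) (\<iota> v))" "v \<in> e"
      using lift[OF h(1,4)] by blast
    obtain b' w where b: "b = snd b'" "b' \<in> X" "b' \<in> set (p (\<kappa> e') (\<iota> w))" "w \<in> e'"
      using lift[OF h(2,5)] by blast
    have "\<iota> v \<in> J" "\<iota> w \<in> J" using a(4) b(4) eF h(1,2) \<iota>J by blast+
    moreover have "\<kappa> e \<noteq> \<kappa> e'" using \<kappa> h(1-3) by (auto simp: bij_betw_def inj_on_def)
    ultimately have "a' \<noteq> b' \<and> \<not> union_adj a' b'" using sep \<kappa>m h(1,2) a(3) b(3) by blast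
    then show "a \<noteq> b \<and> {a, b} \<notin> edges G" using a b sndX adjX by blast
  qed
qed

section \<open>Rich families\<close>

text \<open>Ramsey-type selection for pairs whose colour is taken from a palette of the larger
  element. The maximum \<open>c\<close> is kept with the most popular of its at most
  \<open>k\<close> colours, and the selection continues among the smaller elements of that colour;
  each round costs a factor \<open>k + 1\<close>.\<close>

lemma tail_homogeneous:
  fixes B :: "nat set" and K :: "nat \<Rightarrow> 'c set"
  assumes "(k + 1) ^ n \<le> card B" "finite B"
    and "\<And>c. c \<in> B \<Longrightarrow> finite (K c) \<and> K c \<noteq> {} \<and> card (K c) \<le> k"
    and "\<And>b c. b \<in> B \<Longrightarrow> c \<in> B \<Longrightarrow> b < c \<Longrightarrow> col b c \<in> K c"
  shows "\<exists>J\<subseteq>B. card J = n \<and> (\<exists>x. \<forall>c\<in>J. x c \<in> K c \<and> (\<forall>b\<in>J. b < c \<longrightarrow> col b c = x c))"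
  using assms
proof (induction n arbitrary: B)
  case 0
  then show ?case by (intro exI[of _ "{}"]) auto
next
  case (Suc n)
  have "B \<noteq> {}" using Suc.prems(1) by auto
  define c where "c = Max B"
  have c: "c \<in> B" "\<And>b. b \<in> B \<Longrightarrow> b \<le> c" using Suc.prems(2) \<open>B \<noteq> {}\<close> by (auto simp: c_def)
  define S where "S y = {b \<in> B - {c}. col b c = y}" for y
  have Kc: "finite (K c)" "K c \<noteq> {}" "card (K c) \<le> k" using Suc.prems(3)[OF c(1)] by auto
  have cB: "k * (k + 1) ^ n \<le> card (B - {c})"
  proof -
    have "k * (k + 1) ^ n + (k + 1) ^ n \<le> card B" using Suc.prems(1) by simp
    moreover have "1 \<le> (k + 1) ^ n" by simp
    moreover have "card (B - {c}) = card B - 1" using c(1) Suc.prems(2) by simp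
    ultimately show ?thesis by linarith
  qed
  have k0: "0 < k" using Kc card_gt_0_iff[of "K c"] by linarith
  have "\<exists>y\<in>K c. (k + 1) ^ n \<le> card (S y)"
  proof (rule ccontr)
    assume neg: "\<not> ?thesis"
    have "B - {c} = (\<Union>y\<in>K c. S y)"
      unfolding S_def using Suc.prems(4) c by (force simp: le_less)
    then have "card (B - {c}) \<le> (\<Sum>y\<in>K c. card (S y))" using card_UN_le[OF Kc(1), of S] by simp
    also have "\<dots> \<le> (\<Sum>y\<in>K c. (k + 1) ^ n - 1)" using neg by (intro sum_mono) (auto simp: not_le)
    also have "\<dots> \<le> k * ((k + 1) ^ n - 1)" using Kc(3) by simp
    also have "\<dots> < k * (k + 1) ^ n" using k0 by (intro mult_strict_left_mono) auto
    finally show False using cB by simp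
  qed
  then obtain y where y: "y \<in> K c" "(k + 1) ^ n \<le> card (S y)" by blast
  have SB: "S y \<subseteq> B" "c \<notin> S y" "finite (S y)" using Suc.prems(2) by (auto simp: S_def)
  have "\<exists>J\<subseteq>S y. card J = n \<and> (\<exists>x. \<forall>c\<in>J. x c \<in> K c \<and> (\<forall>b\<in>J. b < c \<longrightarrow> col b c = x c))"
    by (rule Suc.IH[OF y(2) SB(3)]) (use Suc.prems(3,4) SB(1) in auto)
  then obtain J x where J: "J \<subseteq> S y" "card J = n"
    "\<forall>c\<in>J. x c \<in> K c \<and> (\<forall>b\<in>J. b < c \<longrightarrow> col b c = x c)" by blast
  have lt: "b < c" if "b \<in> J" for b using that J(1) SB c(2) by (metis le_neq_implies_less subsetD)
  have "finite J" using J(1) SB(3) finite_subset by blast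
  have cJ: "c \<notin> J" using J(1) SB(2) by blast
  have "card (insert c J) = Suc n" using J(2) cJ \<open>finite J\<close> by simp
  moreover have "\<forall>a\<in>insert c J. (x(c := y)) a \<in> K a \<and>
      (\<forall>b\<in>insert c J. b < a \<longrightarrow> col b a = (x(c := y)) a)"
  proof
    fix a assume a: "a \<in> insert c J"
    show "(x(c := y)) a \<in> K a \<and> (\<forall>b\<in>insert c J. b < a \<longrightarrow> col b a = (x(c := y)) a)"
    proof (cases "a = c")
      case True
      then show ?thesis using y(1) J(1) unfolding S_def by auto
    next
      case False
      then have "a \<in> J" using a by simp
      then show ?thesis using J(3) lt[of a] False by auto
    qed
  qed
  moreover have "insert c J \<subseteq> B" using J(1) SB(1) c(1) by auto
  ultimately show ?case by blast
qed

text \<open>The situation after the reductions: neighbourhoods are bounded, cliques of the extremal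
  size \<open>h\<close> dominate large sets everywhere, those of size \<open>Suc h\<close> dominate
  only bounded ones, and long multicovers of radius one cover only bounded sets. The constants serve
  all members of \<open>U\<close> simultaneously.\<close>

locale arena = sgraph adj for adj :: "'v \<Rightarrow> 'v \<Rightarrow> bool" +
  fixes U :: "'v set set" and h d D0 n1 D1 :: nat
  assumes U_fin: "X \<in> U \<Longrightarrow> finite X"
    and U_hered: "X \<in> U \<Longrightarrow> Y \<subseteq> X \<Longrightarrow> Y \<in> U"
    and U_unbounded: "\<exists>X\<in>U. n \<le> chi X"
    and U_local: "X \<in> U \<Longrightarrow> v \<in> X \<Longrightarrow> chi {u \<in> X. adj v u} \<le> d"
    and h_pos: "0 < h"
    and U_dense: "\<exists>c. \<forall>X\<in>U. c \<le> chi X \<longrightarrow> (\<exists>K\<subseteq>X. clq K \<and> card K = h \<and> D \<le> chi (dominated X (cn K)))"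
    and U_sparse: "X \<in> U \<Longrightarrow> K \<subseteq> X \<Longrightarrow> clq K \<Longrightarrow> card K = Suc h \<Longrightarrow> chi (dominated X (cn K)) \<le> D0"
    and U_multicover: "X \<in> U \<Longrightarrow> multicover X 1 I x L C \<Longrightarrow> n1 \<le> card I \<Longrightarrow> chi C < D1"
begin

text \<open>The last clause is the refocusing: every vertex of an old cover that sees
  \<open>w\<close> is a common neighbour of \<open>K\<close>.\<close>

definition nest :: "'v set list \<Rightarrow> 'v set \<Rightarrow> 'v set \<Rightarrow> 'v set" where
  "nest Ts K C = {w \<in> C. w \<notin> K \<and> (\<forall>y\<in>K. \<not> adj y w) \<and> (\<exists>t\<in>C \<inter> cn K. adj t w) \<and>
     (\<forall>T\<in>set Ts. \<forall>t\<in>T. adj t w \<longrightarrow> t \<in> cn K)}"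

definition nestable :: "nat \<Rightarrow> 'v set list \<Rightarrow> 'v set \<Rightarrow> bool" where
  "nestable D Ts C \<longleftrightarrow> (\<exists>K\<subseteq>C. clq K \<and> card K = h \<and> D \<le> chi (nest Ts K C))"

definition state :: "nat \<Rightarrow> 'v set list \<Rightarrow> 'v set \<Rightarrow> bool" where
  "state m Ts C \<longleftrightarrow> length Ts = m \<and> (\<exists>X\<in>U. C \<subseteq> X \<and>
     (\<forall>T\<in>set Ts. T \<subseteq> X \<and> stable T \<and> (\<forall>w\<in>C. \<exists>t\<in>T. adj t w)))"

definition family :: "nat \<Rightarrow> ('v set list \<times> 'v set) set \<Rightarrow> bool" where
  "family m S \<longleftrightarrow> (\<forall>Ts C. (Ts, C) \<in> S \<longrightarrow> state m Ts C) \<and>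
     (\<forall>Ts C C'. (Ts, C) \<in> S \<longrightarrow> C' \<subseteq> C \<longrightarrow> (Ts, C') \<in> S) \<and>
     (\<forall>n. \<exists>Ts C. (Ts, C) \<in> S \<and> n \<le> chi C)"

text \<open>The threshold \<open>c\<close> depends on \<open>D\<close> alone, not on the state.
  Hence richness passes to every subset of a family, which makes it possible to argue inside the
  subfamily of counterexamples.\<close>

definition rich :: "('v set list \<times> 'v set) set \<Rightarrow> bool" where
  "rich S \<longleftrightarrow> (\<forall>D. \<exists>c. \<forall>Ts C. (Ts, C) \<in> S \<longrightarrow> c \<le> chi C \<longrightarrow> nestable D Ts C)"

definition extends :: "'v set list \<Rightarrow> 'v set \<Rightarrow> 'v set \<Rightarrow> 'v set \<Rightarrow> 'v set \<Rightarrow> bool" where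
  "extends Ts C K T C' \<longleftrightarrow> K \<subseteq> C \<and> clq K \<and> card K = h \<and> T \<subseteq> C \<inter> cn K \<and> stable T \<and>
     C' \<subseteq> nest Ts K C \<and> (\<forall>w\<in>C'. \<exists>t\<in>T. adj t w)"

lemma nest_subset: "nest Ts K C \<subseteq> C"
  by (auto simp: nest_def)

lemma nest_mono: "C' \<subseteq> C \<Longrightarrow> nest Ts K C' \<subseteq> nest Ts K C"
  unfolding nest_def by blast

lemma state_fin: "state m Ts C \<Longrightarrow> C \<in> U \<and> finite C"
  unfolding state_def using U_hered U_fin by blast

lemma nestable_mono:
  assumes "nestable D Ts C'" "C' \<subseteq> C" "finite C"
  shows "nestable D Ts C"
proof -
  obtain K where K: "K \<subseteq> C'" "clq K" "card K = h" "D \<le> chi (nest Ts K C')"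
    using assms(1) unfolding nestable_def by blast
  have "chi (nest Ts K C') \<le> chi (nest Ts K C)"
    using nest_mono[OF assms(2)] nest_subset assms(3) by (meson chi_mono finite_subset)
  then have "D \<le> chi (nest Ts K C)" using K(4) by linarith
  moreover have "K \<subseteq> C" using K(1) assms(2) by blast
  ultimately show ?thesis unfolding nestable_def using K(2,3) by blast
qed

lemma nestable_antimono: "nestable D Ts C \<Longrightarrow> D' \<le> D \<Longrightarrow> nestable D' Ts C"
  unfolding nestable_def using le_trans by blast

lemma family_D:
  assumes "family m S"
  shows "(Ts, C) \<in> S \<Longrightarrow> state m Ts C" "(Ts, C) \<in> S \<Longrightarrow> C' \<subseteq> C \<Longrightarrow> (Ts, C') \<in> S"
    "\<exists>Ts C. (Ts, C) \<in> S \<and> n \<le> chi C"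
  using assms unfolding family_def by blast+

lemma rich_subset: "rich S \<Longrightarrow> S' \<subseteq> S \<Longrightarrow> rich S'"
  unfolding rich_def by (meson subsetD)

lemma extends_state:
  assumes "state m Ts C" "extends Ts C K T C'"
  shows "state (Suc m) (Ts @ [T]) C'"
proof -
  obtain X where X: "X \<in> U" "C \<subseteq> X" "\<forall>T\<in>set Ts. T \<subseteq> X \<and> stable T \<and> (\<forall>w\<in>C. \<exists>t\<in>T. adj t w)"
    and m: "length Ts = m" using assms(1) unfolding state_def by blast
  have C': "C' \<subseteq> C" using assms(2) nest_subset unfolding extends_def by blast
  have T: "T \<subseteq> X" "stable T" "\<forall>w\<in>C'. \<exists>t\<in>T. adj t w"
    using assms(2) X(2) unfolding extends_def by auto
  have "\<forall>T'\<in>set (Ts @ [T]). T' \<subseteq> X \<and> stable T' \<and> (\<forall>w\<in>C'. \<exists>t\<in>T'. adj t w)"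
    using X(3) T C' by auto
  then show ?thesis unfolding state_def using m X(1,2) C' by (intro conjI bexI[of _ X]) auto
qed

lemma extends_shrink:
  assumes "extends Ts C K T C'" "C'' \<subseteq> C'" "T' \<subseteq> T" "\<forall>w\<in>C''. \<exists>t\<in>T'. adj t w"
  shows "extends Ts C K T' C''"
  using assms unfolding extends_def stable_def by blast

lemma base_family: "family 0 ({[]} \<times> U)"
proof -
  have "\<exists>C. C \<in> U \<and> n \<le> chi C" for n using U_unbounded[of n] by auto
  then show ?thesis unfolding family_def state_def using U_hered by auto
qed

text \<open>Each vertex of \<open>Z\<close> together with its neighbours in \<open>C\<close> has
  chromatic number at most \<open>d + 1\<close>.\<close>

lemma chi_shave:
  assumes C: "C \<in> U" "W \<subseteq> C" "Z \<subseteq> C"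
  shows "chi W \<le> chi {w \<in> W. \<forall>z\<in>Z. z \<noteq> w \<and> \<not> adj z w} + card Z * (d + 1)"
proof -
  have fC: "finite C" using C(1) by (rule U_fin)
  have fZ: "finite Z" using C(3) fC by (rule finite_subset)
  have fW: "finite W" using C(2) fC by (rule finite_subset)
  define N where "N z = {u \<in> C. adj z u} \<union> {z}" for z
  have "chi (N z) \<le> d + 1" if "z \<in> Z" for z
  proof -
    have "chi {z} \<le> 1" by (rule chi_le[where c = "\<lambda>_. 0"]) (simp add: proper_def adj_irr)
    moreover have "chi {u \<in> C. adj z u} \<le> d" by (rule U_local[OF C(1)]) (use that C(3) in auto)
    ultimately show ?thesis using chi_Un[of "{u \<in> C. adj z u}" "{z}"] fC by (simp add: N_def)
  qed
  moreover have fN: "finite (N z)" for z using fC by (simp add: N_def)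
  ultimately have "chi (\<Union>z\<in>Z. N z) \<le> card Z * (d + 1)" using fZ by (intro chi_UN_le)
  moreover have "chi W \<le> chi (W - (\<Union>z\<in>Z. N z)) + chi (\<Union>z\<in>Z. N z)"
    using fW fZ fN by (intro chi_diff) auto
  moreover have "chi (W - (\<Union>z\<in>Z. N z)) \<le> chi {w \<in> W. \<forall>z\<in>Z. z \<noteq> w \<and> \<not> adj z w}"
    using fW C(2) by (intro chi_mono) (auto simp: N_def)
  ultimately show ?thesis by linarith
qed

text \<open>With no covers yet, \<open>nest\<close> only lacks those dominated vertices that lie in
  \<open>K\<close> or see it, and shaving off \<open>h\<close> vertices costs
  \<open>h * (d + 1)\<close>.\<close>

lemma base_rich: "rich ({[]} \<times> U)"
  unfolding rich_def
proof
  fix D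
  obtain c where c: "\<forall>X\<in>U. c \<le> chi X \<longrightarrow>
     (\<exists>K\<subseteq>X. clq K \<and> card K = h \<and> D + h * (d + 1) \<le> chi (dominated X (cn K)))"
    using U_dense by blast
  have "nestable D [] X" if X: "X \<in> U" "c \<le> chi X" for X
  proof -
    obtain K where K: "K \<subseteq> X" "clq K" "card K = h" "D + h * (d + 1) \<le> chi (dominated X (cn K))"
      using c X by blast
    have fX: "finite X" using U_fin X by blast
    have "dominated X (cn K) \<subseteq> X" unfolding dominated_def by blast
    then have "D \<le> chi {w \<in> dominated X (cn K). \<forall>y\<in>K. y \<noteq> w \<and> \<not> adj y w}"
      using chi_shave[OF X(1) _ K(1), of "dominated X (cn K)"] K(3,4) by auto
    moreover have "{w \<in> dominated X (cn K). \<forall>y\<in>K. y \<noteq> w \<and> \<not> adj y w} \<subseteq> nest [] K X"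
      unfolding nest_def dominated_def by auto
    moreover have "finite (nest [] K X)" by (rule finite_subset[OF nest_subset fX])
    ultimately have "D \<le> chi (nest [] K X)" using chi_mono by (meson le_trans)
    then show ?thesis unfolding nestable_def using K by blast
  qed
  then show "\<exists>c. \<forall>Ts C. (Ts, C) \<in> {[]} \<times> U \<longrightarrow> c \<le> chi C \<longrightarrow> nestable D Ts C" by auto
qed

text \<open>A record consists of many one-step extensions of the same state, found one after another,
  such that every earlier cover misses some root of every later one.\<close>

definition record_of ::
  "('v set list \<times> 'v set) set \<Rightarrow> nat \<Rightarrow> 'v set list \<Rightarrow> (nat \<Rightarrow> 'v set) \<Rightarrow> (nat \<Rightarrow> 'v set) \<Rightarrow> 'v set \<Rightarrow> bool" where
  "record_of S a Ts Ks Rs C \<longleftrightarrow> (Ts, C) \<in> S \<and>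
     (\<exists>X\<in>U. C \<subseteq> X \<and> (\<forall>b<a. Ks b \<subseteq> X \<and> Rs b \<subseteq> X)) \<and>
     (\<forall>b<a. \<exists>C0. (Ts, C0) \<in> S \<and> extends Ts C0 (Ks b) (Rs b) C) \<and>
     (\<forall>c<a. \<forall>b<c. (\<forall>y\<in>Ks b. \<forall>z\<in>Ks c \<union> Rs c. z \<noteq> y \<and> \<not> adj y z) \<and> (\<exists>y\<in>Ks c. \<forall>t\<in>Rs b. \<not> adj y t))"

lemma record_of_D:
  assumes "record_of S a Ts Ks Rs C"
  shows "(Ts, C) \<in> S" "\<exists>X\<in>U. C \<subseteq> X \<and> (\<forall>b<a. Ks b \<subseteq> X \<and> Rs b \<subseteq> X)"
    "b < a \<Longrightarrow> \<exists>C0. (Ts, C0) \<in> S \<and> extends Ts C0 (Ks b) (Rs b) C"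
    "c < a \<Longrightarrow> b < c \<Longrightarrow> \<forall>y\<in>Ks b. \<forall>z\<in>Ks c \<union> Rs c. z \<noteq> y \<and> \<not> adj y z"
    "c < a \<Longrightarrow> b < c \<Longrightarrow> \<exists>y\<in>Ks c. \<forall>t\<in>Rs b. \<not> adj y t"
  using assms unfolding record_of_def by (simp_all (no_asm_simp))

lemma record_shrink:
  assumes fam: "family m S" and rec: "record_of S a Ts Ks Rs C" and sub: "C' \<subseteq> C"
  shows "record_of S a Ts Ks Rs C'"
  unfolding record_of_def
proof (intro conjI allI impI)
  show "(Ts, C') \<in> S" by (rule family_D(2)[OF fam record_of_D(1)[OF rec] sub])
  obtain X where "X \<in> U" "C \<subseteq> X" "\<forall>b<a. Ks b \<subseteq> X \<and> Rs b \<subseteq> X"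
    using record_of_D(2)[OF rec] by (elim bexE conjE) (rule that)
  with sub show "\<exists>X\<in>U. C' \<subseteq> X \<and> (\<forall>b<a. Ks b \<subseteq> X \<and> Rs b \<subseteq> X)"
    by (intro bexI[of _ X]) auto
next
  fix b assume "b < a"
  then obtain C0 where C0: "(Ts, C0) \<in> S" "extends Ts C0 (Ks b) (Rs b) C"
    using record_of_D(3)[OF rec] by blast
  have "extends Ts C0 (Ks b) (Rs b) C'" using C0(2) sub unfolding extends_def by blast
  then show "\<exists>C0. (Ts, C0) \<in> S \<and> extends Ts C0 (Ks b) (Rs b) C'" using C0(1) by blast
next
  fix c b assume "c < a" "b < c"
  then show "\<forall>y\<in>Ks b. \<forall>z\<in>Ks c \<union> Rs c. z \<noteq> y \<and> \<not> adj y z" "\<exists>y\<in>Ks c. \<forall>t\<in>Rs b. \<not> adj y t"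
    using record_of_D(4,5)[OF rec] by auto
qed

text \<open>Each clique has, for every earlier cover, a vertex missed by it; on \<open>n1\<close>
  indices selected by \<open>tail_homogeneous\<close>, one vertex \<open>x c\<close> of
  \<open>Ks c\<close> is missed by all earlier covers. These vertices as roots, with the covers
  \<open>Rs\<close>, form a multicover of radius one: a root is separated from later indices by the
  record condition on its whole clique, and from earlier covers by this choice.\<close>

lemma record_bounded:
  assumes fam: "family m S" and rec: "record_of S ((h + 1) ^ n1) Ts Ks Rs C"
  shows "chi C < D1"
proof -
  let ?a = "(h + 1) ^ n1"
  obtain X where X: "X \<in> U" "C \<subseteq> X" "\<forall>b<?a. Ks b \<subseteq> X \<and> Rs b \<subseteq> X"
    using record_of_D(2)[OF rec] by (elim bexE conjE) (rule that)
  have ext: "\<exists>C0. extends Ts C0 (Ks b) (Rs b) C" if "b < ?a" for b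
    using record_of_D(3)[OF rec that] by blast
  have pair: "(\<forall>y\<in>Ks b. \<forall>z\<in>Ks c \<union> Rs c. z \<noteq> y \<and> \<not> adj y z)" "(\<exists>y\<in>Ks c. \<forall>t\<in>Rs b. \<not> adj y t)"
    if "b < c" "c < ?a" for b c
    using record_of_D(4,5)[OF rec that(2,1)] .
  define col where "col b c = (SOME y. y \<in> Ks c \<and> (\<forall>t\<in>Rs b. \<not> adj y t))" for b c
  have col: "col b c \<in> Ks c" "\<forall>t\<in>Rs b. \<not> adj (col b c) t" if "b < c" "c < ?a" for b c
    using pair(2)[OF that] someI_ex[of "\<lambda>y. y \<in> Ks c \<and> (\<forall>t\<in>Rs b. \<not> adj y t)"]
    unfolding col_def by blast+
  have K: "finite (Ks c) \<and> Ks c \<noteq> {} \<and> card (Ks c) \<le> h" if "c < ?a" for c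
  proof -
    have "card (Ks c) = h" using ext[OF that] unfolding extends_def by blast
    then show ?thesis using h_pos card_gt_0_iff[of "Ks c"] by auto
  qed
  obtain J x where J: "J \<subseteq> {..<?a}" "card J = n1"
     "\<forall>c\<in>J. x c \<in> Ks c \<and> (\<forall>b\<in>J. b < c \<longrightarrow> col b c = x c)"
    using tail_homogeneous[of h n1 "{..<?a}" Ks col] K col(1) by auto
  have lt: "b < ?a" if "b \<in> J" for b using J(1) that by blast
  have "multicover X 1 J x Rs C" unfolding multicover_def
  proof (intro conjI ballI impI)
    show "finite J" using J(1) finite_subset by blast
    show "C \<subseteq> X" by fact
    fix i assume i: "i \<in> J"
    obtain C0 where e: "extends Ts C0 (Ks i) (Rs i) C" using ext[OF lt[OF i]] by blast
    have xi: "x i \<in> Ks i" using J(3) i by blast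
    show "x i \<in> X" "Rs i \<subseteq> X" using X(3) lt[OF i] xi by auto
    show "stable (Rs i)" using e unfolding extends_def by blast
    show "C \<subseteq> reach X 1 (Rs i)"
    proof
      fix w assume w: "w \<in> C"
      then obtain t where t: "t \<in> Rs i" "adj t w" using e unfolding extends_def by blast
      have "w \<in> X" "t \<in> X" using w t(1) X(2,3) lt[OF i] by auto
      then have "near X 1 t w" using t(2) by auto
      then show "w \<in> reach X 1 (Rs i)" using t(1) \<open>w \<in> X\<close> unfolding reach_def by blast
    qed
    show "adj (x i) t" if "t \<in> Rs i" for t
      using e that xi unfolding extends_def cn_def by blast
    show "\<not> near X 1 (x i) u" if "u \<in> C" for u
    proof -
      have "u \<in> nest Ts (Ks i) C0" using e that unfolding extends_def by blast
      then have "u \<noteq> x i" "\<not> adj (x i) u" using xi unfolding nest_def by auto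
      then show ?thesis by auto
    qed
    fix j assume j: "j \<in> J" "i \<noteq> j"
    have xj: "x j \<in> Ks j" using bspec[OF J(3) j(1)] by simp
    have "x i \<noteq> x j \<and> \<not> adj (x i) (x j) \<and> (\<forall>t\<in>Rs j. \<not> adj (x i) t)"
    proof (cases "i < j")
      case True
      have p: "\<forall>z\<in>Ks j \<union> Rs j. z \<noteq> x i \<and> \<not> adj (x i) z"
        using bspec[OF pair(1)[OF True lt[OF j(1)]] xi] .
      have "x j \<noteq> x i \<and> \<not> adj (x i) (x j)" using bspec[OF p, of "x j"] xj by simp
      moreover have "\<forall>t\<in>Rs j. \<not> adj (x i) t" using p by simp
      ultimately show ?thesis by metis
    next
      case False
      then have ji: "j < i" using j(2) by simp
      have p: "\<forall>z\<in>Ks i \<union> Rs i. z \<noteq> x j \<and> \<not> adj (x j) z"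
        using bspec[OF pair(1)[OF ji lt[OF i]] xj] .
      have "x i \<noteq> x j \<and> \<not> adj (x j) (x i)" using bspec[OF p, of "x i"] xi by simp
      moreover have "col j i = x i" using bspec[OF J(3) i] j(1) ji by simp
      moreover have "\<forall>t\<in>Rs j. \<not> adj (col j i) t" by (rule col(2)[OF ji lt[OF i]])
      ultimately show ?thesis using adj_sym by (metis (no_types))
    qed
    then show "x i \<noteq> x j" "\<not> adj (x i) (x j)" "\<And>t. t \<in> Rs j \<Longrightarrow> \<not> adj (x i) t" by auto
  qed
  then show ?thesis using U_multicover X(1) J(2) by blast
qed

text \<open>Since no extension is rich, a record can be chosen none of whose covers, appended to
  \<open>Ts\<close>, admits a clique nesting a set of chromatic number \<open>D\<close>. But
  \<open>Ts\<close> alone is nestable by richness of \<open>S\<close>. So for the new clique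
  \<open>K\<close>, most nested vertices see in each old cover some vertex missed by a member of
  \<open>K\<close>; restricting the old covers to such vertices lengthens the record.\<close>

lemma record_step:
  assumes fam: "family m S" and rich: "rich S"
    and none: "\<And>S'. family (Suc m) S' \<Longrightarrow>
      (\<And>Us C'. (Us, C') \<in> S' \<Longrightarrow> \<exists>Ts C K T. Us = Ts @ [T] \<and> (Ts, C) \<in> S \<and> extends Ts C K T C') \<Longrightarrow> \<not> rich S'"
    and IH: "\<And>n. \<exists>Ts Ks Rs C. record_of S a Ts Ks Rs C \<and> n \<le> chi C"
  shows "\<exists>Ts Ks Rs C. record_of S (Suc a) Ts Ks Rs C \<and> n \<le> chi C"
proof -
  \<comment> \<open>One old cover is treated at a time: appending the cover with index
    \<open>k\<close> gives a family of one-step extensions of \<open>S\<close>. It is not rich, so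
    its poor members again have unbounded chromatic number, and they are closed under
    shrinking.\<close>
  have poor: "\<exists>Q D. (\<forall>Ts Ks Rs C. (Ts, Ks, Rs, C) \<in> Q \<longrightarrow> record_of S a Ts Ks Rs C \<and>
       (\<forall>b<k. \<not> nestable D (Ts @ [Rs b]) C)) \<and>
     (\<forall>Ts Ks Rs C C'. (Ts, Ks, Rs, C) \<in> Q \<longrightarrow> C' \<subseteq> C \<longrightarrow> (Ts, Ks, Rs, C') \<in> Q) \<and>
     (\<forall>n. \<exists>Ts Ks Rs C. (Ts, Ks, Rs, C) \<in> Q \<and> n \<le> chi C)" if "k \<le> a" for k
    using that
  proof (induction k)
    case 0
    show ?case
      by (rule exI[of _ "{(Ts, Ks, Rs, C). record_of S a Ts Ks Rs C}"])
        (use IH record_shrink[OF fam] in auto)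
  next
    case (Suc k)
    then have ka: "k < a" by simp
    obtain Q D where Q0: "\<forall>Ts Ks Rs C. (Ts, Ks, Rs, C) \<in> Q \<longrightarrow> record_of S a Ts Ks Rs C \<and>
        (\<forall>b<k. \<not> nestable D (Ts @ [Rs b]) C)"
      "\<forall>Ts Ks Rs C C'. (Ts, Ks, Rs, C) \<in> Q \<longrightarrow> C' \<subseteq> C \<longrightarrow> (Ts, Ks, Rs, C') \<in> Q"
      "\<forall>n. \<exists>Ts Ks Rs C. (Ts, Ks, Rs, C) \<in> Q \<and> n \<le> chi C"
      using Suc.IH[OF less_imp_le[OF ka]] by (elim exE conjE) (rule that)
    have Q: "record_of S a Ts Ks Rs C" "b < k \<Longrightarrow> \<not> nestable D (Ts @ [Rs b]) C"
      "C' \<subseteq> C \<Longrightarrow> (Ts, Ks, Rs, C') \<in> Q" if "(Ts, Ks, Rs, C) \<in> Q" for Ts Ks Rs C C' b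
      using Q0(1,2) that by auto
    have Q4: "\<exists>Ts Ks Rs C. (Ts, Ks, Rs, C) \<in> Q \<and> n \<le> chi C" for n using Q0(3) by simp
    define S' where "S' = {(Ts @ [Rs k], C) | Ts Ks Rs C. (Ts, Ks, Rs, C) \<in> Q}"
    have S'_mem: "(Us, C) \<in> S' \<longleftrightarrow> (\<exists>Ts Ks Rs. Us = Ts @ [Rs k] \<and> (Ts, Ks, Rs, C) \<in> Q)" for Us C
      unfolding S'_def by auto
    have ext: "\<exists>Ts C K T. Us = Ts @ [T] \<and> (Ts, C) \<in> S \<and> extends Ts C K T C'" if mem: "(Us, C') \<in> S'" for Us C'
    proof -
      obtain Ts Ks Rs where q: "Us = Ts @ [Rs k]" "(Ts, Ks, Rs, C') \<in> Q"
        using mem[unfolded S'_mem] by (elim exE conjE) (rule that)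
      then obtain C0 where "(Ts, C0) \<in> S" "extends Ts C0 (Ks k) (Rs k) C'"
        using record_of_D(3)[OF Q(1)[OF q(2)] ka] by (elim exE conjE) (rule that)
      then show ?thesis using q(1) by (intro exI conjI)
    qed
    have "family (Suc m) S'" unfolding family_def
    proof (intro conjI allI impI)
      fix Us C' assume "(Us, C') \<in> S'"
      from ext[OF this] show "state (Suc m) Us C'" using extends_state family_D(1)[OF fam] by blast
    next
      fix Us C C' assume "(Us, C) \<in> S'" and sub: "C' \<subseteq> C"
      then obtain Ts Ks Rs where "Us = Ts @ [Rs k]" "(Ts, Ks, Rs, C) \<in> Q"
        unfolding S'_mem by (elim exE conjE) (rule that)
      then show "(Us, C') \<in> S'" unfolding S'_mem using Q(3)[OF _ sub] by (intro exI conjI)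
    next
      fix n
      obtain Ts Ks Rs C where "(Ts, Ks, Rs, C) \<in> Q" "n \<le> chi C"
        using Q4[of n] by (elim exE conjE) (rule that)
      then show "\<exists>Us C. (Us, C) \<in> S' \<and> n \<le> chi C" unfolding S'_mem by (intro exI conjI) (rule refl)
    qed
    then have "\<not> rich S'" using none ext by blast
    then obtain E where E: "\<And>c. \<exists>Us C. (Us, C) \<in> S' \<and> c \<le> chi C \<and> \<not> nestable E Us C"
      unfolding rich_def by blast
    \<comment> \<open>The maximum keeps the earlier failures valid: failing to nest a set of some
      chromatic number implies failing for every larger one.\<close>
    define D' where "D' = max D E"
    define Q' where "Q' = {(Ts, Ks, Rs, C). (Ts, Ks, Rs, C) \<in> Q \<and> \<not> nestable D' (Ts @ [Rs k]) C}"
    have Q'Q: "(Ts, Ks, Rs, C) \<in> Q \<and> \<not> nestable D' (Ts @ [Rs k]) C" if "(Ts, Ks, Rs, C) \<in> Q'" for Ts Ks Rs C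
      using that unfolding Q'_def by blast
    have "\<not> nestable D' (Ts @ [Rs b]) C" if "(Ts, Ks, Rs, C) \<in> Q'" "b < Suc k" for Ts Ks Rs C b
    proof (cases "b = k")
      case True
      then show ?thesis using Q'Q[OF that(1)] by blast
    next
      case False
      then have "\<not> nestable D (Ts @ [Rs b]) C" using Q(2)[OF conjunct1[OF Q'Q[OF that(1)]]] that(2) by simp
      then show ?thesis using nestable_antimono D'_def by (metis max.cobounded1)
    qed
    moreover have "(Ts, Ks, Rs, C') \<in> Q'" if h: "(Ts, Ks, Rs, C) \<in> Q'" "C' \<subseteq> C" for Ts Ks Rs C C'
    proof -
      have q: "(Ts, Ks, Rs, C) \<in> Q" "\<not> nestable D' (Ts @ [Rs k]) C" using Q'Q[OF h(1)] by auto
      have "(Ts, C) \<in> S" using record_of_D(1)[OF Q(1)[OF q(1)]] .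
      then have "finite C" using family_D(1)[OF fam] state_fin by blast
      then have "\<not> nestable D' (Ts @ [Rs k]) C'" using q(2) h(2) nestable_mono by blast
      then show ?thesis using Q(3)[OF q(1) h(2)] unfolding Q'_def by simp
    qed
    moreover have "\<exists>Ts Ks Rs C. (Ts, Ks, Rs, C) \<in> Q' \<and> n \<le> chi C" for n
    proof -
      obtain Us C where "(Us, C) \<in> S'" "n \<le> chi C" "\<not> nestable E Us C" using E by blast
      then obtain Ts Ks Rs where q: "Us = Ts @ [Rs k]" "(Ts, Ks, Rs, C) \<in> Q"
        unfolding S'_mem by (elim exE conjE) (rule that)
      have "\<not> nestable D' (Ts @ [Rs k]) C"
        using \<open>\<not> nestable E Us C\<close> nestable_antimono q(1) D'_def by (metis max.cobounded2)
      then show ?thesis using q(2) \<open>n \<le> chi C\<close> unfolding Q'_def by blast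
    qed
    moreover have "record_of S a Ts Ks Rs C" if "(Ts, Ks, Rs, C) \<in> Q'" for Ts Ks Rs C
      using Q(1) Q'Q[OF that] by simp
    ultimately show ?case by (intro exI[of _ Q'] exI[of _ D']) simp
  qed
  obtain Q D where Q0: "\<forall>Ts Ks Rs C. (Ts, Ks, Rs, C) \<in> Q \<longrightarrow> record_of S a Ts Ks Rs C \<and>
        (\<forall>b<a. \<not> nestable D (Ts @ [Rs b]) C)"
      "\<forall>n. \<exists>Ts Ks Rs C. (Ts, Ks, Rs, C) \<in> Q \<and> n \<le> chi C"
    using poor[OF order_refl] by (elim exE conjE) (rule that)
  have Q: "record_of S a Ts Ks Rs C" "b < a \<Longrightarrow> \<not> nestable D (Ts @ [Rs b]) C"
    if "(Ts, Ks, Rs, C) \<in> Q" for Ts Ks Rs C b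
    using Q0(1) that by auto
  \<comment> \<open>Losses: \<open>D\<close> for each old cover, a factor \<open>h ^ a\<close> for
    choosing one vertex of \<open>K\<close> per old cover, and a factor \<open>d\<close> for a
    stable cover by common neighbours of \<open>K\<close>.\<close>
  define E where "E = a * D + h ^ a * (d * n) + 1"
  obtain c where c: "\<And>Ts C. (Ts, C) \<in> S \<Longrightarrow> c \<le> chi C \<Longrightarrow> nestable E Ts C"
    using rich unfolding rich_def by blast
  obtain Ts Ks Rs C where q: "(Ts, Ks, Rs, C) \<in> Q" "c \<le> chi C"
    using spec[OF Q0(2), of c] by (elim exE conjE) (rule that)
  have rec: "record_of S a Ts Ks Rs C" by (rule Q(1)[OF q(1)])
  have TsC: "(Ts, C) \<in> S" using record_of_D(1)[OF rec] .
  have CU: "C \<in> U" "finite C" using family_D(1)[OF fam TsC] state_fin by blast+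
  obtain K where K: "K \<subseteq> C" "clq K" "card K = h" "E \<le> chi (nest Ts K C)"
    using c[OF TsC q(2)] unfolding nestable_def by blast
  have fK: "finite K" using K(1) CU(2) finite_subset by blast
  have Kne: "K \<noteq> {}" using K(3) h_pos by auto
  \<comment> \<open>These vertices see only common neighbours of \<open>K\<close> in
    \<open>Rs b\<close>, so they remain nested when that cover is appended; by the choice of the
    record their chromatic number is at most \<open>D\<close>.\<close>
  define B where "B b = {w \<in> nest Ts K C. \<forall>t\<in>Rs b. adj t w \<longrightarrow> t \<in> cn K}" for b
  have fN: "finite (nest Ts K C)" by (rule finite_subset[OF nest_subset CU(2)])
  have "chi (B b) \<le> D" if b: "b < a" for b
  proof -
    have "B b \<subseteq> nest (Ts @ [Rs b]) K C" unfolding B_def nest_def by auto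
    moreover have "finite (nest (Ts @ [Rs b]) K C)" by (rule finite_subset[OF nest_subset CU(2)])
    ultimately have "chi (B b) \<le> chi (nest (Ts @ [Rs b]) K C)" by (rule chi_mono[rotated])
    moreover have "\<not> D \<le> chi (nest (Ts @ [Rs b]) K C)"
      using Q(2)[OF q(1) b] K(1-3) unfolding nestable_def by auto
    ultimately show ?thesis by linarith
  qed
  then have "chi (\<Union>b<a. B b) \<le> card {..<a} * D" using fN by (intro chi_UN_le) (auto simp: B_def)
  then have cB: "chi (\<Union>b<a. B b) \<le> a * D" by simp
  define C2 where "C2 = nest Ts K C - (\<Union>b<a. B b)"
  have "finite (\<Union>b<a. B b)" using fN by (auto simp: B_def)
  then have cC2: "h ^ a * (d * n) < chi C2"
    using chi_diff[OF fN, of "\<Union>b<a. B b"] K(4) cB unfolding C2_def E_def by linarith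
  have fC2: "finite C2" using fN by (simp add: C2_def)
  have "\<exists>y\<in>K. \<exists>t\<in>Rs b. adj t w \<and> \<not> adj y t" if "w \<in> C2" "b < a" for w b
  proof -
    have "w \<in> nest Ts K C" "w \<notin> B b" using that unfolding C2_def by auto
    then show ?thesis unfolding B_def cn_def by auto
  qed
  then have "\<forall>w b. \<exists>y. w \<in> C2 \<longrightarrow> b < a \<longrightarrow> y \<in> K \<and> (\<exists>t\<in>Rs b. adj t w \<and> \<not> adj y t)"
    by blast
  then obtain y where y: "\<forall>w b. w \<in> C2 \<longrightarrow> b < a \<longrightarrow> y w b \<in> K \<and> (\<exists>t\<in>Rs b. adj t w \<and> \<not> adj (y w b) t)"
    unfolding choice_iff by (elim exE) (rule that)
  have "(\<lambda>w. restrict (y w) {..<a}) ` C2 \<subseteq> PiE {..<a} (\<lambda>_. K)"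
    using y by (intro image_subsetI) (simp add: restrict_PiE_iff)
  moreover have "finite (PiE {..<a} (\<lambda>_. K))" using fK by (intro finite_PiE) auto
  moreover have "card (PiE {..<a} (\<lambda>_. K)) * (d * n) < chi C2" using cC2 by (simp add: card_PiE K(3))
  ultimately have "\<exists>z\<in>PiE {..<a} (\<lambda>_. K). d * n < chi {w \<in> C2. restrict (y w) {..<a} = z}"
    by (intro chi_pigeon[OF fC2])
  then obtain z where z: "d * n < chi {w \<in> C2. restrict (y w) {..<a} = z}"
    by (elim bexE) (rule that)
  define C3 where "C3 = {w \<in> C2. restrict (y w) {..<a} = z}"
  have zy: "z b \<in> K" "\<exists>t\<in>Rs b. adj t w \<and> \<not> adj (z b) t" if "w \<in> C3" "b < a" for w b
  proof -
    have w: "w \<in> C2" "z = restrict (y w) {..<a}" using that(1) unfolding C3_def by auto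
    then have "z b = y w b" using that(2) by simp
    moreover have "y w b \<in> K \<and> (\<exists>t\<in>Rs b. adj t w \<and> \<not> adj (y w b) t)"
      using y w(1) that(2) by simp
    ultimately show "z b \<in> K" "\<exists>t\<in>Rs b. adj t w \<and> \<not> adj (z b) t" by auto
  qed
  obtain v where v: "v \<in> K" using Kne by blast
  have "chi (C \<inter> cn K) \<le> chi {u \<in> C. adj v u}" using v CU(2) by (intro chi_mono) (auto simp: cn_def)
  also have "\<dots> \<le> d" using U_local[OF CU(1)] v K(1) by blast
  finally have cN: "chi (C \<inter> cn K) \<le> d" .
  have C3n: "C3 \<subseteq> nest Ts K C" unfolding C3_def C2_def by blast
  have cov3: "\<exists>t\<in>C \<inter> cn K. adj t w" if "w \<in> C3" for w using C3n that unfolding nest_def by blast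
  obtain T C4 where T: "T \<subseteq> C \<inter> cn K" "stable T" "C4 \<subseteq> C3" "n < chi C4" "\<forall>w\<in>C4. \<exists>t\<in>T. adj t w"
    using stable_cover_part[of C3 "C \<inter> cn K" d adj n] cov3 cN z fC2 CU(2) unfolding C3_def by auto
  define Ks' where "Ks' = Ks(a := K)"
  \<comment> \<open>Old covers keep only what the chosen \<open>z b\<close> in \<open>K\<close>
    misses, so \<open>z b\<close> is the witness the record demands between \<open>b\<close> and the
    new index \<open>a\<close>.\<close>
  define Rs' where "Rs' b = (if b < a then {t \<in> Rs b. \<not> adj (z b) t} else T)" for b
  have C4C: "C4 \<subseteq> C" using T(3) C3n nest_subset by blast
  have "C4 \<noteq> {}" using T(4) by auto
  then have zK: "z b \<in> K" if "b < a" for b using zy(1) T(3) that by blast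
  have "record_of S (Suc a) Ts Ks' Rs' C4" unfolding record_of_def
  proof (intro conjI allI impI)
    show "(Ts, C4) \<in> S" using family_D(2)[OF fam TsC C4C] .
    obtain X where X: "X \<in> U" "C \<subseteq> X" "\<forall>b<a. Ks b \<subseteq> X \<and> Rs b \<subseteq> X"
      using record_of_D(2)[OF rec] by (elim bexE conjE) (rule that)
    have "\<forall>b<Suc a. Ks' b \<subseteq> X \<and> Rs' b \<subseteq> X"
      using X(2,3) K(1) T(1) unfolding Ks'_def Rs'_def by (auto simp: less_Suc_eq)
    then show "\<exists>X\<in>U. C4 \<subseteq> X \<and> (\<forall>b<Suc a. Ks' b \<subseteq> X \<and> Rs' b \<subseteq> X)"
      using X(1) subset_trans[OF C4C X(2)] by (intro bexI[of _ X] conjI)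
  next
    fix b assume b: "b < Suc a"
    show "\<exists>C0. (Ts, C0) \<in> S \<and> extends Ts C0 (Ks' b) (Rs' b) C4"
    proof (cases "b = a")
      case True
      have "extends Ts C K T C4"
        unfolding extends_def using K(1-3) T(1,2,5) subset_trans[OF T(3) C3n] by (intro conjI)
      moreover have "Ks' b = K" "Rs' b = T" using True unfolding Ks'_def Rs'_def by auto
      ultimately show ?thesis using TsC by (intro exI[of _ C]) simp
    next
      case False
      then have ba: "b < a" using b by simp
      obtain C0 where C0: "(Ts, C0) \<in> S" "extends Ts C0 (Ks b) (Rs b) C"
        using record_of_D(3)[OF rec ba] by (elim exE conjE) (rule that)
      have "extends Ts C0 (Ks b) {t \<in> Rs b. \<not> adj (z b) t} C4"
      proof (rule extends_shrink[OF C0(2) C4C])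
        show "\<forall>w\<in>C4. \<exists>t\<in>{t \<in> Rs b. \<not> adj (z b) t}. adj t w"
          using zy(2)[OF subsetD[OF T(3)] ba] by auto
      qed auto
      moreover have "Ks' b = Ks b" "Rs' b = {t \<in> Rs b. \<not> adj (z b) t}"
        using ba unfolding Ks'_def Rs'_def by auto
      ultimately show ?thesis using C0(1) by (intro exI[of _ C0]) simp
    qed
  next
    fix c b assume cb: "c < Suc a" "b < c"
    show "\<exists>y\<in>Ks' c. \<forall>t\<in>Rs' b. \<not> adj y t"
    proof (cases "c = a")
      case True
      then have "z b \<in> Ks' c" "\<forall>t\<in>Rs' b. \<not> adj (z b) t"
        using zK cb(2) unfolding Ks'_def Rs'_def by auto
      then show ?thesis by (intro bexI)
    next
      case False
      then have "c < a" "b < a" using cb by auto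
      then have "\<exists>y\<in>Ks c. \<forall>t\<in>Rs b. \<not> adj y t" using record_of_D(5)[OF rec] cb(2) by simp
      then show ?thesis using \<open>c < a\<close> \<open>b < a\<close> unfolding Ks'_def Rs'_def by auto
    qed
    show "\<forall>y\<in>Ks' b. \<forall>z\<in>Ks' c \<union> Rs' c. z \<noteq> y \<and> \<not> adj y z"
    proof (cases "c = a")
      case True
      then have ba: "b < a" using cb by simp
      obtain C0 where C0: "extends Ts C0 (Ks b) (Rs b) C"
        using record_of_D(3)[OF rec ba] by (elim exE conjE) (rule that)
      then have "C \<subseteq> nest Ts (Ks b) C0" unfolding extends_def by blast
      moreover have "K \<union> T \<subseteq> C" using K(1) T(1) by blast
      ultimately have "\<forall>y\<in>Ks b. \<forall>z\<in>K \<union> T. z \<noteq> y \<and> \<not> adj y z" unfolding nest_def by auto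
      moreover have "Ks' b = Ks b" "Ks' c = K" "Rs' c = T"
        using ba True unfolding Ks'_def Rs'_def by auto
      ultimately show ?thesis by simp
    next
      case False
      then have "c < a" "b < a" using cb by auto
      then have "\<forall>y\<in>Ks b. \<forall>z\<in>Ks c \<union> Rs c. z \<noteq> y \<and> \<not> adj y z"
        using record_of_D(4)[OF rec] cb(2) by simp
      then show ?thesis using \<open>c < a\<close> \<open>b < a\<close> unfolding Ks'_def Rs'_def by auto
    qed
  qed
  then show ?thesis using T(4) by (meson less_imp_le)
qed

text \<open>If no extension were rich, then every new root clique would have a vertex missed by each of
  the earlier covers, so that records of any length, and hence long multicovers, would exist.\<close>

lemma rich_extension:
  assumes fam: "family m S" and rich: "rich S"
  shows "\<exists>S'. family (Suc m) S' \<and> rich S' \<and>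
    (\<forall>Us C'. (Us, C') \<in> S' \<longrightarrow> (\<exists>Ts C K T. Us = Ts @ [T] \<and> (Ts, C) \<in> S \<and> extends Ts C K T C'))"
proof (rule ccontr)
  assume neg: "\<not> ?thesis"
  have none: "\<not> rich S'" if "family (Suc m) S'"
    "\<And>Us C'. (Us, C') \<in> S' \<Longrightarrow> \<exists>Ts C K T. Us = Ts @ [T] \<and> (Ts, C) \<in> S \<and> extends Ts C K T C'" for S'
    using neg that by blast
  have "\<exists>Ts Ks Rs C. record_of S a Ts Ks Rs C \<and> n \<le> chi C" for a n
  proof (induction a arbitrary: n)
    case 0
    obtain Ts C where TsC: "(Ts, C) \<in> S" "n \<le> chi C" using family_D(3)[OF fam] by blast
    then have "C \<in> U" using family_D(1)[OF fam] state_fin by blast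
    then have "record_of S 0 Ts (\<lambda>_. {}) (\<lambda>_. {}) C" using TsC unfolding record_of_def by auto
    then show ?case using TsC(2) by blast
  next
    case (Suc a)
    show ?case by (rule record_step[OF fam rich none Suc.IH])
  qed
  then obtain Ts Ks Rs C where "record_of S ((h + 1) ^ n1) Ts Ks Rs C" "D1 \<le> chi C" by blast
  then show False using record_bounded[OF fam] by fastforce
qed

end

section \<open>Patterns and grafting\<close>

context arena
begin

text \<open>A vertex yet to be chosen is represented by \<open>W\<close>: whichever cover vertex
  sees a member of \<open>W\<close> has trace \<open>p\<close> on the embedded copy. Since
  \<open>W\<close> avoids the copy and its neighbourhood, further copies can be embedded inside it
  when it is large.\<close>

definition leaf :: "'b set \<Rightarrow> ('b \<Rightarrow> 'v) \<Rightarrow> 'b set \<Rightarrow> 'v set list \<Rightarrow> 'v set \<Rightarrow> bool" where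
  "leaf V \<phi> p Ts W \<longleftrightarrow> (\<forall>w\<in>W. (\<forall>v\<in>V. \<phi> v \<noteq> w \<and> \<not> adj (\<phi> v) w) \<and>
     (\<forall>T\<in>set Ts. \<forall>t\<in>T. adj t w \<longrightarrow> (\<forall>v\<in>V. adj (\<phi> v) t \<longleftrightarrow> v \<in> p)))"

text \<open>A pattern consists of a graph with vertex set \<open>V\<close> and adjacency \<open>E\<close> and of prescribed
  neighbourhoods \<open>P a\<close> of further vertices \<open>a \<in> A\<close>. A set \<open>C\<close> hosts it if it contains a copy of
  the graph together with, for every \<open>a \<in> A\<close>, a set of large chromatic number all of whose
  neighbours in the covers \<open>Ts\<close> could play the role of \<open>a\<close>.\<close>

definition hosts :: "'b set \<Rightarrow> ('b \<Rightarrow> 'b \<Rightarrow> bool) \<Rightarrow> 'a set \<Rightarrow> ('a \<Rightarrow> 'b set) \<Rightarrow> nat \<Rightarrow> 'v set list \<Rightarrow> 'v set \<Rightarrow> bool" where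
  "hosts V E A P D Ts C \<longleftrightarrow> (\<exists>\<phi> W. inj_on \<phi> V \<and> \<phi> ` V \<subseteq> C \<and>
     (\<forall>u\<in>V. \<forall>v\<in>V. adj (\<phi> u) (\<phi> v) \<longleftrightarrow> E u v) \<and>
     (\<forall>a\<in>A. W a \<subseteq> C \<and> D \<le> chi (W a) \<and> leaf V \<phi> (P a) Ts (W a)))"

text \<open>Quantifying over all rich families, with any number of covers, is what lets the
  operations be iterated: a hosted pattern can be found again inside the extended families built for
  the next one.\<close>

definition hosted :: "'b set \<Rightarrow> ('b \<Rightarrow> 'b \<Rightarrow> bool) \<Rightarrow> 'a set \<Rightarrow> ('a \<Rightarrow> 'b set) \<Rightarrow> bool" where
  "hosted V E A P \<longleftrightarrow> (\<forall>m S D. family m S \<longrightarrow> rich S \<longrightarrow>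
     (\<exists>c. \<forall>Ts C. (Ts, C) \<in> S \<longrightarrow> c \<le> chi C \<longrightarrow> hosts V E A P D Ts C))"

lemma leafD:
  assumes "leaf V \<phi> p Ts W" "w \<in> W" "v \<in> V"
  shows "\<phi> v \<noteq> w" "\<not> adj (\<phi> v) w" "T \<in> set Ts \<Longrightarrow> t \<in> T \<Longrightarrow> adj t w \<Longrightarrow> adj (\<phi> v) t \<longleftrightarrow> v \<in> p"
  using assms unfolding leaf_def by auto

lemma hostedD:
  assumes "hosted V E A P" "family m S" "rich S"
  shows "\<exists>c. \<forall>Ts C. (Ts, C) \<in> S \<longrightarrow> c \<le> chi C \<longrightarrow> hosts V E A P D Ts C"
  using assms unfolding hosted_def by simp

lemma hosts_mono:
  assumes "hosts V E A P D Ts C" "C \<subseteq> C'"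
  shows "hosts V E A P D Ts C'"
proof -
  obtain \<phi> W where "inj_on \<phi> V" "\<phi> ` V \<subseteq> C" "\<forall>u\<in>V. \<forall>v\<in>V. adj (\<phi> u) (\<phi> v) \<longleftrightarrow> E u v"
    "\<forall>a\<in>A. W a \<subseteq> C \<and> D \<le> chi (W a) \<and> leaf V \<phi> (P a) Ts (W a)"
    using assms(1) unfolding hosts_def by (elim exE conjE) (rule that)
  then show ?thesis unfolding hosts_def
    using assms(2) by (intro exI[of _ \<phi>] exI[of _ W]) (simp add: subset_trans[OF _ assms(2)])
qed

lemma hosts_relabel:
  assumes "hosts V E A P D Ts C"
    and f: "inj_on f V'" "f ` V' \<subseteq> V" "\<And>u v. u \<in> V' \<Longrightarrow> v \<in> V' \<Longrightarrow> E' u v \<longleftrightarrow> E (f u) (f v)"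
    and g: "g ` A' \<subseteq> A" "\<And>a v. a \<in> A' \<Longrightarrow> v \<in> V' \<Longrightarrow> v \<in> P' a \<longleftrightarrow> f v \<in> P (g a)"
  shows "hosts V' E' A' P' D Ts C"
proof -
  obtain \<phi> W where \<phi>: "inj_on \<phi> V" "\<phi> ` V \<subseteq> C" "\<forall>u\<in>V. \<forall>v\<in>V. adj (\<phi> u) (\<phi> v) \<longleftrightarrow> E u v"
    and W: "\<forall>a\<in>A. W a \<subseteq> C \<and> D \<le> chi (W a) \<and> leaf V \<phi> (P a) Ts (W a)"
    using assms(1) unfolding hosts_def by (elim exE conjE) (rule that)
  have fV: "f v \<in> V" if "v \<in> V'" for v using f(2) that by blast
  have gA: "g a \<in> A" if "a \<in> A'" for a using g(1) that by blast
  show ?thesis unfolding hosts_def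
  proof (intro exI[of _ "\<phi> \<circ> f"] exI[of _ "W \<circ> g"] conjI ballI)
    show "inj_on (\<phi> \<circ> f) V'" using f(1,2) \<phi>(1) by (meson comp_inj_on inj_on_subset)
    show "(\<phi> \<circ> f) ` V' \<subseteq> C" using \<phi>(2) fV by auto
    show "adj ((\<phi> \<circ> f) u) ((\<phi> \<circ> f) v) \<longleftrightarrow> E' u v" if "u \<in> V'" "v \<in> V'" for u v
      using \<phi>(3) fV that f(3) by simp
    fix a assume a: "a \<in> A'"
    show "(W \<circ> g) a \<subseteq> C" "D \<le> chi ((W \<circ> g) a)" using W gA[OF a] by auto
    have l: "leaf V \<phi> (P (g a)) Ts (W (g a))" using W gA[OF a] by auto
    show "leaf V' (\<phi> \<circ> f) (P' a) Ts ((W \<circ> g) a)"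
      unfolding leaf_def using leafD[OF l _ fV] g(2)[OF a] by simp
  qed
qed

lemma hosted_relabel:
  assumes "hosted V E A P"
    and "inj_on f V'" "f ` V' \<subseteq> V" "\<And>u v. u \<in> V' \<Longrightarrow> v \<in> V' \<Longrightarrow> E' u v \<longleftrightarrow> E (f u) (f v)"
    and "g ` A' \<subseteq> A" "\<And>a v. a \<in> A' \<Longrightarrow> v \<in> V' \<Longrightarrow> v \<in> P' a \<longleftrightarrow> f v \<in> P (g a)"
  shows "hosted V' E' A' P'"
  unfolding hosted_def
proof (intro allI impI)
  fix m S D assume S: "family m S" "rich S"
  obtain c where c: "\<forall>Ts C. (Ts, C) \<in> S \<longrightarrow> c \<le> chi C \<longrightarrow> hosts V E A P D Ts C"
    using hostedD[where D = D, OF assms(1) S] by (elim exE) (rule that)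
  have "hosts V' E' A' P' D Ts C" if "(Ts, C) \<in> S" "c \<le> chi C" for Ts C
    by (rule hosts_relabel[OF c[rule_format, OF that] assms(2-6)])
  then show "\<exists>c. \<forall>Ts C. (Ts, C) \<in> S \<longrightarrow> c \<le> chi C \<longrightarrow> hosts V' E' A' P' D Ts C" by blast
qed

text \<open>Any vertex of a nested clique \<open>K\<close> serves: the nested set does not see it,
  and all cover vertices seen from that set are common neighbours of \<open>K\<close>.\<close>

lemma hosted_base: "hosted {b} (\<lambda>_ _. False) A (\<lambda>_. {b})"
  unfolding hosted_def
proof (intro allI impI)
  fix m S D assume S: "family m S" "rich S"
  obtain c where c: "\<forall>Ts C. (Ts, C) \<in> S \<longrightarrow> c \<le> chi C \<longrightarrow> nestable D Ts C"
    using S(2) unfolding rich_def by meson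
  have "hosts {b} (\<lambda>_ _. False) A (\<lambda>_. {b}) D Ts C" if TsC: "(Ts, C) \<in> S" "c \<le> chi C" for Ts C
  proof -
    obtain K where K: "K \<subseteq> C" "card K = h" "D \<le> chi (nest Ts K C)"
      using c[rule_format, OF TsC] unfolding nestable_def by (elim exE conjE) (rule that)
    have "K \<noteq> {}" using K(2) h_pos by auto
    then obtain y where y: "y \<in> K" by blast
    show ?thesis unfolding hosts_def
    proof (intro exI[of _ "\<lambda>_. y"] exI[of _ "\<lambda>_. nest Ts K C"] conjI ballI)
      show "nest Ts K C \<subseteq> C" by (rule nest_subset)
      show "leaf {b} (\<lambda>_. y) {b} Ts (nest Ts K C)"
        using y unfolding leaf_def nest_def cn_def by auto
    qed (use y K adj_irr in auto)
  qed
  then show "\<exists>c. \<forall>Ts C. (Ts, C) \<in> S \<longrightarrow> c \<le> chi C \<longrightarrow> hosts {b} (\<lambda>_ _. False) A (\<lambda>_. {b}) D Ts C"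
    by blast
qed

text \<open>Grafting puts a copy of the second pattern into the set reserved for each
  \<open>a\<close>. There are no edges between the old part and the copies, nor between copies; a
  new leaf \<open>(a, l)\<close> inherits the trace \<open>P a\<close> and adds that of
  \<open>l\<close> in its copy.\<close>

definition graft_adj :: "('b \<Rightarrow> 'b \<Rightarrow> bool) \<Rightarrow> ('c \<Rightarrow> 'c \<Rightarrow> bool) \<Rightarrow> 'b + 'a \<times> 'c \<Rightarrow> 'b + 'a \<times> 'c \<Rightarrow> bool" where
  "graft_adj E E' x y = (case (x, y) of (Inl u, Inl v) \<Rightarrow> E u v
     | (Inr p, Inr q) \<Rightarrow> fst p = fst q \<and> E' (snd p) (snd q) | _ \<Rightarrow> False)"

definition graft_nbrs :: "('a \<Rightarrow> 'b set) \<Rightarrow> ('e \<Rightarrow> 'c set) \<Rightarrow> 'a \<times> 'e \<Rightarrow> ('b + 'a \<times> 'c) set" where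
  "graft_nbrs P P' p = P (fst p) <+> {fst p} \<times> P' (snd p)"

lemma graft_nbrs_iff [simp]:
  "Inl v \<in> graft_nbrs P P' (a, l) \<longleftrightarrow> v \<in> P a"
  "Inr (b, u) \<in> graft_nbrs P P' (a, l) \<longleftrightarrow> b = a \<and> u \<in> P' l"
  unfolding graft_nbrs_def by auto

text \<open>Copies are placed one after another. Before each of them, the earlier copies and their
  neighbourhoods are shaved off the set at hand, at a cost of at most
  \<open>card B * (card V * (d + 1))\<close>.\<close>

lemma host_copies:
  assumes fam: "family m S" and c: "\<And>C. (Ts, C) \<in> S \<Longrightarrow> c \<le> chi C \<Longrightarrow> hosts V E A P D Ts C"
    and V: "finite V" and B: "finite B"
  shows "(\<And>b. b \<in> B \<Longrightarrow> (Ts, W b) \<in> S \<and> W b \<subseteq> C \<and> c + card B * (card V * (d + 1)) \<le> chi (W b)) \<Longrightarrow> C \<in> U \<Longrightarrow>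
    \<exists>\<psi> Y. (\<forall>b\<in>B. inj_on (\<psi> b) V \<and> \<psi> b ` V \<subseteq> W b \<and>
       (\<forall>u\<in>V. \<forall>v\<in>V. adj (\<psi> b u) (\<psi> b v) \<longleftrightarrow> E u v) \<and>
       (\<forall>a\<in>A. Y b a \<subseteq> W b \<and> D \<le> chi (Y b a) \<and> leaf V (\<psi> b) (P a) Ts (Y b a))) \<and>
       (\<forall>b\<in>B. \<forall>b'\<in>B. b \<noteq> b' \<longrightarrow> (\<forall>u\<in>V. \<forall>v\<in>V. \<psi> b u \<noteq> \<psi> b' v \<and> \<not> adj (\<psi> b u) (\<psi> b' v)))"
  using B
proof (induction B rule: finite_induct)
  case empty
  show ?case by simp
next
  case (insert b B)
  have W: "(Ts, W x) \<in> S" "W x \<subseteq> C" "c + card B * (card V * (d + 1)) \<le> chi (W x)"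
    and Wb: "c + Suc (card B) * (card V * (d + 1)) \<le> chi (W x)" if "x \<in> insert b B" for x
    using insert.prems(1)[OF that] insert.hyps by auto
  have "\<exists>\<psi> Y. (\<forall>b\<in>B. inj_on (\<psi> b) V \<and> \<psi> b ` V \<subseteq> W b \<and>
       (\<forall>u\<in>V. \<forall>v\<in>V. adj (\<psi> b u) (\<psi> b v) \<longleftrightarrow> E u v) \<and>
       (\<forall>a\<in>A. Y b a \<subseteq> W b \<and> D \<le> chi (Y b a) \<and> leaf V (\<psi> b) (P a) Ts (Y b a))) \<and>
       (\<forall>b\<in>B. \<forall>b'\<in>B. b \<noteq> b' \<longrightarrow> (\<forall>u\<in>V. \<forall>v\<in>V. \<psi> b u \<noteq> \<psi> b' v \<and> \<not> adj (\<psi> b u) (\<psi> b' v)))"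
    by (rule insert.IH) (use W insert.prems(2) in auto)
  then obtain \<psi> Y where \<psi>: "\<forall>b\<in>B. inj_on (\<psi> b) V \<and> \<psi> b ` V \<subseteq> W b \<and>
       (\<forall>u\<in>V. \<forall>v\<in>V. adj (\<psi> b u) (\<psi> b v) \<longleftrightarrow> E u v) \<and>
       (\<forall>a\<in>A. Y b a \<subseteq> W b \<and> D \<le> chi (Y b a) \<and> leaf V (\<psi> b) (P a) Ts (Y b a))"
    and sep: "\<forall>b\<in>B. \<forall>b'\<in>B. b \<noteq> b' \<longrightarrow> (\<forall>u\<in>V. \<forall>v\<in>V. \<psi> b u \<noteq> \<psi> b' v \<and> \<not> adj (\<psi> b u) (\<psi> b' v))"
    by (elim exE conjE) (rule that)
  define Z where "Z = (\<lambda>p. \<psi> (fst p) (snd p)) ` (B \<times> V)"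
  have "\<psi> x u \<in> C" if "x \<in> B" "u \<in> V" for x u
    using \<psi> W(2)[of x] that by blast
  then have ZC: "Z \<subseteq> C" by (auto simp: Z_def)
  have cZ: "card Z \<le> card B * card V"
    using card_image_le[of "B \<times> V" "\<lambda>p. \<psi> (fst p) (snd p)"] insert.hyps V
    by (simp add: Z_def card_cartesian_product)
  define W' where "W' = {w \<in> W b. \<forall>z\<in>Z. z \<noteq> w \<and> \<not> adj z w}"
  have W'W: "W' \<subseteq> W b" by (auto simp: W'_def)
  have "chi (W b) \<le> chi W' + card Z * (d + 1)"
    using chi_shave[OF insert.prems(2) W(2) ZC] by (simp add: W'_def)
  moreover have "card Z * (d + 1) \<le> card B * (card V * (d + 1))"
    using mult_le_mono1[OF cZ, of "d + 1"] by (simp only: mult.assoc)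
  ultimately have "c \<le> chi W'" using W(3)[of b] by simp
  then have "hosts V E A P D Ts W'"
    using c family_D(2)[OF fam W(1) W'W] by simp
  then obtain \<phi> X where \<phi>: "inj_on \<phi> V" "\<phi> ` V \<subseteq> W'" "\<forall>u\<in>V. \<forall>v\<in>V. adj (\<phi> u) (\<phi> v) \<longleftrightarrow> E u v"
    and X: "\<forall>a\<in>A. X a \<subseteq> W' \<and> D \<le> chi (X a) \<and> leaf V \<phi> (P a) Ts (X a)"
    unfolding hosts_def by (elim exE conjE) (rule that)
  have new: "\<psi> x u \<noteq> \<phi> v" "\<not> adj (\<psi> x u) (\<phi> v)" if "x \<in> B" "u \<in> V" "v \<in> V" for x u v
  proof -
    have "\<psi> x u \<in> Z" "\<phi> v \<in> W'" using that \<phi>(2) by (auto simp: Z_def intro!: image_eqI[of _ _ "(x, u)"])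
    then show "\<psi> x u \<noteq> \<phi> v" "\<not> adj (\<psi> x u) (\<phi> v)" by (auto simp: W'_def)
  qed
  show ?case
  proof (intro exI[of _ "\<psi>(b := \<phi>)"] exI[of _ "Y(b := X)"] conjI)
    show "\<forall>x\<in>insert b B. inj_on ((\<psi>(b := \<phi>)) x) V \<and> (\<psi>(b := \<phi>)) x ` V \<subseteq> W x \<and>
       (\<forall>u\<in>V. \<forall>v\<in>V. adj ((\<psi>(b := \<phi>)) x u) ((\<psi>(b := \<phi>)) x v) \<longleftrightarrow> E u v) \<and>
       (\<forall>a\<in>A. (Y(b := X)) x a \<subseteq> W x \<and> D \<le> chi ((Y(b := X)) x a) \<and>
          leaf V ((\<psi>(b := \<phi>)) x) (P a) Ts ((Y(b := X)) x a))"
    proof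
      fix x assume x: "x \<in> insert b B"
      show "inj_on ((\<psi>(b := \<phi>)) x) V \<and> (\<psi>(b := \<phi>)) x ` V \<subseteq> W x \<and>
       (\<forall>u\<in>V. \<forall>v\<in>V. adj ((\<psi>(b := \<phi>)) x u) ((\<psi>(b := \<phi>)) x v) \<longleftrightarrow> E u v) \<and>
       (\<forall>a\<in>A. (Y(b := X)) x a \<subseteq> W x \<and> D \<le> chi ((Y(b := X)) x a) \<and>
          leaf V ((\<psi>(b := \<phi>)) x) (P a) Ts ((Y(b := X)) x a))"
      proof (cases "x = b")
        case True
        then show ?thesis using \<phi> X W'W by (simp add: subset_trans[OF _ W'W])
      next
        case False
        then have "x \<in> B" using x by simp
        from bspec[OF \<psi> this] False show ?thesis by simp
      qed
    qed
    show "\<forall>x\<in>insert b B. \<forall>y\<in>insert b B. x \<noteq> y \<longrightarrow> (\<forall>u\<in>V. \<forall>v\<in>V.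
       (\<psi>(b := \<phi>)) x u \<noteq> (\<psi>(b := \<phi>)) y v \<and> \<not> adj ((\<psi>(b := \<phi>)) x u) ((\<psi>(b := \<phi>)) y v))"
    proof (intro ballI impI)
      fix x y u v assume xy: "x \<in> insert b B" "y \<in> insert b B" "x \<noteq> y" "u \<in> V" "v \<in> V"
      consider "x = b" "y \<in> B" "y \<noteq> b" | "y = b" "x \<in> B" "x \<noteq> b" | "x \<in> B" "y \<in> B" "x \<noteq> b" "y \<noteq> b"
        using xy(1-3) by auto
      then show "(\<psi>(b := \<phi>)) x u \<noteq> (\<psi>(b := \<phi>)) y v \<and> \<not> adj ((\<psi>(b := \<phi>)) x u) ((\<psi>(b := \<phi>)) y v)"
      proof cases
        case 1
        have "\<phi> u \<noteq> \<psi> y v" "\<not> adj (\<phi> u) (\<psi> y v)"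
          using new[OF 1(2) xy(5,4)] adj_sym[of "\<phi> u" "\<psi> y v"] by auto
        then show ?thesis using 1 by simp
      next
        case 2
        then show ?thesis using new[OF 2(2) xy(4,5)] by simp
      next
        case 3
        then show ?thesis using sep xy(3-5) by simp
      qed
    qed
  qed
qed

text \<open>Leaves are anticomplete to the old copy, which separates it from the grafted ones. A
  cover vertex seen from the leaf \<open>(a, l)\<close> has trace \<open>P a\<close> on the old
  part; if it also saw the copy at another \<open>b\<close>, which lies in the leaf of
  \<open>b\<close>, its trace would be \<open>P b\<close> as well, contradicting injectivity of the
  traces.\<close>

lemma hosted_graft:
  assumes M: "hosted V E A P" and N: "hosted V' E' A' P'"
    and fin: "finite A" "finite V'" and inj: "inj_on (\<lambda>a. P a \<inter> V) A"
  shows "hosted (V <+> A \<times> V') (graft_adj E E') (A \<times> A') (graft_nbrs P P')"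
  unfolding hosted_def
proof (intro allI impI)
  fix m S D assume S: "family m S" "rich S"
  \<comment> \<open>All grafted copies together have at most \<open>card A * card V'\<close>
    vertices; \<open>k\<close> is the price of shaving off their neighbourhoods, paid once to
    separate the copies and once to clear the leaves.\<close>
  define k where "k = card A * (card V' * (d + 1))"
  obtain c1 where c1: "\<forall>Ts C. (Ts, C) \<in> S \<longrightarrow> c1 \<le> chi C \<longrightarrow> hosts V' E' A' P' (D + k) Ts C"
    using hostedD[where D = "D + k", OF N S] by (elim exE) (rule that)
  obtain c2 where c2: "\<forall>Ts C. (Ts, C) \<in> S \<longrightarrow> c2 \<le> chi C \<longrightarrow> hosts V E A P (c1 + k) Ts C"
    using hostedD[where D = "c1 + k", OF M S] by (elim exE) (rule that)
  have "hosts (V <+> A \<times> V') (graft_adj E E') (A \<times> A') (graft_nbrs P P') D Ts C"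
    if TsC: "(Ts, C) \<in> S" and C: "c2 \<le> chi C" for Ts C
  proof -
    obtain \<phi> W where \<phi>: "inj_on \<phi> V" "\<phi> ` V \<subseteq> C" "\<forall>u\<in>V. \<forall>v\<in>V. adj (\<phi> u) (\<phi> v) \<longleftrightarrow> E u v"
      and W0: "\<forall>a\<in>A. W a \<subseteq> C \<and> c1 + k \<le> chi (W a) \<and> leaf V \<phi> (P a) Ts (W a)"
      using c2[rule_format, OF TsC C] unfolding hosts_def by (elim exE conjE) (rule that)
    have W: "W a \<subseteq> C" "c1 + k \<le> chi (W a)" "leaf V \<phi> (P a) Ts (W a)" "(Ts, W a) \<in> S" if "a \<in> A" for a
      using W0 that family_D(2)[OF S(1) TsC] by auto
    have CU: "C \<in> U" using family_D(1)[OF S(1) TsC] state_fin by blast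
    have fC: "finite C" using CU by (rule U_fin)
    have "\<exists>\<psi> Y. (\<forall>b\<in>A. inj_on (\<psi> b) V' \<and> \<psi> b ` V' \<subseteq> W b \<and>
       (\<forall>u\<in>V'. \<forall>v\<in>V'. adj (\<psi> b u) (\<psi> b v) \<longleftrightarrow> E' u v) \<and>
       (\<forall>a\<in>A'. Y b a \<subseteq> W b \<and> D + k \<le> chi (Y b a) \<and> leaf V' (\<psi> b) (P' a) Ts (Y b a))) \<and>
       (\<forall>b\<in>A. \<forall>b'\<in>A. b \<noteq> b' \<longrightarrow> (\<forall>u\<in>V'. \<forall>v\<in>V'. \<psi> b u \<noteq> \<psi> b' v \<and> \<not> adj (\<psi> b u) (\<psi> b' v)))"
      by (rule host_copies[OF S(1) c1[rule_format] fin(2,1) _ CU]) (use W in \<open>auto simp: k_def\<close>)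
    then obtain \<psi> Y where \<psi>0: "\<forall>b\<in>A. inj_on (\<psi> b) V' \<and> \<psi> b ` V' \<subseteq> W b \<and>
       (\<forall>u\<in>V'. \<forall>v\<in>V'. adj (\<psi> b u) (\<psi> b v) \<longleftrightarrow> E' u v) \<and>
       (\<forall>a\<in>A'. Y b a \<subseteq> W b \<and> D + k \<le> chi (Y b a) \<and> leaf V' (\<psi> b) (P' a) Ts (Y b a))"
      and sep: "\<forall>b\<in>A. \<forall>b'\<in>A. b \<noteq> b' \<longrightarrow> (\<forall>u\<in>V'. \<forall>v\<in>V'. \<psi> b u \<noteq> \<psi> b' v \<and> \<not> adj (\<psi> b u) (\<psi> b' v))"
      by (elim exE conjE) (rule that)
    have \<psi>: "inj_on (\<psi> b) V'" "\<And>u. u \<in> V' \<Longrightarrow> \<psi> b u \<in> W b"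
      "\<And>u v. u \<in> V' \<Longrightarrow> v \<in> V' \<Longrightarrow> adj (\<psi> b u) (\<psi> b v) \<longleftrightarrow> E' u v"
      and Y: "\<And>a. a \<in> A' \<Longrightarrow> Y b a \<subseteq> W b" "\<And>a. a \<in> A' \<Longrightarrow> D + k \<le> chi (Y b a)"
        "\<And>a. a \<in> A' \<Longrightarrow> leaf V' (\<psi> b) (P' a) Ts (Y b a)" if "b \<in> A" for b
      using bspec[OF \<psi>0 that] by auto
    define Z where "Z = (\<lambda>p. \<psi> (fst p) (snd p)) ` (A \<times> V')"
    have ZC: "Z \<subseteq> C" using \<psi>(2) W(1) by (fastforce simp: Z_def)
    have cZ: "card Z * (d + 1) \<le> k"
    proof -
      have "card Z \<le> card A * card V'"
        using card_image_le[of "A \<times> V'" "\<lambda>p. \<psi> (fst p) (snd p)"] fin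
        by (simp add: Z_def card_cartesian_product)
      from mult_le_mono1[OF this, of "d + 1"] show ?thesis by (simp only: k_def mult.assoc)
    qed
    define Y' where "Y' p = {w \<in> Y (fst p) (snd p). \<forall>z\<in>Z. z \<noteq> w \<and> \<not> adj z w}" for p
    define \<theta> where "\<theta> x = (case x of Inl v \<Rightarrow> \<phi> v | Inr p \<Rightarrow> \<psi> (fst p) (snd p))" for x
    have \<theta>: "\<theta> (Inl v) = \<phi> v" "\<theta> (Inr (a, u)) = \<psi> a u" for v a u by (auto simp: \<theta>_def)
    have cross: "\<phi> v \<noteq> \<psi> a u" "\<not> adj (\<phi> v) (\<psi> a u)" "\<not> adj (\<psi> a u) (\<phi> v)"
      if "v \<in> V" "a \<in> A" "u \<in> V'" for v a u
      using leafD(1,2)[OF W(3)[OF that(2)] \<psi>(2)[OF that(2,3)] that(1)] adj_sym by metis+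
    show ?thesis unfolding hosts_def
    proof (intro exI[of _ \<theta>] exI[of _ Y'] conjI ballI)
      show "inj_on \<theta> (V <+> A \<times> V')"
      proof (rule inj_onI)
        fix x y assume x: "x \<in> V <+> A \<times> V'" and y: "y \<in> V <+> A \<times> V'" and eq: "\<theta> x = \<theta> y"
        from x show "x = y"
        proof (elim PlusE SigmaE)
          fix v assume xv: "x = Inl v" "v \<in> V"
          from y show ?thesis
          proof (elim PlusE SigmaE)
            fix v' assume "y = Inl v'" "v' \<in> V"
            then show ?thesis using xv eq \<phi>(1) \<theta> by (simp add: inj_on_def)
          next
            fix q a u assume "y = Inr q" "a \<in> A" "u \<in> V'" "q = (a, u)"
            then show ?thesis using xv eq \<theta> cross(1) by simp
          qed
        next
          fix p a u assume xp: "x = Inr p" "a \<in> A" "u \<in> V'" "p = (a, u)"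
          from y show ?thesis
          proof (elim PlusE SigmaE)
            fix v assume "y = Inl v" "v \<in> V"
            then show ?thesis using xp eq \<theta> cross(1)[of v a u] by simp
          next
            fix q a' u' assume yq: "y = Inr q" "a' \<in> A" "u' \<in> V'" "q = (a', u')"
            have e: "\<psi> a u = \<psi> a' u'" using eq xp yq \<theta> by simp
            then have "a = a'" using sep xp(2,3) yq(2,3) by metis
            then show ?thesis using e \<psi>(1)[OF xp(2)] xp yq by (simp add: inj_on_def)
          qed
        qed
      qed
      show "\<theta> ` (V <+> A \<times> V') \<subseteq> C" using \<phi>(2) \<psi>(2) W(1) by (fastforce simp: \<theta>_def)
      fix x y assume x: "x \<in> V <+> A \<times> V'" and y: "y \<in> V <+> A \<times> V'"
      from x show "adj (\<theta> x) (\<theta> y) \<longleftrightarrow> graft_adj E E' x y"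
      proof (elim PlusE SigmaE)
        fix v assume xv: "x = Inl v" "v \<in> V"
        from y show ?thesis
          by (elim PlusE SigmaE) (use xv \<theta> \<phi>(3) cross in \<open>auto simp: graft_adj_def\<close>)
      next
        fix p a u assume xp: "x = Inr p" "a \<in> A" "u \<in> V'" "p = (a, u)"
        from y show ?thesis
        proof (elim PlusE SigmaE)
          fix v assume "y = Inl v" "v \<in> V"
          then show ?thesis using xp \<theta> cross(3) by (simp add: graft_adj_def)
        next
          fix q a' u' assume yq: "y = Inr q" "a' \<in> A" "u' \<in> V'" "q = (a', u')"
          show ?thesis
          proof (cases "a = a'")
            case True
            then show ?thesis using xp yq \<theta> \<psi>(3)[OF xp(2,3)] by (simp add: graft_adj_def)
          next
            case False
            then have "\<not> adj (\<psi> a u) (\<psi> a' u')" using sep xp(2,3) yq(2,3) by simp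
            then show ?thesis using False xp yq \<theta> by (simp add: graft_adj_def)
          qed
        qed
      qed
    next
      fix p assume "p \<in> A \<times> A'"
      then obtain a l where p: "p = (a, l)" "a \<in> A" "l \<in> A'" by blast
      have YW: "Y a l \<subseteq> W a" and lf: "leaf V' (\<psi> a) (P' l) Ts (Y a l)" using Y p by auto
      have Y'Y: "Y' p \<subseteq> Y a l" by (auto simp: Y'_def p(1))
      show "Y' p \<subseteq> C" using Y'Y YW W(1)[OF p(2)] by blast
      have "chi (Y a l) \<le> chi (Y' p) + card Z * (d + 1)"
        using chi_shave[OF CU subset_trans[OF YW W(1)[OF p(2)]] ZC] by (simp add: Y'_def p(1))
      then show "D \<le> chi (Y' p)" using Y(2)[OF p(2,3)] cZ by linarith
      show "leaf (V <+> A \<times> V') \<theta> (graft_nbrs P P' p) Ts (Y' p)"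
        unfolding leaf_def
      proof (intro ballI conjI impI)
        fix w x assume w: "w \<in> Y' p" and x: "x \<in> V <+> A \<times> V'"
        have wY: "w \<in> Y a l" using w Y'Y by blast
        then have wW: "w \<in> W a" using YW by blast
        have nZ: "z \<noteq> w \<and> \<not> adj z w" if "z \<in> Z" for z using w that by (auto simp: Y'_def)
        have "\<theta> x \<noteq> w \<and> \<not> adj (\<theta> x) w"
          using x
        proof (elim PlusE SigmaE)
          fix v assume "x = Inl v" "v \<in> V"
          then show ?thesis using leafD(1,2)[OF W(3)[OF p(2)] wW] \<theta> by simp
        next
          fix q b u assume q: "x = Inr q" "b \<in> A" "u \<in> V'" "q = (b, u)"
          then have "\<theta> x \<in> Z" by (auto simp: \<theta>_def Z_def intro!: image_eqI[of _ _ "(b, u)"])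
          then show ?thesis using nZ by simp
        qed
        then show "\<theta> x \<noteq> w" "\<not> adj (\<theta> x) w" by auto
      next
        fix w T t x assume w: "w \<in> Y' p" and T: "T \<in> set Ts" "t \<in> T" "adj t w"
          and x: "x \<in> V <+> A \<times> V'"
        have wY: "w \<in> Y a l" using w Y'Y by blast
        then have wW: "w \<in> W a" using YW by blast
        have old: "adj (\<phi> v) t \<longleftrightarrow> v \<in> P a" if "v \<in> V" for v
          by (rule leafD(3)[OF W(3)[OF p(2)] wW that T])
        from x show "adj (\<theta> x) t \<longleftrightarrow> x \<in> graft_nbrs P P' p"
        proof (elim PlusE SigmaE)
          fix v assume "x = Inl v" "v \<in> V"
          then show ?thesis using old \<theta> by (simp add: p(1))
        next
          fix q b u assume q: "x = Inr q" "b \<in> A" "u \<in> V'" "q = (b, u)"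
          show ?thesis
          proof (cases "b = a")
            case True
            then show ?thesis using q leafD(3)[OF lf wY q(3) T] \<theta> by (simp add: p(1))
          next
            case False
            have "\<not> adj (\<psi> b u) t"
            proof
              assume "adj (\<psi> b u) t"
              then have tu: "adj t (\<psi> b u)" by (rule adj_sym)
              have "adj (\<phi> v) t \<longleftrightarrow> v \<in> P b" if "v \<in> V" for v
                by (rule leafD(3)[OF W(3)[OF q(2)] \<psi>(2)[OF q(2,3)] that T(1,2) tu])
              then have "P a \<inter> V = P b \<inter> V" using old by blast
              then show False using inj False p(2) q(2) by (auto simp: inj_on_def)
            qed
            then show ?thesis using False q \<theta> by (simp add: p(1))
          qed
        qed
      qed
    qed
  qed
  then show "\<exists>c. \<forall>Ts C. (Ts, C) \<in> S \<longrightarrow> c \<le> chi C \<longrightarrow>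
      hosts (V <+> A \<times> V') (graft_adj E E') (A \<times> A') (graft_nbrs P P') D Ts C" by blast
qed

end

section \<open>Doubling a pattern\<close>

context arena
begin

text \<open>Compared with \<open>extends\<close>, every vertex \<open>z\<close> of the new cover
  comes with a reserve \<open>R\<close>: a large set all of whose neighbours in the old covers see
  \<open>z\<close>. It becomes a leaf attached to \<open>z\<close> once \<open>z\<close> is an
  actual vertex of the pattern.\<close>

definition stage :: "nat \<Rightarrow> 'v set list \<Rightarrow> 'v set \<Rightarrow> 'v set \<Rightarrow> 'v set \<Rightarrow> 'v set \<Rightarrow> bool" where
  "stage D Us C K T C' \<longleftrightarrow> K \<subseteq> C \<and> clq K \<and> card K = h \<and> T \<subseteq> C \<inter> cn K \<and> C' \<subseteq> C \<and>
     (\<forall>w\<in>C'. w \<notin> K \<and> (\<forall>y\<in>K. \<not> adj y w) \<and> (\<forall>V\<in>set Us. \<forall>t\<in>V. adj t w \<longrightarrow> t \<in> cn K)) \<and>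
     (\<forall>z\<in>T. \<exists>R\<subseteq>C. D \<le> chi R \<and> (\<forall>w\<in>R. \<forall>V\<in>set Us. \<forall>t\<in>V. adj t w \<longrightarrow> adj z t))"

text \<open>Vertices without a reserve form a set of small chromatic number: otherwise richness
  would nest a clique \<open>K\<close> among them, and the nested set would be a reserve for each
  member of \<open>K\<close>. Hence they are deleted first, and the extension is made within the
  family of what remains.\<close>

lemma stage_extension:
  assumes fam: "family m S" and rich: "rich S"
  shows "\<exists>S'. family (Suc m) S' \<and> rich S' \<and>
    (\<forall>Us C'. (Us, C') \<in> S' \<longrightarrow> (\<exists>Ts C K T. Us = Ts @ [T] \<and> (Ts, C) \<in> S \<and> stage D Ts C K T C'))"
proof -
  define good where "good Ts C z \<longleftrightarrow>
    (\<exists>R\<subseteq>C. D \<le> chi R \<and> (\<forall>w\<in>R. \<forall>V\<in>set Ts. \<forall>t\<in>V. adj t w \<longrightarrow> adj z t))" for Ts C z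
  define S1 where "S1 = {(Ts, C1). \<exists>C. (Ts, C) \<in> S \<and> C1 \<subseteq> C \<and> (\<forall>z\<in>C1. good Ts C z)}"
  have S1D: "\<exists>C. (Ts, C) \<in> S \<and> C1 \<subseteq> C \<and> (\<forall>z\<in>C1. good Ts C z)" if "(Ts, C1) \<in> S1" for Ts C1
    using that by (simp add: S1_def)
  have S1S: "S1 \<subseteq> S"
  proof
    fix p assume "p \<in> S1"
    then obtain Ts C1 where p: "p = (Ts, C1)" "(Ts, C1) \<in> S1" by (cases p) auto
    then obtain C where "(Ts, C) \<in> S" "C1 \<subseteq> C" using S1D by blast
    then show "p \<in> S" using family_D(2)[OF fam] p(1) by simp
  qed
  have "family m S1" unfolding family_def
  proof (intro conjI allI impI)
    show "state m Ts C" if "(Ts, C) \<in> S1" for Ts C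
      using family_D(1)[OF fam] subsetD[OF S1S that] by simp
    show "(Ts, C') \<in> S1" if C: "(Ts, C) \<in> S1" "C' \<subseteq> C" for Ts C C'
    proof -
      obtain C0 where "(Ts, C0) \<in> S" "C \<subseteq> C0" "\<forall>z\<in>C. good Ts C0 z"
        using S1D[OF C(1)] by (elim exE conjE) (rule that)
      then have "(Ts, C0) \<in> S \<and> C' \<subseteq> C0 \<and> (\<forall>z\<in>C'. good Ts C0 z)" using C(2) by auto
      then show ?thesis unfolding S1_def by auto
    qed
    fix n
    obtain c where c: "\<forall>Ts C. (Ts, C) \<in> S \<longrightarrow> c \<le> chi C \<longrightarrow> nestable D Ts C"
      using rich unfolding rich_def by meson
    obtain Ts C where TsC: "(Ts, C) \<in> S" "n + c \<le> chi C" using family_D(3)[OF fam] by blast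
    have fC: "finite C" using family_D(1)[OF fam TsC(1)] state_fin by blast
    define B where "B = {z \<in> C. \<not> good Ts C z}"
    have BC: "B \<subseteq> C" by (auto simp: B_def)
    have "chi B < c"
    proof (rule ccontr)
      assume "\<not> chi B < c"
      then have "nestable D Ts B" using c family_D(2)[OF fam TsC(1) BC] by simp
      then obtain K where K: "K \<subseteq> B" "card K = h" "D \<le> chi (nest Ts K B)"
        unfolding nestable_def by (elim exE conjE) (rule that)
      have "K \<noteq> {}" using K(2) h_pos by auto
      then obtain y where y: "y \<in> K" by blast
      have "nest Ts K B \<subseteq> C" using nest_subset BC by (rule subset_trans)
      moreover have "\<forall>w\<in>nest Ts K B. \<forall>V\<in>set Ts. \<forall>t\<in>V. adj t w \<longrightarrow> adj y t"
        using y unfolding nest_def cn_def by auto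
      ultimately have "good Ts C y" unfolding good_def using K(3) by (intro exI conjI)
      moreover have "y \<in> B" using y K(1) by blast
      ultimately show False by (simp add: B_def)
    qed
    then have "n \<le> chi (C - B)"
      using chi_diff[OF fC finite_subset[OF BC fC]] TsC(2) by linarith
    moreover have "(Ts, C) \<in> S \<and> C - B \<subseteq> C \<and> (\<forall>z\<in>C - B. good Ts C z)"
      using TsC(1) by (auto simp: B_def)
    then have "(Ts, C - B) \<in> S1" unfolding S1_def by auto
    ultimately show "\<exists>Ts C. (Ts, C) \<in> S1 \<and> n \<le> chi C" by (intro exI conjI)
  qed
  then obtain S' where S': "family (Suc m) S'" "rich S'"
    and ext: "\<forall>Us C'. (Us, C') \<in> S' \<longrightarrow> (\<exists>Ts C K T. Us = Ts @ [T] \<and> (Ts, C) \<in> S1 \<and> extends Ts C K T C')"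
    using rich_extension rich_subset[OF rich S1S] by blast
  have "\<exists>Ts C K T. Us = Ts @ [T] \<and> (Ts, C) \<in> S \<and> stage D Ts C K T C'" if mem: "(Us, C') \<in> S'" for Us C'
  proof -
    obtain Ts C1 K T where e: "Us = Ts @ [T]" "(Ts, C1) \<in> S1" "extends Ts C1 K T C'"
      using ext[rule_format, OF mem] by (elim exE conjE) (rule that)
    obtain C where C: "(Ts, C) \<in> S" "C1 \<subseteq> C" "\<forall>z\<in>C1. good Ts C z"
      using S1D[OF e(2)] by (elim exE conjE) (rule that)
    have x: "K \<subseteq> C1" "clq K" "card K = h" "T \<subseteq> C1 \<inter> cn K" "C' \<subseteq> nest Ts K C1"
      using e(3) unfolding extends_def by auto
    have "stage D Ts C K T C'" unfolding stage_def
    proof (intro conjI)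
      show "K \<subseteq> C" "T \<subseteq> C \<inter> cn K" using x(1,4) C(2) by auto
      show "C' \<subseteq> C" using x(5) nest_subset C(2) by (meson subset_trans)
      show "\<forall>w\<in>C'. w \<notin> K \<and> (\<forall>y\<in>K. \<not> adj y w) \<and> (\<forall>V\<in>set Ts. \<forall>t\<in>V. adj t w \<longrightarrow> t \<in> cn K)"
        using x(5) unfolding nest_def by auto
      show "\<forall>z\<in>T. \<exists>R\<subseteq>C. D \<le> chi R \<and> (\<forall>w\<in>R. \<forall>V\<in>set Ts. \<forall>t\<in>V. adj t w \<longrightarrow> adj z t)"
        using C(3) x(4) unfolding good_def by blast
    qed (use x in auto)
    then show ?thesis using e(1) C(1) by (intro exI conjI)
  qed
  then show ?thesis using S' by (intro exI[of _ S']) simp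
qed

text \<open>Stage \<open>i\<close> refocuses on \<open>K i\<close> not only the covers
  \<open>Ts\<close> but also those of all earlier stages.\<close>

definition tower :: "nat \<Rightarrow> nat \<Rightarrow> 'v set list \<Rightarrow> (nat \<Rightarrow> 'v set) \<Rightarrow> (nat \<Rightarrow> 'v set) \<Rightarrow> (nat \<Rightarrow> 'v set) \<Rightarrow> bool" where
  "tower D s Ts T K Cs \<longleftrightarrow> (\<forall>i<s. stage D (Ts @ map T [0..<i]) (Cs i) (K i) (T i) (Cs (Suc i)))"

lemma tower_extension:
  assumes fam: "family m S" and rich: "rich S"
  shows "\<exists>S'. family (m + s) S' \<and> rich S' \<and> (\<forall>Us C. (Us, C) \<in> S' \<longrightarrow>
    (\<exists>Ts T K Cs. Us = Ts @ map T [0..<s] \<and> (Ts, Cs 0) \<in> S \<and> Cs s = C \<and> tower D s Ts T K Cs))"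
proof (induction s)
  case 0
  show ?case by (rule exI[of _ S]) (auto simp: fam rich tower_def intro!: exI[of _ "\<lambda>_. C" for C])
next
  case (Suc s)
  then obtain S1 where S1: "family (m + s) S1" "rich S1"
    and tow: "\<forall>Us C. (Us, C) \<in> S1 \<longrightarrow>
      (\<exists>Ts T K Cs. Us = Ts @ map T [0..<s] \<and> (Ts, Cs 0) \<in> S \<and> Cs s = C \<and> tower D s Ts T K Cs)"
    by (elim exE conjE) (rule that)
  obtain S2 where S2: "family (Suc (m + s)) S2" "rich S2"
    and ext: "\<forall>Us C'. (Us, C') \<in> S2 \<longrightarrow> (\<exists>Ts C K T. Us = Ts @ [T] \<and> (Ts, C) \<in> S1 \<and> stage D Ts C K T C')"
    using stage_extension[OF S1, of D] by (elim exE conjE) (rule that)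
  have "\<exists>Ts T K Cs. Us = Ts @ map T [0..<Suc s] \<and> (Ts, Cs 0) \<in> S \<and> Cs (Suc s) = C \<and> tower D (Suc s) Ts T K Cs"
    if mem: "(Us, C) \<in> S2" for Us C
  proof -
    obtain Us' C' K' T' where e: "Us = Us' @ [T']" "(Us', C') \<in> S1" "stage D Us' C' K' T' C"
      using ext[rule_format, OF mem] by (elim exE conjE) (rule that)
    obtain Ts T K Cs where t: "Us' = Ts @ map T [0..<s]" "(Ts, Cs 0) \<in> S" "Cs s = C'" "tower D s Ts T K Cs"
      using tow[rule_format, OF e(2)] by (elim exE conjE) (rule that)
    have m: "map (T(s := T')) [0..<i] = map T [0..<i]" if "i \<le> s" for i
      using that by (intro map_cong) auto
    show ?thesis
    proof (rule exI[of _ Ts], rule exI[of _ "T(s := T')"], rule exI[of _ "K(s := K')"],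
        rule exI[of _ "Cs(Suc s := C)"], intro conjI)
      show "Us = Ts @ map (T(s := T')) [0..<Suc s]" using e(1) t(1) m[of s] by simp
      show "tower D (Suc s) Ts (T(s := T')) (K(s := K')) (Cs(Suc s := C))"
        unfolding tower_def
      proof (intro allI impI)
        fix i assume i: "i < Suc s"
        show "stage D (Ts @ map (T(s := T')) [0..<i]) ((Cs(Suc s := C)) i) ((K(s := K')) i)
          ((T(s := T')) i) ((Cs(Suc s := C)) (Suc i))"
        proof (cases "i = s")
          case True
          then show ?thesis using e(3) t(1,3) m[of s] by simp
        next
          case False
          then have "i < s" using i by simp
          then show ?thesis using t(4) m[of i] unfolding tower_def by simp
        qed
      qed
    qed (use t(2) in auto)
  qed
  then show ?case using S2 by (intro exI[of _ S2]) simp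
qed

text \<open>The doubling inside the Burling recursion: the vertex \<open>Inr a\<close> is the new
  one joined to the neighbours of the marked vertex \<open>a\<close>. Of the two leaves in
  \<open>dup_nbrs\<close>, \<open>Inl a\<close> is \<open>a\<close> itself and \<open>Inr a\<close>
  is the additional marked vertex hanging on that new vertex.\<close>

definition dup_adj :: "('b \<Rightarrow> 'b \<Rightarrow> bool) \<Rightarrow> ('a \<Rightarrow> 'b set) \<Rightarrow> 'b + 'a \<Rightarrow> 'b + 'a \<Rightarrow> bool" where
  "dup_adj E P x y = (case (x, y) of (Inl u, Inl v) \<Rightarrow> E u v
     | (Inl u, Inr a) \<Rightarrow> u \<in> P a | (Inr a, Inl u) \<Rightarrow> u \<in> P a | _ \<Rightarrow> False)"

definition dup_nbrs :: "('a \<Rightarrow> 'b set) \<Rightarrow> 'a + 'a \<Rightarrow> ('b + 'a) set" where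
  "dup_nbrs P x = (case x of Inl a \<Rightarrow> Inl ` P a | Inr a \<Rightarrow> {Inr a})"

text \<open>The pattern is hosted at the top of a tower with one stage per marked vertex. The cover
  of the stage of \<open>a\<close> supplies \<open>z (pos a)\<close>, seen from the leaf of
  \<open>a\<close> and hence with trace \<open>P a\<close>; the old leaf stays, and the reserve of
  \<open>z (pos a)\<close> is the second leaf. Unwanted adjacencies are excluded by focusing: a
  vertex of an earlier cover seen from beyond stage \<open>i\<close> is a common neighbour of
  \<open>K i\<close>, and by \<open>U_sparse\<close> only a bounded set sees common neighbours of
  \<open>K i\<close> that are also adjacent to \<open>z i\<close>.\<close>

lemma tower_hosts_dup:
  fixes P :: "'a \<Rightarrow> 'b set"
  assumes X: "X \<in> U" "Cs 0 \<subseteq> X" "\<And>T. T \<in> set Ts \<Longrightarrow> T \<subseteq> X"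
    and tow: "tower G s Ts T K Cs"
    and pos: "bij_betw pos A {..<s}"
    and cov: "\<And>i w. i < s \<Longrightarrow> w \<in> Cs s \<Longrightarrow> \<exists>t\<in>T i. adj t w"
    and G: "G = Suc (D + (card V + s) * (d + 1) + s * D0)" and V: "finite V"
    and host: "hosts V E A P G (Ts @ map T [0..<s]) (Cs s)"
  shows "hosts (V <+> A) (dup_adj E P) (A <+> A) (dup_nbrs P) D Ts (Cs 0)"
proof -
  have fX: "finite X" using X(1) by (rule U_fin)
  have C0: "Cs 0 \<in> U" using X(1,2) by (rule U_hered)
  have st: "K i \<subseteq> Cs i" "clq (K i)" "card (K i) = h" "T i \<subseteq> Cs i" "T i \<subseteq> cn (K i)" "Cs (Suc i) \<subseteq> Cs i"
    "\<And>w. w \<in> Cs (Suc i) \<Longrightarrow> w \<notin> K i \<and> (\<forall>y\<in>K i. \<not> adj y w)"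
    "\<And>w V t. w \<in> Cs (Suc i) \<Longrightarrow> V \<in> set Ts \<union> T ` {..<i} \<Longrightarrow> t \<in> V \<Longrightarrow> adj t w \<Longrightarrow> t \<in> cn (K i)"
    "\<And>z. z \<in> T i \<Longrightarrow> \<exists>R\<subseteq>Cs i. G \<le> chi R \<and> (\<forall>w\<in>R. \<forall>V\<in>set Ts. \<forall>t\<in>V. adj t w \<longrightarrow> adj z t)"
    if "i < s" for i
  proof -
    have S: "stage G (Ts @ map T [0..<i]) (Cs i) (K i) (T i) (Cs (Suc i))"
      using tow that unfolding tower_def by simp
    show "K i \<subseteq> Cs i" "clq (K i)" "card (K i) = h" "T i \<subseteq> Cs i" "T i \<subseteq> cn (K i)" "Cs (Suc i) \<subseteq> Cs i"
      using S unfolding stage_def by auto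
    show "w \<notin> K i \<and> (\<forall>y\<in>K i. \<not> adj y w)" if "w \<in> Cs (Suc i)" for w
      using S that unfolding stage_def by auto
    show "t \<in> cn (K i)" if "w \<in> Cs (Suc i)" "V \<in> set Ts \<union> T ` {..<i}" "t \<in> V" "adj t w" for w V t
    proof -
      have "V \<in> set (Ts @ map T [0..<i])" using that(2) by auto
      then show ?thesis using S that unfolding stage_def by blast
    qed
    show "\<exists>R\<subseteq>Cs i. G \<le> chi R \<and> (\<forall>w\<in>R. \<forall>V\<in>set Ts. \<forall>t\<in>V. adj t w \<longrightarrow> adj z t)" if z: "z \<in> T i" for z
    proof -
      have "\<forall>z\<in>T i. \<exists>R\<subseteq>Cs i. G \<le> chi R \<and>
          (\<forall>w\<in>R. \<forall>V\<in>set (Ts @ map T [0..<i]). \<forall>t\<in>V. adj t w \<longrightarrow> adj z t)"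
        using S unfolding stage_def by (elim conjE)
      from bspec[OF this z] obtain R where "R \<subseteq> Cs i" "G \<le> chi R"
          "\<forall>w\<in>R. \<forall>V\<in>set (Ts @ map T [0..<i]). \<forall>t\<in>V. adj t w \<longrightarrow> adj z t"
        by (elim exE conjE) (rule that)
      then show ?thesis by (intro exI[of _ R]) (simp add: ball_Un)
    qed
  qed
  have mono: "Cs j \<subseteq> Cs i" if "i \<le> j" "j \<le> s" for i j
    using that
  proof (induction j rule: dec_induct)
    case (step n)
    then show ?case using subset_trans[OF st(6)[of n]] by simp
  qed simp
  have away: "w \<notin> K i" "y \<in> K i \<Longrightarrow> \<not> adj y w" and focus:
    "V \<in> set Ts \<union> T ` {..<i} \<Longrightarrow> t \<in> V \<Longrightarrow> adj t w \<Longrightarrow> t \<in> cn (K i)"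
    if "w \<in> Cs j" "i < j" "j \<le> s" for w i j y V t
  proof -
    have "w \<in> Cs (Suc i)" "i < s" using mono[of "Suc i" j] that by auto
    then show "w \<notin> K i" "y \<in> K i \<Longrightarrow> \<not> adj y w"
      "V \<in> set Ts \<union> T ` {..<i} \<Longrightarrow> t \<in> V \<Longrightarrow> adj t w \<Longrightarrow> t \<in> cn (K i)"
      using st(7,8) by auto
  qed
  have Cs0: "Cs i \<subseteq> Cs 0" if "i \<le> s" for i using mono[of 0 i] that by simp
  have CsX: "Cs i \<subseteq> X" if "i \<le> s" for i using Cs0[OF that] X(2) by (rule subset_trans)
  have Kne: "K i \<noteq> {}" if "i < s" for i using st(3)[OF that] h_pos by auto
  have sparse: "chi (dominated X (cn (insert z (K i)))) \<le> D0" if "i < s" "z \<in> T i" for i z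
  proof (rule U_sparse[OF X(1)])
    have z: "z \<in> cn (K i)" "z \<in> X" using st(4,5)[OF that(1)] that(2) CsX[of i] that(1) by auto
    then show "clq (insert z (K i))"
      using st(2)[OF that(1)] adj_sym unfolding clq_def cn_def by auto
    have "finite (K i)" using st(1)[OF that(1)] CsX[of i] that(1) fX by (meson finite_subset less_imp_le)
    moreover have "z \<notin> K i" using z(1) adj_irr unfolding cn_def by blast
    ultimately show "card (insert z (K i)) = Suc h" using st(3)[OF that(1)] by simp
    show "insert z (K i) \<subseteq> X" using z(2) st(1)[OF that(1)] CsX[of i] that(1) by auto
  qed
  have union: "chi (\<Union>i\<in>I. dominated X (cn (insert (z i) (K i)))) \<le> s * D0"
    if "I \<subseteq> {..<s}" "\<And>i. i \<in> I \<Longrightarrow> z i \<in> T i" for I z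
  proof -
    have fI: "finite I" using that(1) finite_subset by blast
    have "chi (\<Union>i\<in>I. dominated X (cn (insert (z i) (K i)))) \<le> card I * D0"
      using fI fX sparse that by (intro chi_UN_le) (auto simp: dominated_def)
    also have "\<dots> \<le> s * D0" using card_mono[OF _ that(1)] by simp
    finally show ?thesis .
  qed
  obtain \<phi> W where \<phi>: "inj_on \<phi> V" "\<phi> ` V \<subseteq> Cs s" "\<forall>u\<in>V. \<forall>v\<in>V. adj (\<phi> u) (\<phi> v) \<longleftrightarrow> E u v"
    and W: "\<forall>a\<in>A. W a \<subseteq> Cs s \<and> G \<le> chi (W a) \<and> leaf V \<phi> (P a) (Ts @ map T [0..<s]) (W a)"
    using host unfolding hosts_def by (elim exE conjE) (rule that)
  define e where "e = inv_into A pos"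
  have e: "e i \<in> A" if "i < s" for i
    using pos that unfolding e_def bij_betw_def by (metis inv_into_into lessThan_iff)
  have ep: "e (pos a) = a" "pos a < s" if "a \<in> A" for a
    using pos that unfolding e_def bij_betw_def by auto
  \<comment> \<open>The \<open>z i\<close> are chosen from the last stage down. At stage
    \<open>i\<close> a vertex \<open>w\<close> of the leaf is taken outside the sets dominated by
    common neighbours of \<open>insert (z i') (K i')\<close> for later \<open>i'\<close>. Its
    neighbour \<open>z i\<close> in \<open>T i\<close> is focused on \<open>K i'\<close>, so it
    cannot also see \<open>z i'\<close>.\<close>
  have "\<exists>z. \<forall>i. s - j \<le> i \<longrightarrow> i < s \<longrightarrow> z i \<in> T i \<and> (\<exists>w\<in>W (e i). adj (z i) w \<and>
      (\<forall>i'. i < i' \<longrightarrow> i' < s \<longrightarrow> w \<notin> dominated X (cn (insert (z i') (K i')))))" for j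
  proof (induction j)
    case 0
    show ?case by simp
  next
    case (Suc j)
    then obtain z where z: "\<forall>i. s - j \<le> i \<longrightarrow> i < s \<longrightarrow> z i \<in> T i \<and> (\<exists>w\<in>W (e i). adj (z i) w \<and>
      (\<forall>i'. i < i' \<longrightarrow> i' < s \<longrightarrow> w \<notin> dominated X (cn (insert (z i') (K i')))))" by (elim exE) (rule that)
    show ?case
    proof (cases "j < s")
      case False
      then show ?thesis using z by (intro exI[of _ z]) simp
    next
      case True
      define i where "i = s - Suc j"
      have i: "i < s" "s - j = Suc i" using True by (auto simp: i_def)
      define B where "B = (\<Union>i'\<in>{i<..<s}. dominated X (cn (insert (z i') (K i'))))"
      have "chi B \<le> s * D0" unfolding B_def using z i by (intro union) auto
      then have "chi B < chi (W (e i))" using W e[OF i(1)] G by fastforce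
      moreover have "finite B" unfolding B_def dominated_def using fX by auto
      ultimately have "\<not> W (e i) \<subseteq> B" using chi_mono by (metis not_less)
      then obtain w where w: "w \<in> W (e i)" "w \<notin> B" by blast
      have "w \<in> Cs s" using w(1) W e[OF i(1)] by blast
      then obtain t where t: "t \<in> T i" "adj t w" using cov[OF i(1)] by blast
      have wB: "\<forall>i'. i < i' \<longrightarrow> i' < s \<longrightarrow> w \<notin> dominated X (cn (insert (z i') (K i')))"
        using w(2) unfolding B_def by auto
      show ?thesis
      proof (intro exI[of _ "z(i := t)"] allI impI)
        fix l assume l: "s - Suc j \<le> l" "l < s"
        show "(z(i := t)) l \<in> T l \<and> (\<exists>w\<in>W (e l). adj ((z(i := t)) l) w \<and>
          (\<forall>i'. l < i' \<longrightarrow> i' < s \<longrightarrow> w \<notin> dominated X (cn (insert ((z(i := t)) i') (K i')))))"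
        proof (cases "l = i")
          case True
          then show ?thesis using t w(1) wB by (intro conjI bexI[of _ w]) auto
        next
          case False
          then have il: "s - j \<le> l" "i < l" using l i by (auto simp: i_def)
          obtain w where "z l \<in> T l" "w \<in> W (e l)" "adj (z l) w"
            "\<forall>i'. l < i' \<longrightarrow> i' < s \<longrightarrow> w \<notin> dominated X (cn (insert (z i') (K i')))"
            using z[rule_format, OF il(1) l(2)] by blast
          then show ?thesis using il(2) by (intro conjI bexI[of _ w]) auto
        qed
      qed
    qed
  qed
  from this[of s] obtain z where z: "\<forall>i<s. z i \<in> T i \<and> (\<exists>w\<in>W (e i). adj (z i) w \<and>
      (\<forall>i'. i < i' \<longrightarrow> i' < s \<longrightarrow> w \<notin> dominated X (cn (insert (z i') (K i')))))" by auto
  have zT: "z i \<in> T i" "z i \<in> Cs i" "z i \<in> cn (K i)" "z i \<in> Cs 0" "z i \<in> X" if "i < s" for i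
  proof -
    show zi: "z i \<in> T i" using z that by simp
    show "z i \<in> cn (K i)" using zi st(5)[OF that] by (rule rev_subsetD)
    show zC: "z i \<in> Cs i" using zi st(4)[OF that] by (rule rev_subsetD)
    show "z i \<in> Cs 0" using zC Cs0[OF less_imp_le[OF that]] by (rule rev_subsetD)
    show "z i \<in> X" using zC CsX[OF less_imp_le[OF that]] by (rule rev_subsetD)
  qed
  have zz: "z i \<noteq> z j" "\<not> adj (z i) (z j)" "\<not> adj (z j) (z i)" if ij: "i < j" "j < s" for i j
  proof -
    have i: "i < s" using ij by simp
    obtain w where w: "w \<in> W (e i)" "adj (z i) w" "w \<notin> dominated X (cn (insert (z j) (K j)))"
      using z i ij by blast
    have wC: "w \<in> Cs s" using w(1) W e[OF i] by blast
    have "z i \<in> cn (K j)" using focus[OF wC ij(2) order_refl _ zT(1)[OF i] w(2)] ij(1) by simp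
    moreover have "z i \<notin> cn (insert (z j) (K j))"
      using w(2,3) wC CsX[of s] zT(5)[OF i] unfolding dominated_def by auto
    ultimately show n: "\<not> adj (z j) (z i)" unfolding cn_def by auto
    then show "\<not> adj (z i) (z j)" using adj_sym by blast
    \<comment> \<open>A member of \<open>K i\<close> sees \<open>z i\<close> but nothing in the
      later sets of the tower, which tells \<open>z i\<close> from \<open>z j\<close>.\<close>
    obtain y where y: "y \<in> K i" using Kne[OF i] by blast
    have "\<not> adj y (z j)" using away(2)[OF zT(2)[OF ij(2)] ij(1) _ y] ij by simp
    moreover have "adj y (z i)" using zT(3)[OF i] y unfolding cn_def by simp
    ultimately show "z i \<noteq> z j" by metis
  qed
  have \<phi>z: "\<phi> v \<noteq> z i" if vi: "v \<in> V" "i < s" for v i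
  proof -
    obtain y where y: "y \<in> K i" using Kne[OF vi(2)] by blast
    have "\<phi> v \<in> Cs s" using \<phi>(2) vi(1) by blast
    then have "\<not> adj y (\<phi> v)" using away(2)[OF _ vi(2) order_refl y] by simp
    moreover have "adj y (z i)" using zT(3)[OF vi(2)] y unfolding cn_def by simp
    ultimately show ?thesis by metis
  qed
  have adj\<phi>z: "adj (\<phi> v) (z (pos a)) \<longleftrightarrow> v \<in> P a" if va: "v \<in> V" "a \<in> A" for v a
  proof -
    have p: "pos a < s" "e (pos a) = a" using ep va(2) by auto
    then obtain w where w: "w \<in> W a" "adj (z (pos a)) w" using z by metis
    have lf: "leaf V \<phi> (P a) (Ts @ map T [0..<s]) (W a)" using W va(2) by simp
    have Tp: "T (pos a) \<in> set (Ts @ map T [0..<s])" using p(1) by simp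
    show ?thesis by (rule leafD(3)[OF lf w(1) va(1) Tp zT(1)[OF p(1)] w(2)])
  qed
  define Z where "Z = \<phi> ` V \<union> z ` {..<s}"
  have ZC: "Z \<subseteq> Cs 0" using \<phi>(2) Cs0[of s] zT(4) by (auto simp: Z_def)
  have cZ: "card Z \<le> card V + s"
  proof -
    have "card Z \<le> card (\<phi> ` V) + card (z ` {..<s})" unfolding Z_def by (rule card_Un_le)
    then show ?thesis using card_image_le[OF V, of \<phi>] card_image_le[of "{..<s}" z] by simp
  qed
  define B where "B = (\<Union>i<s. dominated X (cn (insert (z i) (K i))))"
  have cB: "chi B \<le> s * D0" unfolding B_def using zT(1) by (intro union) auto
  have fB: "finite B" unfolding B_def dominated_def using fX by auto
  have nB: "\<not> adj (z i) t" if "w \<in> Cs 0" "w \<notin> B" "t \<in> X" "adj t w" "t \<in> cn (K i)" "i < s" for w t i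
  proof -
    have "w \<notin> dominated X (cn (insert (z i) (K i)))" using that(2,6) unfolding B_def by blast
    then have "t \<notin> cn (insert (z i) (K i))" using that X(2) unfolding dominated_def by blast
    then show ?thesis using that(5) unfolding cn_def by auto
  qed
  \<comment> \<open>Trimming removes the chosen vertices, their neighbourhoods and \<open>B\<close>.
    If a cover vertex seen from a trimmed vertex is focused on \<open>K i\<close>, it then does not
    see \<open>z i\<close>.\<close>
  define trim where "trim R = {w \<in> R. \<forall>x\<in>Z. x \<noteq> w \<and> \<not> adj x w} - B" for R
  have trim: "D \<le> chi (trim R)" if "R \<subseteq> Cs 0" "G \<le> chi R" for R
  proof -
    have fR: "finite R" using that(1) X(2) fX by (meson finite_subset)
    have "chi R \<le> chi {w \<in> R. \<forall>x\<in>Z. x \<noteq> w \<and> \<not> adj x w} + card Z * (d + 1)"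
      by (rule chi_shave[OF C0 that(1) ZC])
    moreover have "chi {w \<in> R. \<forall>x\<in>Z. x \<noteq> w \<and> \<not> adj x w} \<le> chi (trim R) + chi B"
      unfolding trim_def using fR fB by (intro chi_diff) auto
    moreover have "card Z * (d + 1) \<le> (card V + s) * (d + 1)" using cZ by (rule mult_le_mono1)
    ultimately show ?thesis using that(2) cB G by linarith
  qed
  have trimR: "trim R \<subseteq> R" for R by (auto simp: trim_def)
  have trimZ: "x \<noteq> w" "\<not> adj x w" "w \<notin> B" if "w \<in> trim R" "x \<in> Z" for w R x
    using that by (auto simp: trim_def)
  have "\<forall>a\<in>A. \<exists>R\<subseteq>Cs (pos a). G \<le> chi R \<and> (\<forall>w\<in>R. \<forall>V\<in>set Ts. \<forall>t\<in>V. adj t w \<longrightarrow> adj (z (pos a)) t)"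
    using st(9) zT(1) ep(2) by simp
  then obtain R where R: "\<forall>a\<in>A. R a \<subseteq> Cs (pos a) \<and> G \<le> chi (R a) \<and>
     (\<forall>w\<in>R a. \<forall>V\<in>set Ts. \<forall>t\<in>V. adj t w \<longrightarrow> adj (z (pos a)) t)"
    by (elim bchoice[THEN exE]) (rule that)
  define \<theta> where "\<theta> x = (case x of Inl v \<Rightarrow> \<phi> v | Inr a \<Rightarrow> z (pos a))" for x
  define W' where "W' x = trim (case x of Inl a \<Rightarrow> W a | Inr a \<Rightarrow> R a)" for x
  have \<theta>: "\<theta> (Inl v) = \<phi> v" "\<theta> (Inr a) = z (pos a)" for v a by (auto simp: \<theta>_def)
  have W': "W' (Inl a) = trim (W a)" "W' (Inr a) = trim (R a)" for a by (auto simp: W'_def)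
  have \<theta>Z: "\<theta> x \<in> Z" if "x \<in> V <+> A" for x using that ep(2) by (auto simp: \<theta>_def Z_def)
  have pab: "pos a < pos b \<or> pos b < pos a" if "a \<in> A" "b \<in> A" "a \<noteq> b" for a b
    using that ep(1) by (metis linorder_neqE_nat)
  have zab: "z (pos a) \<noteq> z (pos b)" "\<not> adj (z (pos a)) (z (pos b))" if "a \<in> A" "b \<in> A" "a \<noteq> b" for a b
    using pab[OF that] zz[of "pos a" "pos b"] zz[of "pos b" "pos a"] ep(2) that by auto
  show ?thesis unfolding hosts_def
  proof (intro exI[of _ \<theta>] exI[of _ W'] conjI ballI)
    show "inj_on \<theta> (V <+> A)"
    proof (rule inj_onI)
      fix x y assume "x \<in> V <+> A" "y \<in> V <+> A" "\<theta> x = \<theta> y"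
      then show "x = y"
        using \<phi>(1) zab(1) \<phi>z[OF _ ep(2)] \<phi>z[OF _ ep(2), symmetric]
        by (elim PlusE) (auto simp: \<theta>_def inj_on_def)
    qed
    show "\<theta> ` (V <+> A) \<subseteq> Cs 0" using \<theta>Z ZC by blast
  next
    fix x y assume x: "x \<in> V <+> A" and y: "y \<in> V <+> A"
    have sym: "adj (z (pos a)) (\<phi> v) \<longleftrightarrow> v \<in> P a" if "v \<in> V" "a \<in> A" for v a
      using adj\<phi>z[OF that] adj_sym by metis
    have "\<not> adj (z (pos a)) (z (pos b))" if "a \<in> A" "b \<in> A" for a b
      using zab(2)[OF that] adj_irr by metis
    then show "adj (\<theta> x) (\<theta> y) \<longleftrightarrow> dup_adj E P x y"
      using x y by (elim PlusE) (auto simp: \<theta> dup_adj_def \<phi>(3) sym adj\<phi>z)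
  next
    fix x assume x: "x \<in> A <+> A"
    then show "W' x \<subseteq> Cs 0"
    proof (elim PlusE)
      fix a assume a: "x = Inl a" "a \<in> A"
      then have "W a \<subseteq> Cs 0" using W Cs0[of s] by blast
      then show ?thesis using trimR a(1) W' by (metis subset_trans)
    next
      fix a assume a: "x = Inr a" "a \<in> A"
      then have "R a \<subseteq> Cs 0" using R Cs0[of "pos a"] ep(2)[of a] by fastforce
      then show ?thesis using trimR a(1) W' by (metis subset_trans)
    qed
    from x show "D \<le> chi (W' x)"
    proof (elim PlusE)
      fix a assume a: "x = Inl a" "a \<in> A"
      then have "W a \<subseteq> Cs 0" "G \<le> chi (W a)" using W Cs0[of s] by blast+
      then show ?thesis using trim a(1) W' by simp
    next
      fix a assume a: "x = Inr a" "a \<in> A"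
      then have "R a \<subseteq> Cs 0" "G \<le> chi (R a)" using R Cs0[of "pos a"] ep(2)[of a] by fastforce+
      then show ?thesis using trim a(1) W' by simp
    qed
    show "leaf (V <+> A) \<theta> (dup_nbrs P x) Ts (W' x)"
      unfolding leaf_def
    proof (intro ballI conjI impI)
      fix w y assume w: "w \<in> W' x" and y: "y \<in> V <+> A"
      show "\<theta> y \<noteq> w" "\<not> adj (\<theta> y) w"
        using trimZ(1,2)[OF _ \<theta>Z[OF y]] w unfolding W'_def by blast+
    next
      fix w T' t y assume w: "w \<in> W' x" and T': "T' \<in> set Ts" "t \<in> T'" "adj t w" and y: "y \<in> V <+> A"
      have tX: "t \<in> X" using X(3)[OF T'(1)] T'(2) by blast
      have wB: "w \<notin> B" using w unfolding W'_def trim_def by blast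
      have T'u: "T' \<in> set Ts \<union> T ` {..<i}" for i using T'(1) by simp
      from x show "adj (\<theta> y) t \<longleftrightarrow> y \<in> dup_nbrs P x"
      proof (elim PlusE)
        fix a assume a: "x = Inl a" "a \<in> A"
        have wW: "w \<in> W a" using w a(1) W'(1) trimR by blast
        then have wC: "w \<in> Cs s" using W a(2) by blast
        then have wC0: "w \<in> Cs 0" using Cs0[of s] by blast
        have lf: "leaf V \<phi> (P a) (Ts @ map T [0..<s]) (W a)" using W a(2) by simp
        from y show ?thesis
        proof (elim PlusE)
          fix v assume v: "y = Inl v" "v \<in> V"
          have "adj (\<phi> v) t \<longleftrightarrow> v \<in> P a" by (rule leafD(3)[OF lf wW v(2) _ T'(2,3)]) (use T'(1) in simp)
          then show ?thesis using v a by (auto simp: \<theta> dup_nbrs_def)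
        next
          fix b assume b: "y = Inr b" "b \<in> A"
          have "t \<in> cn (K (pos b))" by (rule focus[OF wC ep(2)[OF b(2)] order_refl T'u T'(2,3)])
          then have "\<not> adj (z (pos b)) t" using nB[OF wC0 wB tX T'(3) _ ep(2)[OF b(2)]] by simp
          then show ?thesis using a b by (auto simp: \<theta> dup_nbrs_def)
        qed
      next
        fix a assume a: "x = Inr a" "a \<in> A"
        have p: "pos a < s" using ep(2) a(2) by simp
        have wR: "w \<in> R a" using w a(1) W'(2) trimR by blast
        then have wC: "w \<in> Cs (pos a)" using R a(2) by blast
        then have wC0: "w \<in> Cs 0" using Cs0[of "pos a"] p by auto
        have za: "adj (z (pos a)) t" using R a(2) wR T' by blast
        \<comment> \<open>The reserve forces \<open>t\<close> to see \<open>z (pos a)\<close>, so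
          \<open>t\<close> is not focused on \<open>K (pos a)\<close>. Every vertex of
          \<open>Ts\<close> seen from later sets of the tower is, which rules out
          \<open>\<phi> v\<close> and the later \<open>z\<close>; for earlier stages,
          \<open>w\<close> itself lies beyond them and is outside \<open>B\<close>.\<close>
        have tK: "t \<notin> cn (K (pos a))" using nB[OF wC0 wB tX T'(3) _ p] za by blast
        from y show ?thesis
        proof (elim PlusE)
          fix v assume v: "y = Inl v" "v \<in> V"
          have "\<not> adj (\<phi> v) t"
          proof
            assume "adj (\<phi> v) t"
            then have tv: "adj t (\<phi> v)" by (rule adj_sym)
            have "\<phi> v \<in> Cs s" using \<phi>(2) v(2) by blast
            then have "t \<in> cn (K (pos a))" by (rule focus[OF _ p order_refl T'u T'(2) tv])
            then show False using tK by simp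
          qed
          then show ?thesis using v a by (auto simp: \<theta> dup_nbrs_def)
        next
          fix b assume b: "y = Inr b" "b \<in> A"
          have q: "pos b < s" using ep(2) b(2) by simp
          show ?thesis
          proof (cases "a = b")
            case True
            then show ?thesis using za a b by (auto simp: \<theta> dup_nbrs_def)
          next
            case False
            have "\<not> adj (z (pos b)) t"
            proof (cases "pos b < pos a")
              case True
              have "t \<in> cn (K (pos b))" by (rule focus[OF wC True _ T'u T'(2,3)]) (use p in simp)
              then show ?thesis using nB[OF wC0 wB tX T'(3) _ q] by simp
            next
              case False
              then have ab: "pos a < pos b" using pab[OF a(2) b(2) \<open>a \<noteq> b\<close>] by simp
              show ?thesis
              proof
                assume "adj (z (pos b)) t"
                then have tv: "adj t (z (pos b))" by (rule adj_sym)
                have "t \<in> cn (K (pos a))" by (rule focus[OF zT(2)[OF q] ab _ T'u T'(2) tv]) (use q in simp)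
                then show False using tK by simp
              qed
            qed
            then show ?thesis using False a b by (auto simp: \<theta> dup_nbrs_def)
          qed
        qed
      qed
    qed
  qed
qed

text \<open>If no threshold worked, the failing states would form a family again, rich as a subset
  of \<open>S\<close>. A tower over this family has a failing state at its bottom, yet hosting the
  given pattern at its top yields the doubled one at the bottom.\<close>

lemma hosted_dup:
  assumes M: "hosted V E A P" and fin: "finite V" "finite A"
  shows "hosted (V <+> A) (dup_adj E P) (A <+> A) (dup_nbrs P)"
  unfolding hosted_def
proof (intro allI impI, rule ccontr)
  fix m S D
  assume S: "family m S" "rich S"
    and neg: "\<not> (\<exists>c. \<forall>Ts C. (Ts, C) \<in> S \<longrightarrow> c \<le> chi C \<longrightarrow>
      hosts (V <+> A) (dup_adj E P) (A <+> A) (dup_nbrs P) D Ts C)"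
  define s where "s = card A"
  define G where "G = Suc (D + (card V + s) * (d + 1) + s * D0)"
  define bad where "bad Ts C \<longleftrightarrow> \<not> hosts (V <+> A) (dup_adj E P) (A <+> A) (dup_nbrs P) D Ts C" for Ts C
  define S1 where "S1 = {(Ts, C). (Ts, C) \<in> S \<and> bad Ts C}"
  have S1: "(Ts, C) \<in> S1 \<longleftrightarrow> (Ts, C) \<in> S \<and> bad Ts C" for Ts C by (simp add: S1_def)
  have fam1: "family m S1" unfolding family_def
  proof (intro conjI allI impI)
    show "state m Ts C" if "(Ts, C) \<in> S1" for Ts C using family_D(1)[OF S(1)] that S1 by simp
    show "(Ts, C') \<in> S1" if "(Ts, C) \<in> S1" "C' \<subseteq> C" for Ts C C'
    proof -
      have "bad Ts C'" using that(1) S1 hosts_mono that(2) unfolding bad_def by metis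
      moreover have "(Ts, C') \<in> S" using family_D(2)[OF S(1) _ that(2)] that(1) S1 by simp
      ultimately show ?thesis using S1 by simp
    qed
    show "\<exists>Ts C. (Ts, C) \<in> S1 \<and> n \<le> chi C" for n
    proof (rule ccontr)
      assume "\<not> ?thesis"
      then have "\<forall>Ts C. (Ts, C) \<in> S \<longrightarrow> n \<le> chi C \<longrightarrow>
          hosts (V <+> A) (dup_adj E P) (A <+> A) (dup_nbrs P) D Ts C"
        using S1 unfolding bad_def by auto
      from notE[OF neg exI[of _ n], OF this] show False .
    qed
  qed
  have "rich S1" by (rule rich_subset[OF S(2)]) (auto simp: S1)
  from tower_extension[OF fam1 this, of s G] obtain S2 where S2: "family (m + s) S2" "rich S2"
    and tow: "\<forall>Us C. (Us, C) \<in> S2 \<longrightarrow>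
      (\<exists>Ts T K Cs. Us = Ts @ map T [0..<s] \<and> (Ts, Cs 0) \<in> S1 \<and> Cs s = C \<and> tower G s Ts T K Cs)"
    by (elim exE conjE) (rule that)
  obtain c where c: "\<forall>Ts C. (Ts, C) \<in> S2 \<longrightarrow> c \<le> chi C \<longrightarrow> hosts V E A P G Ts C"
    using hostedD[where D = G, OF M S2] by (elim exE) (rule that)
  obtain Us C where Us: "(Us, C) \<in> S2" "c \<le> chi C" using family_D(3)[OF S2(1)] by blast
  obtain Ts T K Cs where t: "Us = Ts @ map T [0..<s]" "(Ts, Cs 0) \<in> S1" "Cs s = C" "tower G s Ts T K Cs"
    using tow[rule_format, OF Us(1)] by (elim exE conjE) (rule that)
  obtain X where X: "X \<in> U" "Cs 0 \<subseteq> X"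
    "\<forall>T\<in>set Ts. T \<subseteq> X \<and> stable T \<and> (\<forall>w\<in>Cs 0. \<exists>t\<in>T. adj t w)"
    using family_D(1)[OF fam1 t(2)] unfolding state_def by (elim conjE bexE) (rule that)
  have cov: "\<exists>t\<in>T i. adj t w" if "i < s" "w \<in> Cs s" for i w
  proof -
    have Ti: "T i \<in> set Us" using t(1) that(1) by simp
    have "\<forall>V\<in>set Us. \<forall>w\<in>C. \<exists>t\<in>V. adj t w"
      using family_D(1)[OF S2(1) Us(1)] unfolding state_def by auto
    from bspec[OF bspec[OF this Ti]] show ?thesis using that(2) t(3) by simp
  qed
  obtain pos where pos: "bij_betw pos A {..<s}"
    using ex_bij_betw_finite_nat[OF fin(2)] unfolding s_def atLeast0LessThan by blast
  have hst: "hosts V E A P G (Ts @ map T [0..<s]) (Cs s)" using c Us t(1,3) by simp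
  have "hosts (V <+> A) (dup_adj E P) (A <+> A) (dup_nbrs P) D Ts (Cs 0)"
    by (rule tower_hosts_dup[OF X(1,2) _ t(4) pos cov G_def fin(1) hst]) (use X(3) in auto)
  then show False using t(2) S1 unfolding bad_def by simp
qed

end

section \<open>Burling graphs\<close>

lemma doubleton_image_iff:
  assumes "inj f"
  shows "{x, y} = f ` e \<longleftrightarrow> (\<exists>u v. x = f u \<and> y = f v \<and> e = {u, v})"
proof
  assume eq: "{x, y} = f ` e"
  then obtain u v where uv: "u \<in> e" "x = f u" "v \<in> e" "y = f v"
    by (metis imageE insertI1 insertI2)
  have "f ` e = f ` {u, v}" using eq uv by simp
  then have "e = {u, v}" by (rule inj_image_eq_iff[OF assms, THEN iffD1])
  then show "\<exists>u v. x = f u \<and> y = f v \<and> e = {u, v}" using uv by blast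
qed auto

lemma burling_step_verts:
  "verts (graph (burling_step M)) = Old ` (verts (graph M) - marked M) \<union>
     (\<Union>a\<in>marked M. Copy a ` verts (graph M) \<union> NewB a ` marked M \<union> NewC a ` marked M)"
  unfolding burling_step_def Let_def by auto

lemma burling_step_marked:
  "marked (burling_step M) = (\<Union>a\<in>marked M. Copy a ` marked M \<union> NewC a ` marked M)"
  unfolding burling_step_def Let_def by simp

lemma burling_step_edges:
  "{x, y} \<in> edges (graph (burling_step M)) \<longleftrightarrow>
     (\<exists>u v. x = Old u \<and> y = Old v \<and> {u, v} \<in> edges (graph M) \<and> {u, v} \<subseteq> verts (graph M) - marked M) \<or>
     (\<exists>a\<in>marked M. \<exists>u v. x = Copy a u \<and> y = Copy a v \<and> {u, v} \<in> edges (graph M)) \<or>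
     (\<exists>a\<in>marked M. \<exists>v\<in>marked M. (\<exists>u\<in>nbrs (graph M) v. {x, y} = {Copy a u, NewB a v}) \<or>
        {x, y} = {NewB a v, NewC a v} \<or>
        (\<exists>u\<in>nbrs (graph M) a. {x, y} = {Old u, Copy a v} \<or> {x, y} = {Old u, NewC a v}))"
proof -
  have inj: "inj Old" "inj (Copy a)" for a by (auto simp: inj_on_def)
  have 1: "{x, y} \<in> (`) Old ` {e \<in> edges (graph M). e \<subseteq> verts (graph M) - marked M} \<longleftrightarrow>
     (\<exists>u v. x = Old u \<and> y = Old v \<and> {u, v} \<in> edges (graph M) \<and> {u, v} \<subseteq> verts (graph M) - marked M)"
    unfolding image_iff doubleton_image_iff[OF inj(1)] by blast
  have 2: "{x, y} \<in> (`) (Copy a) ` edges (graph M) \<longleftrightarrow>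
     (\<exists>u v. x = Copy a u \<and> y = Copy a v \<and> {u, v} \<in> edges (graph M))" for a
    unfolding image_iff doubleton_image_iff[OF inj(2)] by blast
  have 3: "{x, y} \<in> join_edges (Copy a ` nbrs (graph M) v) {NewB a v} \<longleftrightarrow>
     (\<exists>u\<in>nbrs (graph M) v. {x, y} = {Copy a u, NewB a v})" for a v
    unfolding join_edges_def by auto
  have 4: "{x, y} \<in> join_edges (Old ` nbrs (graph M) a) {Copy a v, NewC a v} \<longleftrightarrow>
     (\<exists>u\<in>nbrs (graph M) a. {x, y} = {Old u, Copy a v} \<or> {x, y} = {Old u, NewC a v})" for a v
    unfolding join_edges_def by auto
  show ?thesis
    unfolding burling_step_def Let_def
    by (simp only: marked_graph.simps ugraph.simps Un_iff UN_iff 1 2 3 4 insert_iff empty_iff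
        bex_disj_distrib disj_assoc simp_thms)
qed

text \<open>Distinct neighbourhoods of marked vertices supply the injectivity that grafting
  requires; independence of the marked set places these neighbourhoods in the unmarked part, which
  is the vertex set of the pattern.\<close>

definition tidy :: "'b marked_graph \<Rightarrow> bool" where
  "tidy M \<longleftrightarrow> finite (verts (graph M)) \<and> marked M \<subseteq> verts (graph M) \<and> marked M \<noteq> {} \<and>
     (\<forall>e\<in>edges (graph M). e \<subseteq> verts (graph M)) \<and>
     (\<forall>a\<in>marked M. nbrs (graph M) a \<inter> marked M = {}) \<and> inj_on (nbrs (graph M)) (marked M)"

lemma tidyD:
  assumes "tidy M"
  shows "finite (verts (graph M))" "finite (marked M)" "marked M \<subseteq> verts (graph M)" "marked M \<noteq> {}"
    "{u, v} \<in> edges (graph M) \<Longrightarrow> u \<in> verts (graph M) \<and> v \<in> verts (graph M)"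
    "a \<in> marked M \<Longrightarrow> nbrs (graph M) a \<subseteq> verts (graph M) - marked M"
    "a \<in> marked M \<Longrightarrow> b \<in> marked M \<Longrightarrow> nbrs (graph M) a = nbrs (graph M) b \<Longrightarrow> a = b"
proof -
  show e: "{u, v} \<in> edges (graph M) \<Longrightarrow> u \<in> verts (graph M) \<and> v \<in> verts (graph M)" for u v
    using assms unfolding tidy_def by auto
  show "nbrs (graph M) a \<subseteq> verts (graph M) - marked M" if "a \<in> marked M"
    using assms e that unfolding tidy_def nbrs_def by auto
qed (use assms finite_subset in \<open>auto simp: tidy_def inj_on_def\<close>)

lemma nbrs_burling_step:
  assumes "tidy M" "a \<in> marked M" "v \<in> marked M"
  shows "nbrs (graph (burling_step M)) (Copy a v) = Copy a ` nbrs (graph M) v \<union> Old ` nbrs (graph M) a"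
    and "nbrs (graph (burling_step M)) (NewC a v) = insert (NewB a v) (Old ` nbrs (graph M) a)"
proof -
  show "nbrs (graph (burling_step M)) (Copy a v) = Copy a ` nbrs (graph M) v \<union> Old ` nbrs (graph M) a"
  proof (rule set_eqI)
    fix x
    have "v \<notin> nbrs (graph M) v'" if "v' \<in> marked M" for v' using tidyD(6)[OF assms(1) that] assms(3) by auto
    then show "x \<in> nbrs (graph (burling_step M)) (Copy a v) \<longleftrightarrow>
        x \<in> Copy a ` nbrs (graph M) v \<union> Old ` nbrs (graph M) a"
      using assms(2,3) unfolding nbrs_def mem_Collect_eq burling_step_edges
      by (auto simp: doubleton_eq_iff nbrs_def)
  qed
  show "nbrs (graph (burling_step M)) (NewC a v) = insert (NewB a v) (Old ` nbrs (graph M) a)"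
    by (rule set_eqI) (use assms(2,3) in \<open>auto simp: nbrs_def burling_step_edges doubleton_eq_iff\<close>)
qed

text \<open>New marked vertices are told apart in three steps: the \<open>Old\<close> part of a
  neighbourhood determines \<open>a\<close>, a \<open>NewB\<close> neighbour identifies a vertex
  \<open>NewC\<close>, and among copies the \<open>Copy\<close> part determines
  \<open>v\<close>.\<close>

lemma tidy_burling_step:
  assumes t: "tidy M"
  shows "tidy (burling_step M)"
  unfolding tidy_def
proof (intro conjI ballI)
  show "finite (verts (graph (burling_step M)))"
    using tidyD(1,2)[OF t] by (auto simp: burling_step_verts)
  show "marked (burling_step M) \<subseteq> verts (graph (burling_step M))" "marked (burling_step M) \<noteq> {}"
    using tidyD(3,4)[OF t] by (auto simp: burling_step_verts burling_step_marked)
next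
  fix e assume e: "e \<in> edges (graph (burling_step M))"
  have "nbrs (graph M) a \<subseteq> verts (graph M) - marked M" if "a \<in> marked M" for a by (rule tidyD(6)[OF t that])
  moreover have "c \<subseteq> verts (graph M)" if "c \<in> edges (graph M)" for c using t that by (simp add: tidy_def)
  ultimately show "e \<subseteq> verts (graph (burling_step M))"
    using e tidyD(3)[OF t] unfolding burling_step_verts
    by (auto simp: burling_step_def Let_def join_edges_def; blast)
next
  fix x assume "x \<in> marked (burling_step M)"
  then obtain a v where "a \<in> marked M" "v \<in> marked M" "x = Copy a v \<or> x = NewC a v"
    unfolding burling_step_marked by blast
  then show "nbrs (graph (burling_step M)) x \<inter> marked (burling_step M) = {}"
    using nbrs_burling_step[OF t] tidyD(6)[OF t] unfolding burling_step_marked by fastforce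
next
  show "inj_on (nbrs (graph (burling_step M))) (marked (burling_step M))"
  proof (rule inj_onI)
    fix x y assume x: "x \<in> marked (burling_step M)" and y: "y \<in> marked (burling_step M)"
      and eq: "nbrs (graph (burling_step M)) x = nbrs (graph (burling_step M)) y"
    obtain a v where a: "a \<in> marked M" "v \<in> marked M" "x = Copy a v \<or> x = NewC a v"
      using x unfolding burling_step_marked by blast
    obtain b u where b: "b \<in> marked M" "u \<in> marked M" "y = Copy b u \<or> y = NewC b u"
      using y unfolding burling_step_marked by blast
    have O: "Old z \<in> nbrs (graph (burling_step M)) x \<longleftrightarrow> z \<in> nbrs (graph M) a"
      "Old z \<in> nbrs (graph (burling_step M)) y \<longleftrightarrow> z \<in> nbrs (graph M) b" for z
      using a b nbrs_burling_step[OF t a(1,2)] nbrs_burling_step[OF t b(1,2)] by auto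
    then have "nbrs (graph M) a = nbrs (graph M) b" using eq by blast
    then have ab: "a = b" using tidyD(7)[OF t a(1) b(1)] by simp
    have B: "NewB a z \<in> nbrs (graph (burling_step M)) x \<longleftrightarrow> x = NewC a z"
      "NewB a z \<in> nbrs (graph (burling_step M)) y \<longleftrightarrow> y = NewC a z" for z
      using a b ab nbrs_burling_step[OF t a(1,2)] nbrs_burling_step[OF t b(1,2)] by auto
    show "x = y"
    proof (cases "x = NewC a v \<or> y = NewC b u")
      case True
      moreover have "x = NewC a z \<longleftrightarrow> y = NewC a z" for z using B[of z] eq by simp
      ultimately show ?thesis using ab by metis
    next
      case False
      then have xy: "x = Copy a v" "y = Copy a u" using a(3) b(3) ab by auto
      have "Copy a z \<in> nbrs (graph (burling_step M)) x \<longleftrightarrow> z \<in> nbrs (graph M) v"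
        "Copy a z \<in> nbrs (graph (burling_step M)) y \<longleftrightarrow> z \<in> nbrs (graph M) u" for z
        using xy nbrs_burling_step[OF t a(1,2)] nbrs_burling_step[OF t b(1,2)] ab by auto
      then have "nbrs (graph M) v = nbrs (graph M) u" using eq by blast
      then show ?thesis using xy tidyD(7)[OF t a(2) b(2)] by simp
    qed
  qed
qed

lemma tidy_burling: "tidy (burling (Suc (Suc k)))"
proof (induction k)
  case 0
  show ?case unfolding tidy_def by (auto simp: nbrs_def doubleton_eq_iff)
next
  case (Suc k)
  then show ?case using tidy_burling_step by simp
qed

text \<open>Only finitely many Burling graphs fit into a finite graph, so the maximum in
  \<open>burling_number\<close> is taken over a finite set.\<close>

lemma card_burling: "k \<le> card (verts (graph (burling k)))"
proof -
  have 2: "Suc (Suc k) \<le> card (verts (graph (burling (Suc (Suc k)))))" for k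
  proof (induction k)
    case 0
    show ?case by simp
  next
    case (Suc k)
    let ?M = "burling (Suc (Suc k))"
    have t: "tidy ?M" by (rule tidy_burling)
    obtain a where a: "a \<in> marked ?M" using tidyD(4)[OF t] by blast
    have "Suc (card (verts (graph ?M))) = card (insert (NewB a a) (Copy a ` verts (graph ?M)))"
      using tidyD(1)[OF t] by (subst card_insert_disjoint) (auto simp: card_image inj_on_def)
    also have "\<dots> \<le> card (verts (graph (burling_step ?M)))"
      using tidyD(1)[OF tidy_burling_step[OF t]] a
      by (intro card_mono) (auto simp: burling_step_verts)
    finally show ?case using Suc by simp
  qed
  show ?thesis
  proof (cases k)
    case (Suc j)
    then show ?thesis using 2 by (cases j) auto
  qed simp
qed

context arena
begin

abbreviation hosted_marked :: "'b marked_graph \<Rightarrow> bool" where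
  "hosted_marked M \<equiv> hosted (verts (graph M) - marked M) (\<lambda>u v. {u, v} \<in> edges (graph M))
     (marked M) (nbrs (graph M))"

text \<open>The step is the doubled pattern grafted at every marked vertex of the original one:
  \<open>Copy a v\<close> and \<open>NewC a v\<close> are the two leaves belonging to
  \<open>v\<close> in the copy at \<open>a\<close>, and \<open>NewB a v\<close> is the vertex added
  by doubling.\<close>

lemma hosted_burling_step:
  assumes t: "tidy M" and M: "hosted_marked M"
  shows "hosted_marked (burling_step M)"
proof -
  \<comment> \<open>Only unmarked vertices of the new graph matter, and none of these is a
    \<open>NewC\<close>, \<open>BaseA\<close> or \<open>BaseB\<close>.\<close>
  define f :: "burling_vertex \<Rightarrow> burling_vertex + burling_vertex \<times> (burling_vertex + burling_vertex)" where
    "f x = (case x of Old v \<Rightarrow> Inl v | Copy a v \<Rightarrow> Inr (a, Inl v) | NewB a v \<Rightarrow> Inr (a, Inr v) | _ \<Rightarrow> undefined)" for x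
  define g :: "burling_vertex \<Rightarrow> burling_vertex \<times> (burling_vertex + burling_vertex)" where
    "g x = (case x of Copy a v \<Rightarrow> (a, Inl v) | NewC a v \<Rightarrow> (a, Inr v) | _ \<Rightarrow> undefined)" for x
  let ?V = "verts (graph M) - marked M" and ?E = "\<lambda>u v. {u, v} \<in> edges (graph M)"
  let ?A = "marked M" and ?P = "nbrs (graph M)"
  have inj: "inj_on (\<lambda>a. ?P a \<inter> ?V) ?A"
  proof (rule inj_onI)
    fix a b assume "a \<in> ?A" "b \<in> ?A" "?P a \<inter> ?V = ?P b \<inter> ?V"
    then show "a = b" using tidyD(6)[OF t, of a] tidyD(6)[OF t, of b] tidyD(7)[OF t] by (metis inf.absorb1)
  qed
  have fin: "finite ?V" "finite ?A" using tidyD(1,2)[OF t] by auto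
  have dup: "hosted (?V <+> ?A) (dup_adj ?E ?P) (?A <+> ?A) (dup_nbrs ?P)"
    by (rule hosted_dup[OF M fin])
  have graft: "hosted (?V <+> ?A \<times> (?V <+> ?A)) (graft_adj ?E (dup_adj ?E ?P))
      (?A \<times> (?A <+> ?A)) (graft_nbrs ?P (dup_nbrs ?P))"
    by (rule hosted_graft[OF M dup fin(2) _ inj]) (use fin in auto)
  let ?V' = "verts (graph (burling_step M)) - marked (burling_step M)"
  have V': "x \<in> ?V' \<longleftrightarrow> (\<exists>v\<in>?V. x = Old v) \<or> (\<exists>a\<in>?A. \<exists>v\<in>?V. x = Copy a v) \<or> (\<exists>a\<in>?A. \<exists>v\<in>?A. x = NewB a v)" for x
    unfolding burling_step_verts burling_step_marked by auto
  show ?thesis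
  proof (rule hosted_relabel[OF graft, of f ?V' _ g])
    show "inj_on f ?V'"
    proof (rule inj_onI)
      fix x y assume "x \<in> ?V'" "y \<in> ?V'" "f x = f y"
      then show "x = y" unfolding V' by (elim disjE bexE) (auto simp: f_def)
    qed
    show "f ` ?V' \<subseteq> ?V <+> ?A \<times> (?V <+> ?A)"
    proof
      fix y assume "y \<in> f ` ?V'"
      then obtain x where "x \<in> ?V'" "y = f x" by blast
      then show "y \<in> ?V <+> ?A \<times> (?V <+> ?A)" unfolding V' by (auto simp: f_def)
    qed
    show "g ` marked (burling_step M) \<subseteq> ?A \<times> (?A <+> ?A)"
      unfolding burling_step_marked by (auto simp: g_def)
    show "{x, y} \<in> edges (graph (burling_step M)) \<longleftrightarrow> graft_adj ?E (dup_adj ?E ?P) (f x) (f y)"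
      if "x \<in> ?V'" "y \<in> ?V'" for x y
      using that unfolding V' burling_step_edges
      by (elim disjE bexE) (auto simp: f_def graft_adj_def dup_adj_def doubleton_eq_iff)
    show "x \<in> nbrs (graph (burling_step M)) y \<longleftrightarrow> f x \<in> graft_nbrs ?P (dup_nbrs ?P) (g y)"
      if y: "y \<in> marked (burling_step M)" and x: "x \<in> ?V'" for x y
    proof -
      obtain a v where a: "a \<in> ?A" "v \<in> ?A" "y = Copy a v \<or> y = NewC a v"
        using y unfolding burling_step_marked by blast
      then show ?thesis using x nbrs_burling_step[OF t a(1,2)] unfolding V'
        by (elim disjE bexE) (auto simp: f_def g_def dup_nbrs_def)
    qed
  qed
qed

lemma hosted_burling: "hosted_marked (burling (Suc (Suc k)))"
proof (induction k)
  case 0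
  have "hosted {BaseB} (\<lambda>_ _. False) {BaseA} (\<lambda>_. {BaseB})" by (rule hosted_base)
  then show ?case
    by (rule hosted_relabel[where f = "\<lambda>x. x" and g = "\<lambda>x. x"]) (auto simp: nbrs_def doubleton_eq_iff)
next
  case (Suc k)
  then show ?case using hosted_burling_step[OF tidy_burling] by simp
qed

text \<open>One extension of the family without covers provides a single cover \<open>T\<close>.
  Each leaf is nonempty and sees some vertex of \<open>T\<close>, which becomes the marked vertex;
  stability of \<open>T\<close> makes the marked set independent, and distinct neighbourhoods make
  the choice injective.\<close>

lemma hosted_marked_embeds:
  assumes t: "tidy M" and M: "hosted_marked M"
  shows "\<exists>X\<in>U. \<exists>\<theta>. inj_on \<theta> (verts (graph M)) \<and> \<theta> ` verts (graph M) \<subseteq> X \<and>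
    (\<forall>u\<in>verts (graph M). \<forall>v\<in>verts (graph M). adj (\<theta> u) (\<theta> v) \<longleftrightarrow> {u, v} \<in> edges (graph M))"
proof -
  let ?V = "verts (graph M) - marked M" and ?A = "marked M" and ?P = "nbrs (graph M)"
  from rich_extension[OF base_family base_rich] obtain S where S: "family (Suc 0) S" "rich S"
    and ext: "\<forall>Us C'. (Us, C') \<in> S \<longrightarrow> (\<exists>Ts C K T. Us = Ts @ [T] \<and> (Ts, C) \<in> {[]} \<times> U \<and> extends Ts C K T C')"
    by (elim exE conjE) (rule that)
  obtain c where c: "\<forall>Ts C. (Ts, C) \<in> S \<longrightarrow> c \<le> chi C \<longrightarrow>
      hosts ?V (\<lambda>u v. {u, v} \<in> edges (graph M)) ?A ?P 1 Ts C"
    using hostedD[where D = 1, OF M S] by (elim exE) (rule that)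
  obtain Us C where C: "(Us, C) \<in> S" "c \<le> chi C" using family_D(3)[OF S(1)] by blast
  obtain Ts X K T where e: "Us = Ts @ [T]" "(Ts, X) \<in> {[]} \<times> U" "extends Ts X K T C"
    using ext[rule_format, OF C(1)] by (elim exE conjE) (rule that)
  have X: "X \<in> U" and Us: "Us = [T]" using e by auto
  have x: "card K = h" "T \<subseteq> X \<inter> cn K" "stable T" "C \<subseteq> nest Ts K X" "\<forall>w\<in>C. \<exists>t\<in>T. adj t w"
    using e(3) unfolding extends_def by auto
  obtain \<phi> W where \<phi>: "inj_on \<phi> ?V" "\<phi> ` ?V \<subseteq> C"
      "\<forall>u\<in>?V. \<forall>v\<in>?V. adj (\<phi> u) (\<phi> v) \<longleftrightarrow> {u, v} \<in> edges (graph M)"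
    and W: "\<forall>a\<in>?A. W a \<subseteq> C \<and> 1 \<le> chi (W a) \<and> leaf ?V \<phi> (?P a) Us (W a)"
    using c[rule_format, OF C] unfolding hosts_def by (elim exE conjE) (rule that)
  have "\<exists>t\<in>T. \<forall>v\<in>?V. adj (\<phi> v) t \<longleftrightarrow> v \<in> ?P a" if a: "a \<in> ?A" for a
  proof -
    have Wa: "W a \<subseteq> C" "1 \<le> chi (W a)" "leaf ?V \<phi> (?P a) Us (W a)" using W a by auto
    then have "W a \<noteq> {}" by auto
    then obtain w where w: "w \<in> W a" by blast
    then obtain t where t: "t \<in> T" "adj t w" using x(5) Wa(1) by blast
    have "adj (\<phi> v) t \<longleftrightarrow> v \<in> ?P a" if "v \<in> ?V" for v
      by (rule leafD(3)[OF Wa(3) w that _ t]) (simp add: Us)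
    then show ?thesis using t(1) by (intro bexI[of _ t]) auto
  qed
  then have "\<forall>a\<in>?A. \<exists>t. t \<in> T \<and> (\<forall>v\<in>?V. adj (\<phi> v) t \<longleftrightarrow> v \<in> ?P a)" by blast
  from bchoice[OF this] obtain \<tau> where \<tau>: "\<forall>a\<in>?A. \<tau> a \<in> T \<and> (\<forall>v\<in>?V. adj (\<phi> v) (\<tau> a) \<longleftrightarrow> v \<in> ?P a)"
    by (elim exE) (rule that)
  have \<tau>T: "\<tau> a \<in> T" "\<And>v. v \<in> ?V \<Longrightarrow> adj (\<phi> v) (\<tau> a) \<longleftrightarrow> v \<in> ?P a" if "a \<in> ?A" for a
    using bspec[OF \<tau> that] by auto
  have dis: "\<phi> v \<noteq> \<tau> a" if "v \<in> ?V" "a \<in> ?A" for v a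
  proof -
    have "K \<noteq> {}" using x(1) h_pos by auto
    then obtain y where y: "y \<in> K" by blast
    have "\<phi> v \<in> nest Ts K X" using \<phi>(2) x(4) that(1) by blast
    then have "\<not> adj y (\<phi> v)" using y unfolding nest_def by simp
    moreover have "adj y (\<tau> a)" using \<tau>T(1)[OF that(2)] x(2) y unfolding cn_def by auto
    ultimately show ?thesis by metis
  qed
  have \<tau>inj: "a = b" if "a \<in> ?A" "b \<in> ?A" "\<tau> a = \<tau> b" for a b
  proof -
    have "v \<in> ?P a \<longleftrightarrow> v \<in> ?P b" if "v \<in> ?V" for v
      using \<tau>T(2)[OF \<open>a \<in> ?A\<close> that] \<tau>T(2)[OF \<open>b \<in> ?A\<close> that] \<open>\<tau> a = \<tau> b\<close> by simp
    then have "?P a = ?P b" using tidyD(6)[OF t that(1)] tidyD(6)[OF t that(2)] by blast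
    then show ?thesis using tidyD(7)[OF t] that by blast
  qed
  have \<tau>\<tau>: "\<not> adj (\<tau> a) (\<tau> b)" if "a \<in> ?A" "b \<in> ?A" for a b
    using x(3) \<tau>T(1) that unfolding stable_def by blast
  define \<theta> where "\<theta> v = (if v \<in> ?A then \<tau> v else \<phi> v)" for v
  have "inj_on \<theta> (verts (graph M))"
  proof (rule inj_onI)
    fix u v assume uv: "u \<in> verts (graph M)" "v \<in> verts (graph M)" "\<theta> u = \<theta> v"
    then show "u = v"
      using \<tau>inj[of u v] \<phi>(1) dis[of u v] dis[of v u]
      by (auto simp: \<theta>_def inj_on_def split: if_splits)
  qed
  moreover have "\<theta> ` verts (graph M) \<subseteq> X"
  proof -
    have "T \<subseteq> X" "C \<subseteq> X" using x(2,4) nest_subset by blast+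
    then show ?thesis using \<tau>T(1) \<phi>(2) by (auto simp: \<theta>_def)
  qed
  moreover have "adj (\<theta> u) (\<theta> v) \<longleftrightarrow> {u, v} \<in> edges (graph M)"
    if uv: "u \<in> verts (graph M)" "v \<in> verts (graph M)" for u v
  proof (cases "u \<in> ?A"; cases "v \<in> ?A")
    assume "u \<in> ?A" "v \<in> ?A"
    moreover have "{u, v} \<notin> edges (graph M)"
      using tidyD(6)[OF t \<open>v \<in> ?A\<close>] \<open>u \<in> ?A\<close> unfolding nbrs_def by blast
    ultimately show ?thesis using \<tau>\<tau> by (simp add: \<theta>_def)
  next
    assume a: "u \<in> ?A" "v \<notin> ?A"
    then have "adj (\<phi> v) (\<tau> u) \<longleftrightarrow> {v, u} \<in> edges (graph M)"
      using \<tau>T(2)[OF a(1), of v] uv by (simp add: nbrs_def)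
    then show ?thesis using a adj_sym by (auto simp: \<theta>_def insert_commute)
  next
    assume a: "u \<notin> ?A" "v \<in> ?A"
    then show ?thesis using \<tau>T(2)[OF a(2), of u] uv by (simp add: \<theta>_def nbrs_def)
  next
    assume "u \<notin> ?A" "v \<notin> ?A"
    then show ?thesis using \<phi>(3) uv by (simp add: \<theta>_def)
  qed
  ultimately show ?thesis using X by (intro bexI[of _ X] exI[of _ \<theta>]) auto
qed

end

section \<open>Reduction to radius one and to extremal cliques\<close>

context sgraph
begin

definition bounded_by :: "nat \<Rightarrow> 'v set set \<Rightarrow> bool" where
  "bounded_by s V \<longleftrightarrow> (\<forall>c. \<exists>D. \<forall>X\<in>V. (\<forall>v\<in>X. chi {u \<in> X. near X s v u} \<le> c) \<longrightarrow> chi X \<le> D)"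

definition ample :: "'v set set \<Rightarrow> bool" where
  "ample V \<longleftrightarrow> (\<forall>X\<in>V. finite X) \<and> (\<forall>X\<in>V. \<forall>Y\<subseteq>X. Y \<in> V) \<and> (\<forall>n. \<exists>X\<in>V. n \<le> chi X)"

definition dense :: "nat \<Rightarrow> 'v set set \<Rightarrow> bool" where
  "dense l V \<longleftrightarrow> (\<forall>D. \<exists>c. \<forall>X\<in>V. c \<le> chi X \<longrightarrow>
     (\<exists>K\<subseteq>X. clq K \<and> card K = l \<and> D \<le> chi (dominated X (cn K))))"

lemma ampleD:
  assumes "ample V"
  shows "X \<in> V \<Longrightarrow> finite X" "X \<in> V \<Longrightarrow> Y \<subseteq> X \<Longrightarrow> Y \<in> V" "\<exists>X\<in>V. n \<le> chi X"
  using assms unfolding ample_def by auto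

lemma bounded_by_subset: "bounded_by s V \<Longrightarrow> V' \<subseteq> V \<Longrightarrow> bounded_by s V'"
  unfolding bounded_by_def by (meson subsetD)

lemma dense_subset: "dense l V \<Longrightarrow> V' \<subseteq> V \<Longrightarrow> dense l V'"
  unfolding dense_def by (meson subsetD)

lemma chi_singleton: "chi {v} \<le> 1"
  by (rule chi_le[where c = "\<lambda>_. 0"]) (simp add: proper_def adj_irr)

lemma near_1: "near X (Suc 0) v u \<longleftrightarrow> v \<in> X \<and> u \<in> X \<and> (v = u \<or> adj v u)"
  by auto

text \<open>If radius at most one controlled the chromatic number, the bound
  \<open>\<tau> + 1\<close> on closed neighbourhoods would bound it on all of
  \<open>V\<close>.\<close>

lemma ample_local:
  assumes V: "ample V" and s: "bounded_by s V"
    and loc: "\<And>X v. X \<in> V \<Longrightarrow> v \<in> X \<Longrightarrow> chi {u \<in> X. adj v u} \<le> \<tau>"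
  shows "2 \<le> s"
proof (rule ccontr)
  assume "\<not> 2 \<le> s"
  then have s1: "s \<le> 1" by simp
  obtain D where D: "\<forall>X\<in>V. (\<forall>v\<in>X. chi {u \<in> X. near X s v u} \<le> \<tau> + 1) \<longrightarrow> chi X \<le> D"
    using spec[OF s[unfolded bounded_by_def], of "\<tau> + 1"] by (elim exE) (rule that)
  have "chi X \<le> D" if X: "X \<in> V" for X
  proof (rule D[rule_format, OF X])
    fix v assume v: "v \<in> X"
    have fX: "finite X" by (rule ampleD(1)[OF V X])
    have "{u \<in> X. near X s v u} \<subseteq> {u \<in> X. adj v u} \<union> {v}"
      using near_mono[OF s1, of X v] by (auto simp: near_1)
    then have "chi {u \<in> X. near X s v u} \<le> chi ({u \<in> X. adj v u} \<union> {v})"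
      using fX by (intro chi_mono) auto
    also have "\<dots> \<le> chi {u \<in> X. adj v u} + chi {v}" using fX by (intro chi_Un) auto
    also have "\<dots> \<le> \<tau> + 1" using loc[OF X v] chi_singleton[of v] by linarith
    finally show "chi {u \<in> X. near X s v u} \<le> \<tau> + 1" .
  qed
  moreover obtain X where "X \<in> V" "Suc D \<le> chi X" using ampleD(3)[OF V] by blast
  ultimately show False by fastforce
qed

text \<open>The next root \<open>v\<close> is the centre of a ball of radius \<open>Suc r\<close> in
  the covered set \<open>C\<close> with large chromatic number. Discarding the bounded ball of
  radius \<open>r\<close> leaves vertices reached through neighbours of \<open>v\<close>, a stable
  part of which is the new cover. As \<open>r \<ge> 2\<close>, all of \<open>C\<close> is at
  distance at least 3 from the old roots, so \<open>v\<close> and its cover are not adjacent to old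
  roots, nor \<open>v\<close> to their covers.\<close>

lemma multicovers_of_local_bound:
  assumes V: "ample V" and s: "bounded_by (Suc r) V" and r: "2 \<le> r"
    and world: "\<And>X. X \<in> V \<Longrightarrow> world r d X"
  shows "\<exists>X\<in>V. \<exists>x L C. multicover X r {..<n} x L C \<and> N \<le> chi C"
proof (induction n arbitrary: N)
  case 0
  obtain X where "X \<in> V" "N \<le> chi X" using ampleD(3)[OF V] by blast
  then show ?case by (intro bexI[of _ X] exI[of _ "\<lambda>_. undefined"] exI[of _ "\<lambda>_. {}"] exI[of _ X])
      (auto simp: multicover_def)
next
  case (Suc n)
  \<comment> \<open>The summand \<open>d\<close> pays for the ball of radius \<open>r\<close>, the
    factor \<open>d\<close> in \<open>d * N\<close> for making the new cover stable.\<close>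
  obtain D where D: "\<forall>X\<in>V. (\<forall>v\<in>X. chi {u \<in> X. near X (Suc r) v u} \<le> d * N + d) \<longrightarrow> chi X \<le> D"
    using spec[OF s[unfolded bounded_by_def], of "d * N + d"] by (elim exE) (rule that)
  obtain X x L C where X: "X \<in> V" and mc: "multicover X r {..<n} x L C" and C: "Suc D \<le> chi C"
    using Suc.IH[of "Suc D"] by (elim bexE exE conjE) (rule that)
  have mcD: "C \<subseteq> X" "\<And>i. i < n \<Longrightarrow> x i \<in> X \<and> L i \<subseteq> X \<and> stable (L i) \<and> (\<forall>t\<in>L i. adj (x i) t) \<and>
        C \<subseteq> reach X r (L i) \<and> (\<forall>u\<in>C. \<not> near X r (x i) u)"
    "\<And>i j. i < n \<Longrightarrow> j < n \<Longrightarrow> i \<noteq> j \<Longrightarrow> x i \<noteq> x j \<and> \<not> adj (x i) (x j) \<and> (\<forall>t\<in>L j. \<not> adj (x i) t)"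
    using mc unfolding multicover_def by simp_all
  have fX: "finite X" by (rule ampleD(1)[OF V X])
  have fC: "finite C" using mcD(1) fX by (rule finite_subset)
  have CV: "C \<in> V" by (rule ampleD(2)[OF V X mcD(1)])
  have "\<not> (\<forall>v\<in>C. chi {u \<in> C. near C (Suc r) v u} \<le> d * N + d)"
    using D CV C by (meson not_less_eq_eq)
  then obtain v where v: "v \<in> C" "d * N + d < chi {u \<in> C. near C (Suc r) v u}"
    by (auto simp: not_le)
  have ball: "chi {u \<in> X. near X r v u} \<le> d" using world[OF X] v(1) mcD(1) unfolding world_def by blast
  define A where "A = {u \<in> C. near C (Suc r) v u} - {u \<in> X. near X r v u}"
  have fA: "finite A" using fC by (simp add: A_def)
  have cA: "d * N < chi A"
    using chi_diff[of "{u \<in> C. near C (Suc r) v u}" "{u \<in> X. near X r v u}"] fC fX v(2) ball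
    unfolding A_def by simp
  define B where "B = {z \<in> C. adj v z}"
  have "B \<subseteq> {u \<in> X. near X r v u}"
  proof
    fix z assume z: "z \<in> B"
    then have "near X 1 v z" using v(1) mcD(1) unfolding One_nat_def near_1 B_def by blast
    then have "near X r v z" using near_mono[of 1 r] r by simp
    then show "z \<in> {u \<in> X. near X r v u}" using near_in by blast
  qed
  then have cB: "chi B \<le> d" using chi_mono[of "{u \<in> X. near X r v u}" B] fX ball by simp
  have cov: "\<exists>t\<in>B. near X r t w" if w: "w \<in> A" for w
  proof -
    have nr: "near C (Suc r) v w" "\<not> near X r v w" using w mcD(1) unfolding A_def by auto
    then have "\<not> near C r v w" using near_subset[OF mcD(1)] by blast
    then obtain z where z: "adj v z" "near C r z w" using nr(1) by auto
    then have "z \<in> B" using near_in unfolding B_def by blast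
    then show ?thesis using near_subset[OF mcD(1) z(2)] by blast
  qed
  have fB: "finite B" using fC by (simp add: B_def)
  have "\<exists>T C'. T \<subseteq> B \<and> stable T \<and> C' \<subseteq> A \<and> N < chi C' \<and> (\<forall>w\<in>C'. \<exists>t\<in>T. near X r t w)"
    by (rule stable_cover_part[OF fA fB cB _ cA]) (rule cov)
  then obtain T C' where T: "T \<subseteq> B" "stable T" "C' \<subseteq> A" "N < chi C'" "\<forall>w\<in>C'. \<exists>t\<in>T. near X r t w"
    by (elim exE conjE) (rule that)
  have C'C: "C' \<subseteq> C" using T(3) unfolding A_def by blast
  have TC: "T \<subseteq> C" "\<forall>t\<in>T. adj v t" using T(1) unfolding B_def by auto
  have far: "x i \<noteq> u" "\<not> adj (x i) u" "t \<in> X \<Longrightarrow> adj (x i) t \<Longrightarrow> \<not> adj t u" if "i < n" "u \<in> C" for i u t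
  proof -
    have n: "\<not> near X r (x i) u" "x i \<in> X" using mcD(2)[OF that(1)] that(2) by auto
    have uX: "u \<in> X" using that(2) mcD(1) by blast
    have n2: "\<not> near X (Suc (Suc 0)) (x i) u"
      using n(1) near_mono[of "Suc (Suc 0)" r] r by auto
    have n1: "\<not> near X 1 (x i) u" using n(1) near_mono[of 1 r] r by auto
    then show "x i \<noteq> u" "\<not> adj (x i) u" using n(2) uX unfolding One_nat_def near_1 by auto
    show "\<not> adj t u" if "t \<in> X" "adj (x i) t"
    proof
      assume "adj t u"
      then have "near X (Suc 0) t u" using that uX by (simp add: near_1)
      from near_step[OF n(2) that(2) this] show False by (rule notE[OF n2])
    qed
  qed
  have "multicover X r {..<Suc n} (x(n := v)) (L(n := T)) C'"
    unfolding multicover_def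
  proof (intro conjI ballI impI)
    show "C' \<subseteq> X" using C'C mcD(1) by blast
    fix i assume i: "i \<in> {..<Suc n}"
    show "(x(n := v)) i \<in> X" "(L(n := T)) i \<subseteq> X" "stable ((L(n := T)) i)"
      using i mcD(2)[of i] v(1) TC(1) mcD(1) T(2) by (auto simp: less_Suc_eq)
    show "adj ((x(n := v)) i) t" if "t \<in> (L(n := T)) i" for t
      using i that mcD(2)[of i] TC(2) by (auto simp: less_Suc_eq)
    show "C' \<subseteq> reach X r ((L(n := T)) i)"
    proof (cases "i = n")
      case True
      then show ?thesis using T(5) C'C mcD(1) unfolding reach_def by auto
    next
      case False
      then have "i < n" using i by simp
      then show ?thesis using mcD(2)[of i] C'C False by auto
    qed
    show "\<not> near X r ((x(n := v)) i) u" if "u \<in> C'" for u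
    proof (cases "i = n")
      case True
      then show ?thesis using that T(3) near_in unfolding A_def by auto
    next
      case False
      then have "i < n" using i by simp
      then show ?thesis using mcD(2)[of i] C'C False that by auto
    qed
    fix j assume j: "j \<in> {..<Suc n}" "i \<noteq> j"
    consider "i < n" "j < n" | "i = n" "j < n" | "i < n" "j = n" using i j by (auto simp: less_Suc_eq)
    then have "(x(n := v)) i \<noteq> (x(n := v)) j \<and> \<not> adj ((x(n := v)) i) ((x(n := v)) j) \<and>
       (\<forall>t\<in>(L(n := T)) j. \<not> adj ((x(n := v)) i) t)"
    proof cases
      case 1
      then show ?thesis using mcD(3)[OF 1 j(2)] by simp
    next
      case 2
      have "v \<noteq> x j" "\<not> adj v (x j)" using far(1,2)[OF 2(2) v(1)] adj_sym by blast+
      moreover have "\<not> adj v t" if "t \<in> L j" for t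
        using far(3)[OF 2(2) v(1), of t] mcD(2)[OF 2(2)] that adj_sym by blast
      ultimately show ?thesis using 2 by simp
    next
      case 3
      have "\<not> adj (x i) t" if "t \<in> T" for t using far(2)[OF 3(1)] TC(1) that by blast
      then show ?thesis using 3 far(1,2)[OF 3(1) v(1)] by simp
    qed
    then show "(x(n := v)) i \<noteq> (x(n := v)) j" "\<not> adj ((x(n := v)) i) ((x(n := v)) j)"
      "\<And>t. t \<in> (L(n := T)) j \<Longrightarrow> \<not> adj ((x(n := v)) i) t" by auto
  qed simp
  then show ?case using X T(4) by (intro bexI[of _ X] exI conjI) auto
qed

text \<open>In a set of large chromatic number some ball of radius 2 is large, while balls of radius
  1 are bounded. So the second neighbourhood of its centre is large, and it is dominated by the
  neighbours of a clique of size one.\<close>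

lemma dense_1:
  assumes V: "ample V" and s: "bounded_by 2 V" and w: "\<And>X. X \<in> V \<Longrightarrow> world 1 d X"
  shows "dense 1 V"
  unfolding dense_def
proof
  fix D
  obtain c where c: "\<forall>X\<in>V. (\<forall>v\<in>X. chi {u \<in> X. near X 2 v u} \<le> D + d) \<longrightarrow> chi X \<le> c"
    using spec[OF s[unfolded bounded_by_def], of "D + d"] by (elim exE) (rule that)
  have "\<exists>K\<subseteq>X. clq K \<and> card K = 1 \<and> D \<le> chi (dominated X (cn K))" if X: "X \<in> V" "Suc c \<le> chi X" for X
  proof -
    have fX: "finite X" by (rule ampleD(1)[OF V X(1)])
    have "\<not> (\<forall>v\<in>X. chi {u \<in> X. near X 2 v u} \<le> D + d)" using c X by (meson not_less_eq_eq)
    then obtain v where v: "v \<in> X" "D + d < chi {u \<in> X. near X 2 v u}" by (auto simp: not_le)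
    have "{u \<in> X. near X 2 v u} \<subseteq> dominated X (cn {v}) \<union> {u \<in> X. near X 1 v u}"
      unfolding dominated_def cn_def numeral_2_eq_2 using near_in by fastforce
    then have "chi {u \<in> X. near X 2 v u} \<le> chi (dominated X (cn {v}) \<union> {u \<in> X. near X 1 v u})"
      using fX by (intro chi_mono) (auto simp: dominated_def)
    also have "\<dots> \<le> chi (dominated X (cn {v})) + chi {u \<in> X. near X 1 v u}"
      using fX by (intro chi_Un) (auto simp: dominated_def)
    finally have "D \<le> chi (dominated X (cn {v}))"
      using v(2) w[OF X(1)] v(1) unfolding world_def by fastforce
    then show ?thesis using v(1) by (intro exI[of _ "{v}"]) (auto simp: clq_def)
  qed
  then show "\<exists>c. \<forall>X\<in>V. c \<le> chi X \<longrightarrow> (\<exists>K\<subseteq>X. clq K \<and> card K = 1 \<and> D \<le> chi (dominated X (cn K)))"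
    by (intro exI[of _ "Suc c"]) blast
qed

definition burling_in :: "nat \<Rightarrow> 'v set \<Rightarrow> bool" where
  "burling_in k X \<longleftrightarrow> (\<exists>\<theta>. inj_on \<theta> (verts (graph (burling k))) \<and> \<theta> ` verts (graph (burling k)) \<subseteq> X \<and>
     (\<forall>u\<in>verts (graph (burling k)). \<forall>v\<in>verts (graph (burling k)).
        adj (\<theta> u) (\<theta> v) \<longleftrightarrow> {u, v} \<in> edges (graph (burling k))))"

lemma ample_bounded_cliques:
  assumes "ample V" "dense l V" and clq: "\<And>X K. X \<in> V \<Longrightarrow> K \<subseteq> X \<Longrightarrow> clq K \<Longrightarrow> card K \<le> w"
  shows "l \<le> w"
proof -
  obtain c where c: "\<forall>X\<in>V. c \<le> chi X \<longrightarrow> (\<exists>K\<subseteq>X. clq K \<and> card K = l \<and> 0 \<le> chi (dominated X (cn K)))"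
    using spec[OF assms(2)[unfolded dense_def], of 0] by (elim exE) (rule that)
  obtain X where "X \<in> V" "c \<le> chi X" using ampleD(3)[OF assms(1)] by blast
  then show ?thesis using c clq by blast
qed

text \<open>Both extremal parameters range over subfamilies: \<open>s\<close> is the least radius
  controlling some ample subfamily, \<open>h\<close> the largest clique size dense in some ample
  subfamily of \<open>V1\<close>. Hence the chosen subfamilies themselves fail at radius
  \<open>s - 1\<close> and at size \<open>Suc h\<close>, and these failures yield the constants
  \<open>d\<close> and \<open>D\<close> of the arena.\<close>

lemma ample_burling:
  assumes U: "ample U" and ctrl: "bounded_by \<rho> U"
    and clq: "\<And>X K. X \<in> U \<Longrightarrow> K \<subseteq> X \<Longrightarrow> clq K \<Longrightarrow> card K \<le> w"
    and loc: "\<And>X v. X \<in> U \<Longrightarrow> v \<in> X \<Longrightarrow> chi {u \<in> X. adj v u} \<le> \<tau>"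
    and mc: "\<And>r d. 0 < r \<Longrightarrow> r \<le> \<rho> \<Longrightarrow> \<exists>n0 D0. \<forall>X\<in>U. \<forall>I x L C.
      world r d X \<longrightarrow> multicover X r I x L C \<longrightarrow> n0 \<le> card I \<longrightarrow> chi C < D0"
  shows "\<exists>X\<in>U. burling_in (Suc (Suc k)) X"
proof -
  define good where "good s \<longleftrightarrow> (\<exists>V\<subseteq>U. ample V \<and> bounded_by s V)" for s
  have g\<rho>: "good \<rho>" unfolding good_def using U ctrl by blast
  define s where "s = (LEAST s. good s)"
  have gs: "good s" unfolding s_def using g\<rho> by (rule LeastI)
  have s\<rho>: "s \<le> \<rho>" unfolding s_def using g\<rho> by (rule Least_le)
  obtain V where V: "V \<subseteq> U" "ample V" "bounded_by s V"
    using gs unfolding good_def by (elim exE conjE) (rule that)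
  have s2: "2 \<le> s" by (rule ample_local[OF V(2,3)]) (use V(1) loc in blast)
  define r where "r = s - 1"
  have r: "s = Suc r" "0 < r" "r \<le> \<rho>" using s2 s\<rho> by (auto simp: r_def)
  have "\<not> good r" using not_less_Least[of r good] r(1) unfolding s_def[symmetric] by simp
  then have "\<not> bounded_by r V" unfolding good_def using V by blast
  then obtain d where d: "\<forall>D. \<exists>X\<in>V. (\<forall>v\<in>X. chi {u \<in> X. near X r v u} \<le> d) \<and> \<not> chi X \<le> D"
    unfolding bounded_by_def by auto
  \<comment> \<open>Radius \<open>r\<close> does not control \<open>V\<close>, so the members whose
    balls of radius \<open>r\<close> are bounded by \<open>d\<close> still have unbounded chromatic
    number.\<close>
  define V1 where "V1 = {X \<in> V. \<forall>v\<in>X. chi {u \<in> X. near X r v u} \<le> d}"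
  have V1V: "V1 \<subseteq> V" by (auto simp: V1_def)
  have V1U: "V1 \<subseteq> U" using V1V V(1) by blast
  have a1: "ample V1" unfolding ample_def
  proof (intro conjI ballI allI impI)
    show "finite X" if "X \<in> V1" for X using ampleD(1)[OF V(2)] V1V that by blast
    show "Y \<in> V1" if X: "X \<in> V1" and Y: "Y \<subseteq> X" for X Y
    proof -
      have fX: "finite X" using ampleD(1)[OF V(2)] V1V X by blast
      have "chi {u \<in> Y. near Y r v u} \<le> d" if v: "v \<in> Y" for v
      proof -
        have "chi {u \<in> Y. near Y r v u} \<le> chi {u \<in> X. near X r v u}"
          using fX Y near_subset[OF Y] by (intro chi_mono) auto
        also have "\<dots> \<le> d" using X Y v unfolding V1_def by blast
        finally show ?thesis .
      qed
      moreover have "Y \<in> V" using ampleD(2)[OF V(2)] X Y V1V by blast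
      ultimately show ?thesis unfolding V1_def by simp
    qed
    show "\<exists>X\<in>V1. n \<le> chi X" for n
    proof -
      obtain X where "X \<in> V" "\<forall>v\<in>X. chi {u \<in> X. near X r v u} \<le> d" "\<not> chi X \<le> n"
        using spec[OF d, of n] by (elim bexE conjE) (rule that)
      then show ?thesis by (intro bexI[of _ X]) (auto simp: V1_def)
    qed
  qed
  have b1: "bounded_by s V1" by (rule bounded_by_subset[OF V(3) V1V])
  have w1: "world r d X" if "X \<in> V1" for X
    using that ampleD(1)[OF a1 that] unfolding world_def V1_def by blast
  obtain n1 D1 where mc1: "\<forall>X\<in>U. \<forall>I x L C.
      world r d X \<longrightarrow> multicover X r I x L C \<longrightarrow> n1 \<le> card I \<longrightarrow> chi C < D1"
    using mc[OF r(2,3), of d] by (elim exE) (rule that)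
  \<comment> \<open>For \<open>r \<ge> 2\<close> the local bound would produce multicovers of any
    length over sets of any chromatic number, which \<open>mc1\<close> excludes.\<close>
  have r1: "r = 1"
  proof (rule ccontr)
    assume "r \<noteq> 1"
    then have "2 \<le> r" using r(2) by simp
    then have "\<exists>X\<in>V1. \<exists>x L C. multicover X r {..<n1} x L C \<and> D1 \<le> chi C"
      by (rule multicovers_of_local_bound[OF a1 b1[unfolded r(1)]]) (rule w1)
    then obtain X x L C where X: "X \<in> V1" "multicover X r {..<n1} x L C" "D1 \<le> chi C"
      by (elim bexE exE conjE) (rule that)
    have "chi C < D1" by (rule mc1[rule_format, OF _ w1[OF X(1)] X(2)]) (use V1U X(1) in auto)
    then show False using X(3) by simp
  qed
  have s2': "s = 2" using r(1) r1 by simp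
  define good2 where "good2 l \<longleftrightarrow> (\<exists>V\<subseteq>V1. ample V \<and> dense l V)" for l
  have g1: "good2 1" unfolding good2_def
  proof (intro exI conjI)
    show "dense 1 V1" by (rule dense_1[OF a1 b1[unfolded s2']]) (rule w1[unfolded r1])
  qed (auto simp: a1)
  have gw: "l \<le> w" if l: "good2 l" for l
  proof -
    obtain V where V: "V \<subseteq> V1" "ample V" "dense l V"
      using l unfolding good2_def by (elim exE conjE) (rule that)
    show ?thesis by (rule ample_bounded_cliques[OF V(2,3)]) (use clq V(1) V1U in blast)
  qed
  define h where "h = (GREATEST l. good2 l)"
  have gh: "good2 h" unfolding h_def by (rule GreatestI_nat[of good2 1 w]) (use g1 gw in auto)
  have h1: "1 \<le> h" unfolding h_def by (rule Greatest_le_nat[of good2 1 w]) (use g1 gw in auto)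
  have "\<not> good2 (Suc h)"
  proof
    assume "good2 (Suc h)"
    then have "Suc h \<le> h" unfolding h_def by (rule Greatest_le_nat) (use gw in auto)
    then show False by simp
  qed
  obtain V2 where V2: "V2 \<subseteq> V1" "ample V2" "dense h V2"
    using gh unfolding good2_def by (elim exE conjE) (rule that)
  have nd: "\<not> dense (Suc h) V2" using \<open>\<not> good2 (Suc h)\<close> V2 unfolding good2_def by blast
  define P where "P X D \<longleftrightarrow> (\<exists>K\<subseteq>X. clq K \<and> card K = Suc h \<and> D \<le> chi (dominated X (cn K)))" for X D
  have "\<exists>D. \<forall>c. \<exists>X\<in>V2. c \<le> chi X \<and> \<not> P X D"
    using nd unfolding dense_def P_def[symmetric] by blast
  then obtain D where D: "\<forall>c. \<exists>X\<in>V2. c \<le> chi X \<and> \<not> P X D"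
    by (elim exE) (rule that)
  \<comment> \<open>Density fails for \<open>Suc h\<close>, so the members of \<open>V2\<close> in
    which every clique of that size dominates only a bounded set have unbounded chromatic number;
    they form the family of the arena.\<close>
  define V3 where "V3 = {X \<in> V2. \<forall>K\<subseteq>X. clq K \<longrightarrow> card K = Suc h \<longrightarrow> chi (dominated X (cn K)) \<le> D}"
  have V32: "V3 \<subseteq> V2" by (auto simp: V3_def)
  have V3U: "V3 \<subseteq> U" using V32 V2(1) V1U by blast
  have fin: "finite X" if "X \<in> V3" for X using ampleD(1)[OF V2(2)] V32 that by blast
  have arena: "arena adj V3 h d D n1 D1"
  proof unfold_locales
    show "finite X" if "X \<in> V3" for X by (rule fin[OF that])
    show "Y \<in> V3" if X: "X \<in> V3" and Y: "Y \<subseteq> X" for X Y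
    proof -
      have "chi (dominated Y (cn K)) \<le> D" if K: "K \<subseteq> Y" "clq K" "card K = Suc h" for K
      proof -
        have "chi (dominated Y (cn K)) \<le> chi (dominated X (cn K))"
          using fin[OF X] Y by (intro chi_mono) (auto simp: dominated_def)
        also have "\<dots> \<le> D" using X K Y unfolding V3_def by blast
        finally show ?thesis .
      qed
      moreover have "Y \<in> V2" using ampleD(2)[OF V2(2)] X Y V32 by blast
      ultimately show ?thesis unfolding V3_def by simp
    qed
    show "\<exists>X\<in>V3. n \<le> chi X" for n
    proof -
      obtain X where "X \<in> V2" "n \<le> chi X"
"\<not> P X D"
        using spec[OF D, of n] by (elim bexE conjE) (rule that)
      then show ?thesis by (intro bexI[of _ X]) (auto simp: V3_def P_def)
    qed
    show "chi {u \<in> X. adj v u} \<le> d" if X: "X \<in> V3" and v: "v \<in> X" for X v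
    proof -
      have "chi {u \<in> X. adj v u} \<le> chi {u \<in> X. near X 1 v u}"
        using fin[OF X] v by (intro chi_mono) (auto simp: near_1)
      also have "\<dots> \<le> d" using w1[of X] X v V32 V2(1) unfolding world_def r1 by blast
      finally show ?thesis .
    qed
    show "0 < h" using h1 by simp
    show "\<exists>c. \<forall>X\<in>V3. c \<le> chi X \<longrightarrow> (\<exists>K\<subseteq>X. clq K \<and> card K = h \<and> E \<le> chi (dominated X (cn K)))" for E
      using dense_subset[OF V2(3) V32] unfolding dense_def by simp
    show "chi (dominated X (cn K)) \<le> D" if "X \<in> V3" "K \<subseteq> X" "clq K" "card K = Suc h" for X K
      using that unfolding V3_def by simp
    show "chi C < D1" if "X \<in> V3" "multicover X 1 I x L C" "n1 \<le> card I" for X I x L C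
    proof -
      have "X \<in> V1" "X \<in> U" using that(1) V32 V2(1) V3U by auto
      then show ?thesis using mc1[rule_format, OF _ w1] that(2,3) unfolding r1 by simp
    qed
  qed
  have "\<exists>X\<in>V3. burling_in (Suc (Suc k)) X"
    unfolding burling_in_def
    by (rule arena.hosted_marked_embeds[OF arena tidy_burling arena.hosted_burling[OF arena]])
  then show ?thesis using V3U by blast
qed

end

section \<open>Graph classes\<close>

lemma chi_slice:
  assumes G: "simple_graph G"
  shows "u.chi ({G} \<times> S) = chromatic_number (induced G S)"
proof -
  have e: "(\<exists>c. u.proper ({G} \<times> S) k c) \<longleftrightarrow> (\<exists>c. (\<forall>v\<in>S. c v < k) \<and>
      (\<forall>x\<in>S. \<forall>y\<in>S. {x, y} \<in> edges (induced G S) \<longrightarrow> c x \<noteq> (c y :: nat)))" for k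
  proof
    assume "\<exists>c. u.proper ({G} \<times> S) k c"
    then obtain c where "u.proper ({G} \<times> S) k c" by blast
    then show "\<exists>c. (\<forall>v\<in>S. c v < k) \<and> (\<forall>x\<in>S. \<forall>y\<in>S. {x, y} \<in> edges (induced G S) \<longrightarrow> c x \<noteq> (c y :: nat))"
      using G unfolding u.proper_def union_adj_def induced_def
      by (intro exI[of _ "\<lambda>v. c (G, v)"]) auto
  next
    assume "\<exists>c. (\<forall>v\<in>S. c v < k) \<and> (\<forall>x\<in>S. \<forall>y\<in>S. {x, y} \<in> edges (induced G S) \<longrightarrow> c x \<noteq> (c y :: nat))"
    then obtain c :: "'a \<Rightarrow> nat" where "\<forall>v\<in>S. c v < k"
      "\<forall>x\<in>S. \<forall>y\<in>S. {x, y} \<in> edges (induced G S) \<longrightarrow> c x \<noteq> c y" by blast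
    then show "\<exists>c. u.proper ({G} \<times> S) k c"
      unfolding u.proper_def union_adj_def induced_def
      by (intro exI[of _ "\<lambda>p. c (snd p)"]) auto
  qed
  have v: "verts (induced G S) = S" by (simp add: induced_def)
  show ?thesis unfolding u.chi_def chromatic_number_def v e ..
qed

lemma induced_induced: "T \<subseteq> S \<Longrightarrow> induced (induced G S) T = induced G T"
  unfolding induced_def by auto

lemma path_near:
  assumes G: "simple_graph G"
  shows "p \<noteq> [] \<Longrightarrow> set p \<subseteq> S \<Longrightarrow> (\<forall>i. Suc i < length p \<longrightarrow> {p ! i, p ! Suc i} \<in> edges (induced G S)) \<Longrightarrow>
    u.near ({G} \<times> S) (length p - 1) (G, hd p) (G, last p)"
proof (induction p)
  case (Cons a p)
  show ?case
  proof (cases p)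
    case Nil
    then show ?thesis using Cons.prems by simp
  next
    case (Cons b q)
    have ed: "\<forall>i. Suc i < length p \<longrightarrow> {p ! i, p ! Suc i} \<in> edges (induced G S)"
      using Cons.prems(3) by (metis length_Cons not_less_eq nth_Cons_Suc)
    have "u.near ({G} \<times> S) (length p - 1) (G, hd p) (G, last p)"
      using Cons.IH ed Cons.prems(2) Cons by simp
    then have nr: "u.near ({G} \<times> S) (length p - 1) (G, b) (G, last p)" using Cons by simp
    have "{a, b} \<in> edges (induced G S)" using Cons.prems(3) Cons by fastforce
    then have e: "union_adj (G, a) (G, b)" using G unfolding union_adj_def induced_def by simp
    have "(G, a) \<in> {G} \<times> S" using Cons.prems(2) by simp
    from u.near_step[OF this e nr] show ?thesis using Cons by (simp del: u.near.simps)
  qed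
qed simp

text \<open>A short path is a walk, so distance balls lie inside those of \<open>near\<close>. This
  is the direction wanted, as \<open>controlled\<close> asks for upper bounds on balls.\<close>

lemma closed_ball_near:
  assumes G: "simple_graph G" and x: "x \<in> closed_ball (induced G S) \<rho> v"
  shows "x \<in> S" "u.near ({G} \<times> S) \<rho> (G, v) (G, x)"
proof -
  let ?P = "{p. is_path (induced G S) p \<and> hd p = v \<and> last p = x}"
  have d: "gdist (induced G S) v x \<le> enat \<rho>" and xS: "x \<in> S"
    using x unfolding closed_ball_def by (auto simp: induced_def)
  show "x \<in> S" by (rule xS)
  have "\<exists>p\<in>?P. length p - 1 \<le> \<rho>"
  proof (rule ccontr)
    assume "\<not> ?thesis"
    then have "enat (Suc \<rho>) \<le> gdist (induced G S) v x"
      unfolding gdist_def by (intro INF_greatest) (auto simp: not_le)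
    then have "enat (Suc \<rho>) \<le> enat \<rho>" using d by (rule order_trans)
    then show False by simp
  qed
  then obtain p where p: "is_path (induced G S) p" "hd p = v" "last p = x" "length p - 1 \<le> \<rho>"
    by blast
  have "u.near ({G} \<times> S) (length p - 1) (G, hd p) (G, last p)"
    by (rule path_near[OF G]) (use p(1) in \<open>auto simp: is_path_def induced_def\<close>)
  then show "u.near ({G} \<times> S) \<rho> (G, v) (G, x)" using u.near_mono[OF p(4)] p(2,3) by simp
qed

lemma controlled_slice:
  assumes G: "simple_graph G" and ctrl: "controlled f \<rho> G" and S: "S \<subseteq> verts G" and c: "1 \<le> c"
    and ball: "\<And>v. v \<in> {G} \<times> S \<Longrightarrow> u.chi {x \<in> {G} \<times> S. u.near ({G} \<times> S) \<rho> v x} \<le> c"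
  shows "u.chi ({G} \<times> S) \<le> f c"
proof (cases "S = {}")
  case True
  then show ?thesis by simp
next
  case False
  have fS: "finite S" using S G finite_subset unfolding simple_graph_def by blast
  let ?H = "induced G S"
  have H: "induced_subgraph ?H G" unfolding induced_subgraph_def using S False by blast
  have v: "verts ?H = S" by (simp add: induced_def)
  have "chromatic_number (induced ?H (closed_ball ?H \<rho> x)) \<le> c" if x: "x \<in> S" for x
  proof -
    have sub: "closed_ball ?H \<rho> x \<subseteq> S" using closed_ball_near(1)[OF G] by blast
    have "chromatic_number (induced ?H (closed_ball ?H \<rho> x)) = u.chi ({G} \<times> closed_ball ?H \<rho> x)"
      by (simp add: induced_induced[OF sub] chi_slice[OF G])
    also have "\<dots> \<le> u.chi {y \<in> {G} \<times> S. u.near ({G} \<times> S) \<rho> (G, x) y}"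
      using closed_ball_near[OF G] fS by (intro u.chi_mono) auto
    also have "\<dots> \<le> c" using ball[of "(G, x)"] x by simp
    finally show ?thesis .
  qed
  then have "Max ((\<lambda>x. chromatic_number (induced ?H (closed_ball ?H \<rho> x))) ` verts ?H) \<le> c"
    using fS False v by (intro Max.boundedI) auto
  then have "chromatic_number ?H \<le> f c" using ctrl c H unfolding controlled_def by blast
  then show ?thesis by (simp add: chi_slice[OF G])
qed

lemma clq_slice:
  assumes G: "simple_graph G" and S: "S \<subseteq> verts G" "S \<noteq> {}" and K: "K \<subseteq> {G} \<times> S" "u.clq K"
  shows "card K \<le> clique_number (induced G S)"
proof -
  have fS: "finite S" using S(1) G finite_subset unfolding simple_graph_def by blast
  have inj: "inj_on snd K" using K(1) by (auto simp: inj_on_def)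
  have "clique (induced G S) (snd ` K)"
    unfolding clique_def
  proof (intro conjI ballI impI)
    show "snd ` K \<subseteq> verts (induced G S)" using K(1) by (auto simp: induced_def)
    fix x y assume xy: "x \<in> snd ` K" "y \<in> snd ` K" "x \<noteq> y"
    then have "(G, x) \<in> K" "(G, y) \<in> K" "x \<in> S" "y \<in> S" using K(1) by auto
    then have "union_adj (G, x) (G, y)" using K(2) xy(3) unfolding u.clq_def by simp
    then show "{x, y} \<in> edges (induced G S)"
      using \<open>x \<in> S\<close> \<open>y \<in> S\<close> by (simp add: union_adj_def induced_def)
  qed
  then have "card (snd ` K) \<in> {card K |K. clique (induced G S) K}" by blast
  moreover have "{card K |K. clique (induced G S) K} \<subseteq> card ` Pow S"
    by (auto simp: clique_def induced_def)
  then have "finite {card K |K. clique (induced G S) K}" using fS finite_subset by blast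
  ultimately have "card (snd ` K) \<le> clique_number (induced G S)"
    unfolding clique_number_def by (intro Max_ge)
  then show ?thesis using card_image[OF inj] by simp
qed

lemma burling_slice:
  assumes G: "simple_graph G" and S: "S \<subseteq> verts G" and k: "1 \<le> k" and B: "u.burling_in k ({G} \<times> S)"
  shows "k \<le> burling_number (induced G S)"
proof -
  have fS: "finite S" using S G finite_subset unfolding simple_graph_def by blast
  let ?B = "graph (burling k)" and ?H = "induced G S"
  obtain \<theta> where \<theta>: "inj_on \<theta> (verts ?B)" "\<theta> ` verts ?B \<subseteq> {G} \<times> S"
     "\<forall>x\<in>verts ?B. \<forall>y\<in>verts ?B. union_adj (\<theta> x) (\<theta> y) \<longleftrightarrow> {x, y} \<in> edges ?B"
    using B unfolding u.burling_in_def by (elim exE conjE) (rule that)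
  define \<phi> where "\<phi> x = snd (\<theta> x)" for x
  have \<theta>\<phi>: "\<theta> x = (G, \<phi> x)" "\<phi> x \<in> S" if "x \<in> verts ?B" for x
  proof -
    have "\<theta> x \<in> {G} \<times> S" using \<theta>(2) that by blast
    then show "\<theta> x = (G, \<phi> x)" "\<phi> x \<in> S" by (auto simp: \<phi>_def)
  qed
  have "verts ?B \<noteq> {}" using card_burling[of k] k by auto
  then have "induced_subgraph (induced ?H (\<phi> ` verts ?B)) ?H"
    unfolding induced_subgraph_def using \<theta>\<phi>(2) by (intro exI[of _ "\<phi> ` verts ?B"]) (auto simp: induced_def)
  moreover have "graph_iso ?B (induced ?H (\<phi> ` verts ?B))"
    unfolding graph_iso_def
  proof (intro exI[of _ \<phi>] conjI ballI)
    have "inj_on \<phi> (verts ?B)"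
    proof (rule inj_onI)
      fix x y assume xy: "x \<in> verts ?B" "y \<in> verts ?B" "\<phi> x = \<phi> y"
      then have "\<theta> x = \<theta> y" using \<theta>\<phi>(1) by simp
      then show "x = y" using \<theta>(1) xy by (simp add: inj_on_def)
    qed
    then show "bij_betw \<phi> (verts ?B) (verts (induced ?H (\<phi> ` verts ?B)))"
      by (simp add: bij_betw_def induced_def)
    fix x y assume xy: "x \<in> verts ?B" "y \<in> verts ?B"
    have "{x, y} \<in> edges ?B \<longleftrightarrow> union_adj (G, \<phi> x) (G, \<phi> y)" using \<theta>(3) xy \<theta>\<phi>(1) by simp
    also have "\<dots> \<longleftrightarrow> {\<phi> x, \<phi> y} \<in> edges G" using G by (simp add: union_adj_def)
    also have "\<dots> \<longleftrightarrow> {\<phi> x, \<phi> y} \<in> edges (induced ?H (\<phi> ` verts ?B))"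
      using xy \<theta>\<phi>(2) by (auto simp: induced_def)
    finally show "{x, y} \<in> edges ?B \<longleftrightarrow> {\<phi> x, \<phi> y} \<in> edges (induced ?H (\<phi> ` verts ?B))" .
  qed
  ultimately have "contains_induced ?B ?H" unfolding contains_induced_def by blast
  then have mem: "k \<in> {k. 1 \<le> k \<and> contains_induced (graph (burling k)) ?H}" using k by simp
  have "j \<le> card S" if j: "contains_induced (graph (burling j)) ?H" for j
  proof -
    obtain T \<psi> where "T \<subseteq> S" "bij_betw \<psi> (verts (graph (burling j))) T"
      using j unfolding contains_induced_def induced_subgraph_def graph_iso_def
      by (auto simp: induced_def)
    then have "card (verts (graph (burling j))) \<le> card S"
      using bij_betw_same_card card_mono[OF fS] by metis
    then show ?thesis using card_burling[of j] by linarith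
  qed
  then have "{k. 1 \<le> k \<and> contains_induced (graph (burling k)) ?H} \<subseteq> {..card S}" by blast
  then have "finite {k. 1 \<le> k \<and> contains_induced (graph (burling k)) ?H}"
    by (rule finite_subset) simp
  then show ?thesis unfolding burling_number_def using mem by (rule Max_ge)
qed

text \<open>A long multicover of a set of large chromatic number contains a spider with a root for
  each vertex of \<open>F\<close> and a point for each edge, hence a subdivision of
  \<open>F\<close>.\<close>

lemma no_long_multicovers:
  fixes F :: "'f ugraph" and \<X> :: "('a ugraph \<times> 'a) set set"
  assumes F: "simple_graph F" and r: "0 < r" "2 * r + 1 \<le> s"
    and X: "\<And>X. X \<in> \<X> \<Longrightarrow> \<exists>G. simple_graph G \<and> X \<subseteq> {G} \<times> verts G \<and>
      \<not> (\<exists>S :: 'a ugraph. le_subdivision s F S \<and> contains_induced S G)"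
    and clq: "\<And>X K. X \<in> \<X> \<Longrightarrow> K \<subseteq> X \<Longrightarrow> u.clq K \<Longrightarrow> card K \<le> w"
  shows "\<exists>n0 D0. \<forall>X\<in>\<X>. \<forall>I x L C. u.world r d X \<longrightarrow> u.multicover X r I x L C \<longrightarrow> n0 \<le> card I \<longrightarrow> u.chi C < D0"
proof -
  obtain n0 D0 where sp: "\<forall>(X :: ('a ugraph \<times> 'a) set) I x L C. u.world r d X \<longrightarrow> u.multicover X r I x L C \<longrightarrow>
      n0 \<le> card I \<longrightarrow> D0 \<le> u.chi C \<longrightarrow> (\<forall>K. u.clq K \<longrightarrow> K \<subseteq> (\<Union>i\<in>I. L i) \<longrightarrow> card K \<le> w) \<longrightarrow>
      u.spider X r (card (verts F)) I L C (card (edges F))"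
    using u.multicover_spider[OF r(1), of d w "card (verts F)" "card (edges F)"]
    by (elim exE) (rule that)
  have "u.chi C < D0" if XX: "X \<in> \<X>" and w: "u.world r d X" and mc: "u.multicover X r I x L C"
    and n: "n0 \<le> card I" for X I x L C
  proof (rule ccontr)
    assume "\<not> u.chi C < D0"
    then have big: "D0 \<le> u.chi C" by simp
    have "(\<Union>i\<in>I. L i) \<subseteq> X" using mc unfolding u.multicover_def by blast
    then have K: "card K \<le> w" if "u.clq K" "K \<subseteq> (\<Union>i\<in>I. L i)" for K
      using clq[OF XX _ that(1)] that(2) by blast
    have sp: "u.spider X r (card (verts F)) I L C (card (edges F))"
      by (rule sp[rule_format, OF w mc n big]) (rule K)
    obtain G where G: "simple_graph G" "X \<subseteq> {G} \<times> verts G"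
      "\<not> (\<exists>S :: 'a ugraph. le_subdivision s F S \<and> contains_induced S G)"
      using X[OF XX] by (elim exE conjE) (rule that)
    show False using spider_subdivision[OF F G(1,2) r(1) mc sp r(2)] G(3) by blast
  qed
  then show ?thesis by (intro exI[of _ n0] exI[of _ D0]) simp
qed

text \<open>Induction on the clique bound \<open>w\<close>: a neighbourhood has smaller cliques, so
  the induction hypothesis supplies the local bound \<open>\<tau>\<close>. Were the chromatic number
  unbounded on \<open>\<X>\<close>, this family would satisfy the assumptions of
  \<open>ample_burling\<close> and contain the excluded Burling graph.\<close>

lemma burling_free_bound:
  fixes F :: "'f ugraph" and \<G> :: "'a ugraph set"
  assumes F: "simple_graph F" and \<G>: "\<And>G. G \<in> \<G> \<Longrightarrow> simple_graph G"
    and ctrl: "\<And>G. G \<in> \<G> \<Longrightarrow> controlled f \<rho> G" and \<rho>: "2 * \<rho> + 1 \<le> s"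
    and sub: "\<And>G. G \<in> \<G> \<Longrightarrow> \<not> (\<exists>S :: 'a ugraph. le_subdivision s F S \<and> contains_induced S G)"
  shows "\<exists>B. \<forall>G\<in>\<G>. \<forall>X\<subseteq>{G} \<times> verts G. (\<forall>K\<subseteq>X. u.clq K \<longrightarrow> card K \<le> w) \<longrightarrow>
    \<not> u.burling_in (Suc (Suc k)) X \<longrightarrow> u.chi X \<le> B"
proof (induction w)
  case 0
  have "u.chi X \<le> 0" if "G \<in> \<G>" "X \<subseteq> {G} \<times> verts G" "\<forall>K\<subseteq>X. u.clq K \<longrightarrow> card K \<le> 0" for G X
  proof -
    have "X = {}"
    proof (rule ccontr)
      assume "X \<noteq> {}"
      then obtain v where v: "v \<in> X" by blast
      have "u.clq {v}" by (simp add: u.clq_def)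
      then have "card {v} \<le> 0" using that(3) v by blast
      then show False by simp
    qed
    then show ?thesis by simp
  qed
  then show ?case by blast
next
  case (Suc w)
  then obtain \<tau> where \<tau>: "\<forall>G\<in>\<G>. \<forall>X\<subseteq>{G} \<times> verts G. (\<forall>K\<subseteq>X. u.clq K \<longrightarrow> card K \<le> w) \<longrightarrow>
    \<not> u.burling_in (Suc (Suc k)) X \<longrightarrow> u.chi X \<le> \<tau>" by (elim exE) (rule that)
  define \<X> where "\<X> = {X. \<exists>G\<in>\<G>. X \<subseteq> {G} \<times> verts G \<and> (\<forall>K\<subseteq>X. u.clq K \<longrightarrow> card K \<le> Suc w) \<and>
    \<not> u.burling_in (Suc (Suc k)) X}"
  have XD: "\<exists>G\<in>\<G>. X \<subseteq> {G} \<times> verts G" "\<And>K. K \<subseteq> X \<Longrightarrow> u.clq K \<Longrightarrow> card K \<le> Suc w"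
    "\<not> u.burling_in (Suc (Suc k)) X" if "X \<in> \<X>" for X
    using that unfolding \<X>_def by auto
  have fin: "finite X" if X: "X \<in> \<X>" for X
  proof -
    obtain G where G: "G \<in> \<G>" "X \<subseteq> {G} \<times> verts G" using XD(1)[OF X] by blast
    have "finite ({G} \<times> verts G)" using \<G>[OF G(1)] by (simp add: simple_graph_def)
    then show ?thesis using G(2) finite_subset by blast
  qed
  have mono: "u.burling_in j X" if B: "u.burling_in j Y" and YX: "Y \<subseteq> X" for j X Y
  proof -
    obtain \<theta> where "inj_on \<theta> (verts (graph (burling j)))" "\<theta> ` verts (graph (burling j)) \<subseteq> Y"
      "\<forall>u\<in>verts (graph (burling j)). \<forall>v\<in>verts (graph (burling j)).
        union_adj (\<theta> u) (\<theta> v) \<longleftrightarrow> {u, v} \<in> edges (graph (burling j))"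
      using B unfolding u.burling_in_def by (elim exE conjE) (rule that)
    then show ?thesis using YX unfolding u.burling_in_def by (intro exI[of _ \<theta>]) auto
  qed
  have hered: "Y \<in> \<X>" if X: "X \<in> \<X>" and Y: "Y \<subseteq> X" for X Y
  proof -
    obtain G where G: "G \<in> \<G>" "X \<subseteq> {G} \<times> verts G" using XD(1)[OF X] by blast
    have "\<forall>K\<subseteq>Y. u.clq K \<longrightarrow> card K \<le> Suc w" using XD(2)[OF X] Y by (meson subset_trans)
    moreover have "\<not> u.burling_in (Suc (Suc k)) Y" using XD(3)[OF X] mono Y by blast
    ultimately show ?thesis using G subset_trans[OF Y G(2)] unfolding \<X>_def by blast
  qed
  have loc: "u.chi {x \<in> X. union_adj v x} \<le> \<tau>" if X: "X \<in> \<X>" and v: "v \<in> X" for X v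
  proof -
    let ?N = "{x \<in> X. union_adj v x}"
    have N: "?N \<in> \<X>" by (rule hered[OF X]) blast
    obtain G where G: "G \<in> \<G>" "?N \<subseteq> {G} \<times> verts G" using XD(1)[OF N] by blast
    have "card K \<le> w" if K: "K \<subseteq> ?N" "u.clq K" for K
    proof -
      have vK: "v \<notin> K" using K(1) u.adj_irr by blast
      have "union_adj v x \<and> union_adj x v" if "x \<in> K" for x using K(1) that u.adj_sym by blast
      then have "u.clq (insert v K)" using K(2) unfolding u.clq_def by blast
      moreover have "insert v K \<subseteq> X" using K(1) v by blast
      ultimately have "card (insert v K) \<le> Suc w" using XD(2)[OF X] by blast
      moreover have "finite K" using K(1) fin[OF N] finite_subset by blast
      ultimately show ?thesis using vK by simp
    qed
    then show ?thesis using \<tau>[rule_format, OF G(1,2)] XD(3)[OF N] by blast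
  qed
  have bnd: "u.bounded_by \<rho> \<X>"
    unfolding u.bounded_by_def
  proof
    fix c
    \<comment> \<open>Control is stated for positive bounds only, hence
      \<open>max 1 c\<close>.\<close>
    have "u.chi X \<le> f (max 1 c)" if X: "X \<in> \<X>" and b: "\<forall>v\<in>X. u.chi {x \<in> X. u.near X \<rho> v x} \<le> c" for X
    proof -
      obtain G where G: "G \<in> \<G>" "X \<subseteq> {G} \<times> verts G" using XD(1)[OF X] by blast
      define S where "S = snd ` X"
      have XS: "X = {G} \<times> S" "S \<subseteq> verts G" using G(2) by (force simp: S_def)+
      show ?thesis unfolding XS(1)
      proof (rule controlled_slice[OF \<G>[OF G(1)] ctrl[OF G(1)] XS(2)])
        show "1 \<le> max 1 c" by simp
        show "u.chi {x \<in> {G} \<times> S. u.near ({G} \<times> S) \<rho> v x} \<le> max 1 c" if "v \<in> {G} \<times> S" for v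
          using bspec[OF b[unfolded XS(1)] that] by linarith
      qed
    qed
    then show "\<exists>D. \<forall>X\<in>\<X>. (\<forall>v\<in>X. u.chi {x \<in> X. u.near X \<rho> v x} \<le> c) \<longrightarrow> u.chi X \<le> D" by blast
  qed
  have "\<exists>B. \<forall>X\<in>\<X>. u.chi X \<le> B"
  proof (rule ccontr)
    assume neg: "\<not> ?thesis"
    have "\<exists>X\<in>\<X>. n \<le> u.chi X" for n using neg by (meson nat_le_linear)
    then have amp: "u.ample \<X>" unfolding u.ample_def using fin hered by blast
    have "\<exists>X\<in>\<X>. u.burling_in (Suc (Suc k)) X"
    proof (rule u.ample_burling[OF amp bnd XD(2) loc])
      fix r d :: nat assume r: "0 < r" "r \<le> \<rho>"
      show "\<exists>n0 D0. \<forall>X\<in>\<X>. \<forall>I x L C. u.world r d X \<longrightarrow> u.multicover X r I x L C \<longrightarrow> n0 \<le> card I \<longrightarrow> u.chi C < D0"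
      proof (rule no_long_multicovers[OF F r(1), of s \<X> "Suc w"])
        show "2 * r + 1 \<le> s" using r(2) \<rho> by linarith
        show "\<exists>G. simple_graph G \<and> X \<subseteq> {G} \<times> verts G \<and>
            \<not> (\<exists>S :: 'a ugraph. le_subdivision s F S \<and> contains_induced S G)" if X: "X \<in> \<X>" for X
        proof -
          obtain G where G: "G \<in> \<G>" "X \<subseteq> {G} \<times> verts G" using XD(1)[OF X] by blast
          then show ?thesis using \<G>[OF G(1)] sub[OF G(1)] by (intro exI[of _ G]) simp
        qed
      qed (rule XD(2))
    qed
    then show False using XD(3) by blast
  qed
  then obtain B where B: "\<forall>X\<in>\<X>. u.chi X \<le> B" by blast
  have "u.chi X \<le> B" if "G \<in> \<G>" "X \<subseteq> {G} \<times> verts G" "\<forall>K\<subseteq>X. u.clq K \<longrightarrow> card K \<le> Suc w"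
    "\<not> u.burling_in (Suc (Suc k)) X" for G X
  proof -
    have "X \<in> \<X>" unfolding \<X>_def using that by blast
    then show ?thesis using B by blast
  qed
  then show ?case by blast
qed

theorem theorem1p5:
  fixes \<rho> :: nat and F :: "'f ugraph" and \<G> :: "nat ugraph set"
  assumes "\<rho> \<ge> 2"
    and "simple_graph F"
    and "graph_class \<G>"
    and "hereditary \<G>"
    and "controlled_class \<rho> \<G>"
    and "\<forall>G\<in>\<G>. \<not> (\<exists>S :: nat ugraph. le_subdivision (2 * \<rho> + 5) F S \<and> contains_induced S G)"
  shows "burling_controlled \<G>"
proof -
  have \<G>: "simple_graph G" if "G \<in> \<G>" for G using assms(3) that unfolding graph_class_def by blast
  obtain f where ctrl: "\<forall>G\<in>\<G>. controlled f \<rho> G" using assms(5) unfolding controlled_class_def by blast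
  have "\<exists>B. \<forall>G\<in>\<G>. \<forall>X\<subseteq>{G} \<times> verts G. (\<forall>K\<subseteq>X. u.clq K \<longrightarrow> card K \<le> w) \<longrightarrow>
    \<not> u.burling_in (Suc (Suc k)) X \<longrightarrow> u.chi X \<le> B" for w k
    by (rule burling_free_bound[OF assms(2) \<G>, of \<G> f \<rho> "2 * \<rho> + 5"]) (use ctrl assms(6) in auto)
  then obtain B where B: "\<And>w k G X. G \<in> \<G> \<Longrightarrow> X \<subseteq> {G} \<times> verts G \<Longrightarrow> (\<forall>K\<subseteq>X. u.clq K \<longrightarrow> card K \<le> w) \<Longrightarrow>
    \<not> u.burling_in (Suc (Suc k)) X \<Longrightarrow> u.chi X \<le> B w k" by metis
  \<comment> \<open>The maximum with 1 keeps the values of the bounding function positive.\<close>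
  define g where "g p = max 1 (B (fst p) (snd p))" for p
  have "chromatic_number H \<le> g (clique_number H, burling_number H)"
    if G: "G \<in> \<G>" and H: "induced_subgraph H G" for G H
  proof -
    obtain S where S: "S \<subseteq> verts G" "S \<noteq> {}" "H = induced G S"
      using H unfolding induced_subgraph_def by blast
    have "u.chi ({G} \<times> S) \<le> B (clique_number H) (burling_number H)"
    proof (rule B[OF G])
      show "{G} \<times> S \<subseteq> {G} \<times> verts G" using S(1) by blast
      show "\<forall>K\<subseteq>{G} \<times> S. u.clq K \<longrightarrow> card K \<le> clique_number H"
        using clq_slice[OF \<G>[OF G] S(1,2)] S(3) by blast
      \<comment> \<open>The index exceeds the Burling number of \<open>H\<close>, so this Burling
        graph cannot occur, and it is at least 2, where the recursion starts.\<close>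
      show "\<not> u.burling_in (Suc (Suc (burling_number H))) ({G} \<times> S)"
        using burling_slice[OF \<G>[OF G] S(1), of "Suc (Suc (burling_number H))"] S(3) by auto
    qed
    then show ?thesis by (simp add: g_def S(3) chi_slice[OF \<G>[OF G]])
  qed
  moreover have "g \<in> {1..} \<times> {1..} \<rightarrow> {1..}" by (auto simp: g_def)
  ultimately show ?thesis unfolding burling_controlled_def by blast
qed

end
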